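(* Let $\{X_n\}_{n\ge 0}$ be a Markov chain on $\mathbb T$ admitting a stationary probability measure $\mu$ whose transfer operator $\mathcal P_\mu$ satisfies, for some $C>0$, $\gamma\in(0,1)$ and every $k\ge 0$, $$\|\mathcal P_\mu^k\phi\|_{L^2(\mu)}\le C\gamma^k\|\phi\|_{L^2(\mu)}\qquad\forall \phi\in L^2(\mu)\text{ with }\int\phi\,d\mu=0 .$$ Let $\mathcal P_{\mu,N}$ be the $N$-fold tensor product of $\mathcal P_\mu$, let $\{H_N\}_N$ be a sequence of measurable sets $H_N\subset\mathbb T^N$ with $\mu_N(H_N)\to 0$ as $N\to\infty$, and let $\mathcal P_{\mu,H_N}(\phi)=\mathcal P_{\mu,N}(\phi\,1_{\mathbb T^N\setminus H_N})$. Then for all $p\in(1,\infty)$ and $\varepsilon\in(0,\tfrac1p)$ there exist $N_{p,\varepsilon}\in\mathbb N$, constants $C_{p,\varepsilon},\bar C_{p,\varepsilon}>0$ and $\theta_p\in(0,1)$ (with $\theta_p$ depending on $p$ but not on $\varepsilon$, and none of the constants depending on $N$) such that for all $N\ge N_{p,\varepsilon}$ the spectrum of $\mathcal P_{\mu,H_N}$ on $L^p(\mu_N)$ satisfies $$\sigma_{L^p(\mu_N)}(\mathcal P_{\mu,H_N})\subset B_{\theta_p}(0)\cup B_{\bar C_{p,\varepsilon}\mu_N(H_N)^{1-\varepsilon}}(1),$$ and there is a unique simple eigenvalue $\lambda_{N,p}\in B_{\bar C_{p,\varepsilon}\mu_N(H_N)^{1-\varepsilon}}(1)$ of $\mathcal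 P_{\mu,H_N}$ on $L^p(\mu_N)$; it has an associated non-negative eigenfunction $\psi_{N,p}$ which, normalized so that $\int\psi_{N,p}\,d\mu_N=1$, satisfies $$\|\psi_{N,p}-1\|_{L^p(\mu_N)}\le C_{p,\varepsilon}\,\mu_N(H_N)^{\frac1p-\varepsilon}.$$
   Context: $\mathbb T$ is the unit circle (one-dimensional torus). A Markov chain on $\mathbb T$ with transition kernel $p(x,\cdot)$ acts on finite measures by $\bar p(\nu)(A)=\int_{\mathbb T}p(x,A)\,d\nu(x)$; a stationary measure is a probability measure $\mu$ with $\bar p(\mu)=\mu$. The transfer operator with respect to a stationary measure $\mu$ is $\mathcal P_\mu:L^1(\mu)\to L^1(\mu)$, $\mathcal P_\mu(\phi)=\frac{d\,\bar p(\phi\,d\mu)}{d\mu}$ (well defined since $\bar p$ preserves absolute continuity with respect to $\mu$). For $N\ge1$, $\mu_N=\mu\otimes\cdots\otimes\mu$ ($N$ factors), and $\mathcal P_{\mu,N}$ is the unique bounded linear operator with $\mathcal P_{\mu,N}(\otimes_{i=1}^N\phi_i)=\otimes_{i=1}^N\mathcal P_\mu(\phi_i)$ for all $\phi_i\in L^1(\mu)$; it is the transfer operator, with respect to $\mu_N$, of $N$ independent copies of the chain, and it is a contraction on every $L^p(\mu_N)$, $p\ge1$. Spectra are taken on complex-valued function spaces. $B_r(z)\subset\mathbb C$ denotes the closed disk of radius $r\ge 0$ centred at $z$. "Simple" means algebraically simple. *)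

theory Defs
  imports "HOL-Probability.Probability"
begin

section \<open>Complex Lebesgue spaces and operators on them\<close>

text \<open>
  Elements of \<open>L\<^sup>p(M)\<close> are represented by functions; equality in \<open>L\<^sup>p(M)\<close> is equality almost
  everywhere. An operator acts on representatives, and every identity between its values is
  required almost everywhere only.
\<close>

definition Lp :: "real \<Rightarrow> 'a measure \<Rightarrow> ('a \<Rightarrow> complex) set" where
  "Lp p M = {f \<in> borel_measurable M. integrable M (\<lambda>x. norm (f x) powr p)}"

definition Lp_norm :: "real \<Rightarrow> 'a measure \<Rightarrow> ('a \<Rightarrow> complex) \<Rightarrow> real" where
  "Lp_norm p M f = (\<integral>x. norm (f x) powr p \<partial>M) powr (1 / p)"

text \<open>
  Compatibility with almost-everywhere equality is not listed below because it follows: if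
  \<open>f = g\<close> almost everywhere then \<open>f - g\<close> has norm 0, and so has its image.
\<close>

definition Lp_bounded_linear ::
    "real \<Rightarrow> 'a measure \<Rightarrow> (('a \<Rightarrow> complex) \<Rightarrow> ('a \<Rightarrow> complex)) \<Rightarrow> bool" where
  "Lp_bounded_linear p M A \<longleftrightarrow>
     (\<forall>f\<in>Lp p M. A f \<in> Lp p M) \<and>
     (\<forall>f\<in>Lp p M. \<forall>g\<in>Lp p M. AE x in M. A (\<lambda>y. f y + g y) x = A f x + A g x) \<and>
     (\<forall>c. \<forall>f\<in>Lp p M. AE x in M. A (\<lambda>y. c * f y) x = c * A f x) \<and>
     (\<exists>B. \<forall>f\<in>Lp p M. Lp_norm p M (A f) \<le> B * Lp_norm p M f)"

definition shifted ::
    "complex \<Rightarrow> (('a \<Rightarrow> complex) \<Rightarrow> ('a \<Rightarrow> complex)) \<Rightarrow> ('a \<Rightarrow> complex) \<Rightarrow> ('a \<Rightarrow> complex)" where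
  "shifted z A f = (\<lambda>x. z * f x - A f x)"

text \<open>
  \<open>z\<close> is in the resolvent set iff \<open>z - A\<close> is an invertible element of the algebra of bounded
  operators on \<open>L\<^sup>p(M)\<close>. In particular the spectrum of an \<open>A\<close> that does not act boundedly on
  \<open>L\<^sup>p(M)\<close> is all of the complex plane.
\<close>

definition Lp_resolvent_set ::
    "real \<Rightarrow> 'a measure \<Rightarrow> (('a \<Rightarrow> complex) \<Rightarrow> ('a \<Rightarrow> complex)) \<Rightarrow> complex set" where
  "Lp_resolvent_set p M A =
     {z. Lp_bounded_linear p M (shifted z A) \<and>
         (\<exists>R. Lp_bounded_linear p M R \<and>
              (\<forall>f\<in>Lp p M. (AE x in M. R (shifted z A f) x = f x) \<and>
                           (AE x in M. shifted z A (R f) x = f x)))}"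

definition Lp_spectrum ::
    "real \<Rightarrow> 'a measure \<Rightarrow> (('a \<Rightarrow> complex) \<Rightarrow> ('a \<Rightarrow> complex)) \<Rightarrow> complex set" where
  "Lp_spectrum p M A = - Lp_resolvent_set p M A"

definition Lp_eigenvector ::
    "real \<Rightarrow> 'a measure \<Rightarrow> (('a \<Rightarrow> complex) \<Rightarrow> ('a \<Rightarrow> complex)) \<Rightarrow> complex \<Rightarrow> ('a \<Rightarrow> complex) \<Rightarrow> bool"
  where
  "Lp_eigenvector p M A z f \<longleftrightarrow>
     f \<in> Lp p M \<and> \<not> (AE x in M. f x = 0) \<and> (AE x in M. A f x = z * f x)"

definition Lp_eigenvalue ::
    "real \<Rightarrow> 'a measure \<Rightarrow> (('a \<Rightarrow> complex) \<Rightarrow> ('a \<Rightarrow> complex)) \<Rightarrow> complex \<Rightarrow> bool" where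
  "Lp_eigenvalue p M A z \<longleftrightarrow> (\<exists>f. Lp_eigenvector p M A z f)"

definition Lp_generalized_eigenspace ::
    "real \<Rightarrow> 'a measure \<Rightarrow> (('a \<Rightarrow> complex) \<Rightarrow> ('a \<Rightarrow> complex)) \<Rightarrow> complex \<Rightarrow> ('a \<Rightarrow> complex) set"
  where
  "Lp_generalized_eigenspace p M A z =
     {f \<in> Lp p M. \<exists>k. AE x in M. (shifted z A ^^ k) f x = 0}"

text \<open>Algebraic simplicity: the generalized eigenspace is one-dimensional.\<close>

definition Lp_simple_eigenvalue ::
    "real \<Rightarrow> 'a measure \<Rightarrow> (('a \<Rightarrow> complex) \<Rightarrow> ('a \<Rightarrow> complex)) \<Rightarrow> complex \<Rightarrow> bool" where
  "Lp_simple_eigenvalue p M A z \<longleftrightarrow>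
     Lp_eigenvalue p M A z \<and>
     (\<exists>f\<in>Lp_generalized_eigenspace p M A z. \<not> (AE x in M. f x = 0) \<and>
        (\<forall>g\<in>Lp_generalized_eigenspace p M A z. \<exists>c. AE x in M. g x = c * f x))"


section \<open>Markov chains and transfer operators\<close>

definition circle :: "complex measure" where
  "circle = restrict_space borel (sphere 0 1)"

text \<open>
  A Markov chain on \<open>S\<close> is given by its transition kernel \<open>K\<close>, where \<open>K x\<close> is the measure
  \<open>p(x, \<cdot>)\<close>; the action of the kernel on measures is \<^const>\<open>bind\<close>.
\<close>

definition markov_kernel :: "'a measure \<Rightarrow> ('a \<Rightarrow> 'a measure) \<Rightarrow> bool" where
  "markov_kernel S K \<longleftrightarrow> K \<in> S \<rightarrow>\<^sub>M prob_algebra S"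

definition stationary_measure :: "'a measure \<Rightarrow> ('a \<Rightarrow> 'a measure) \<Rightarrow> 'a measure \<Rightarrow> bool" where
  "stationary_measure S K \<mu> \<longleftrightarrow> prob_space \<mu> \<and> sets \<mu> = sets S \<and> \<mu> \<bind> K = \<mu>"

text \<open>
  The value on \<open>A\<close> of the image under the kernel of the complex measure \<open>\<phi> d\<mu>\<close>.
\<close>

definition kernel_image ::
    "('a \<Rightarrow> 'a measure) \<Rightarrow> 'a measure \<Rightarrow> ('a \<Rightarrow> complex) \<Rightarrow> 'a set \<Rightarrow> complex" where
  "kernel_image K \<mu> \<phi> A = (\<integral>x. complex_of_real (measure (K x) A) * \<phi> x \<partial>\<mu>)"

text \<open>
  The Radon-Nikodym derivative is spelled out because \<^const>\<open>RN_deriv\<close> covers non-negative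
  measures only. The choice is unique up to null sets; it is meaningful for integrable \<open>\<phi>\<close>.
\<close>

definition transfer_op ::
    "('a \<Rightarrow> 'a measure) \<Rightarrow> 'a measure \<Rightarrow> ('a \<Rightarrow> complex) \<Rightarrow> ('a \<Rightarrow> complex)" where
  "transfer_op K \<mu> \<phi> =
     (SOME \<psi>. integrable \<mu> \<psi> \<and>
              (\<forall>A\<in>sets \<mu>. (LINT x:A|\<mu>. \<psi> x) = kernel_image K \<mu> \<phi> A))"


section \<open>Tensor powers and the operator with a hole\<close>

definition power_measure :: "'a measure \<Rightarrow> nat \<Rightarrow> (nat \<Rightarrow> 'a) measure" where
  "power_measure M N = PiM {..<N} (\<lambda>_. M)"

definition tensor :: "nat \<Rightarrow> (nat \<Rightarrow> 'a \<Rightarrow> complex) \<Rightarrow> (nat \<Rightarrow> 'a) \<Rightarrow> complex" where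
  "tensor N \<phi> x = (\<Prod>i<N. \<phi> i (x i))"

text \<open>The choice is unique up to equality almost everywhere of the values.\<close>

definition tensor_power_op ::
    "'a measure \<Rightarrow> nat \<Rightarrow> (('a \<Rightarrow> complex) \<Rightarrow> ('a \<Rightarrow> complex))
      \<Rightarrow> ((nat \<Rightarrow> 'a) \<Rightarrow> complex) \<Rightarrow> ((nat \<Rightarrow> 'a) \<Rightarrow> complex)" where
  "tensor_power_op \<mu> N P =
     (SOME Q. Lp_bounded_linear 1 (power_measure \<mu> N) Q \<and>
        (\<forall>\<phi>. (\<forall>i<N. \<phi> i \<in> Lp 1 \<mu>) \<longrightarrow>
           (AE x in power_measure \<mu> N. Q (tensor N \<phi>) x = tensor N (\<lambda>i. P (\<phi> i)) x)))"

definition hole_op ::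
    "('a \<Rightarrow> 'a measure) \<Rightarrow> 'a measure \<Rightarrow> nat \<Rightarrow> (nat \<Rightarrow> 'a) set
      \<Rightarrow> ((nat \<Rightarrow> 'a) \<Rightarrow> complex) \<Rightarrow> ((nat \<Rightarrow> 'a) \<Rightarrow> complex)" where
  "hole_op K \<mu> N H \<phi> =
     tensor_power_op \<mu> N (transfer_op K \<mu>)
       (\<lambda>x. \<phi> x * indicator (space (power_measure \<mu> N) - H) x)"

end

theory Submission
  imports Defs
begin

text \<open>
  Write \<open>T\<close> for the tensor power, \<open>Q\<close> for the subtraction of the mean, and \<open>A\<close> for the operator
  with the hole. Since \<open>A = Q A\<close> plus an operator of rank one, everything follows from a bound
  \<open>\<parallel>(Q A)\<^sup>j\<parallel> \<le> K \<theta>\<^sup>j\<close> on \<open>L\<^sup>p\<close> that is uniform in \<open>N\<close>.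

  The gap on \<open>L\<^sup>2\<close>, written with the mean as an explicit term, passes from two factors to their
  product with the same constant. On \<open>L\<^sup>p\<close> it is combined with
  \<open>T\<^sup>n \<bar>f\<bar> \<le> (T\<^sup>n g)\<^sup>a (T\<^sup>n \<bar>f\<bar>\<^sup>p)\<^sup>b\<close>, where \<open>g = \<bar>f\<bar>\<^bsup>p/2\<^esup>\<close>, \<open>a = 2 (p - 1) / p\<^sup>2\<close>,
  \<open>b = 1 / p\<^sup>2\<close>: as \<open>T\<^sup>n g\<close> is close in \<open>L\<^sup>2\<close> to its mean, the functions \<open>T\<^sup>n \<bar>f\<bar>\<close> with \<open>f\<close> in the unit ball
  of \<open>L\<^sup>p\<close> are, up to a small error, bounded. On bounded functions smallness in \<open>L\<^sup>1\<close>, which the gap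
  gives, implies smallness in \<open>L\<^sup>p\<close>; hence a power of \<open>Q A\<close> is a contraction.

  For \<open>\<bar>z\<bar> > \<theta>\<close> the resolvent of \<open>A\<close> then exists unless \<open>z\<close> is a fixed point of a scalar function that
  contracts a disk around 1. The same estimate on \<open>L\<^sup>q\<close> with \<open>q\<close> near 1 locates the fixed point up to
  \<open>\<mu>\<^sub>N(H\<^sub>N)\<^bsup>1/q\<^esup>\<close>.
\<close>

text \<open>The obstacle: the hole is no small perturbation on L^p. Multiplication by the indicator
  of \<open>H\<close> has norm 1 as soon as \<open>H\<close> has positive measure, so
  \<open>A\<close> need not approach \<open>T\<close> in operator norm. Cutting is cheap only on
  bounded functions, where it costs the bound times the measure of \<open>H\<close> in L^1. Hence a
  power of \<open>T\<close> must first make functions bounded up to a small error, with constants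
  that do not see the space. The exponents come from homogeneity: |f| = g^a (|f|^p)^b forces a p / 2
  + b p = 1, which is also the Hoelder condition for |r|^a V^b to lie in L^p if r, the deviation of
  T^n g from its mean, is in L^2 and V = T^n |f|^p is in L^1. Then V^b lies in L^(1/b), a gain over
  L^p if b < 1 / p, while a + b <= 1 amounts to b >= 2 / p - 1. The choice b = 1 / p^2 meets both,
  the second because (1 - 1 / p)^2 >= 0. The decay rate is fixed by the estimate at p before epsilon
  is given; epsilon enters through q alone and so affects only the constants.\<close>

section \<open>Elementary inequalities for real powers\<close>

lemma powr_convex_ge0:
  fixes p u v x y :: real
  assumes "p \<ge> 1" "u \<ge> 0" "v \<ge> 0" "u + v = 1" "x \<ge> 0" "y \<ge> 0"
  shows "(u * x + v * y) powr p \<le> u * x powr p + v * y powr p"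
proof (cases "x = 0 \<or> y = 0")
  case True
  \<comment> \<open>With one point equal to 0 a single summand is left, and
    \<open>c powr p \<le> c\<close> for a weight c in [0,1] settles it.\<close>
  have *: "(c * w) powr p \<le> c * w powr p" if "0 \<le> c" "c \<le> 1" "w \<ge> 0" for c w :: real
  proof -
    have "c powr p \<le> c powr 1" if "c > 0"
      using that \<open>p \<ge> 1\<close> \<open>c \<le> 1\<close> by (intro powr_mono') auto
    then have "c powr p \<le> c" using that by (cases "c = 0") auto
    then show ?thesis using that by (simp add: powr_mult mult_right_mono)
  qed
  from True show ?thesis
    using *[of u x] *[of v y] assms by auto
next
  case False
  then show ?thesis
    using convex_onD[OF powr_convex[OF \<open>p \<ge> 1\<close>], of v x y] assms(2-6)
    by (subst (1 2) eq_diff_eq[of u 1 v, THEN iffD2]) auto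
qed

text \<open>Weighted AM-GM of three numbers, the third being 1 with the leftover weight 1 - a - b.
  The third slot is what makes Hoelder and Jensen on a probability space direct instances, because
  the constant 1 has integral 1.\<close>

lemma powr_weighted_am_gm:
  fixes a b x y :: real
  assumes "a \<ge> 0" "b \<ge> 0" "a + b \<le> 1" "x \<ge> 0" "y \<ge> 0"
  shows "x powr a * y powr b \<le> a * x + b * y + (1 - a - b)"
proof (cases "x = 0 \<or> y = 0")
  \<comment> \<open>Here \<open>0 powr a = 0\<close> for every a, including a = 0, so the left side
    vanishes.\<close>
  case True
  then show ?thesis using assms by auto
next
  case False
  then have pos: "x > 0" "y > 0" using assms by auto
  let ?m = "a * x + b * y + (1 - a - b)"
  have m0: "?m > 0"
    using assms pos by (smt (verit, best) mult_nonneg_nonneg mult_pos_pos)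
  \<comment> \<open>The bound \<open>ln t \<le> t - 1\<close> is taken at each of the three numbers
    divided by their mean \<open>?m\<close>; the weighted right sides add up to 0.\<close>
  have "ln (x/?m) \<le> x/?m - 1" "ln (y/?m) \<le> y/?m - 1" "ln (1/?m) \<le> 1/?m - 1"
    using pos m0 by (auto intro!: ln_le_minus_one)
  then have "a * ln (x/?m) + b * ln (y/?m) + (1-a-b) * ln (1/?m) \<le> a * (x/?m - 1) + b * (y/?m - 1) + (1-a-b) * (1/?m - 1)"
    using assms by (intro add_mono mult_left_mono) auto
  also have "\<dots> = (a * x + b * y + (1 - a - b)) * (1 / ?m) - 1"
    by (simp only: divide_inverse ring_distribs)
  also have "\<dots> = 0" using m0 by simp
  finally have "a * ln x + b * ln y \<le> ln ?m"
    using pos m0 by (simp add: ln_div algebra_simps)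
  then have "exp (a * ln x + b * ln y) \<le> ?m"
    using m0 by (metis exp_le_cancel_iff exp_ln)
  then show ?thesis using pos by (simp add: powr_def exp_add)
qed

section \<open>Lebesgue spaces\<close>

lemma LpI: "f \<in> borel_measurable M \<Longrightarrow> integrable M (\<lambda>x. norm (f x) powr p) \<Longrightarrow> f \<in> Lp p M"
  by (simp add: Lp_def)

lemma Lp_measurable[measurable_dest]: "f \<in> Lp p M \<Longrightarrow> f \<in> borel_measurable M"
  by (simp add: Lp_def)

lemma Lp_integrable_powr: "f \<in> Lp p M \<Longrightarrow> integrable M (\<lambda>x. norm (f x) powr p)"
  by (simp add: Lp_def)

lemma Lp_norm_nonneg[simp]: "Lp_norm p M f \<ge> 0"
  by (simp add: Lp_norm_def)

lemma Lp_norm_powr: "p > 0 \<Longrightarrow> Lp_norm p M f powr p = (\<integral>x. norm (f x) powr p \<partial>M)"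
  by (simp add: Lp_norm_def powr_powr)

lemma Lp_norm_le_iff: 
  assumes "p > 0" "c \<ge> 0"
  shows "Lp_norm p M f \<le> c \<longleftrightarrow> (\<integral>x. norm (f x) powr p \<partial>M) \<le> c powr p"
  using assms by (simp add: Lp_norm_powr[symmetric, OF assms(1)] powr_mono2 powr_less_mono2 not_le[symmetric])
    (metis Lp_norm_nonneg not_le powr_less_mono2 powr_mono2 less_imp_le)

lemma Lp_dominated:
  assumes "g \<in> Lp p M" "f \<in> borel_measurable M" "AE x in M. norm (f x) \<le> norm (g x)" "p > 0"
  shows "f \<in> Lp p M" "Lp_norm p M f \<le> Lp_norm p M g"
proof -
  have le: "AE x in M. norm (f x) powr p \<le> norm (g x) powr p"
    using assms(3) by eventually_elim (use \<open>p > 0\<close> in \<open>auto intro: powr_mono2\<close>)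
  have g: "integrable M (\<lambda>x. norm (g x) powr p)" using assms(1) by (rule Lp_integrable_powr)
  show f: "f \<in> Lp p M"
    using assms(2) le by (intro LpI Bochner_Integration.integrable_bound[OF g]) (auto)
  show "Lp_norm p M f \<le> Lp_norm p M g"
    unfolding Lp_norm_def using assms(4)
    by (intro powr_mono2 integral_mono_AE g Lp_integrable_powr[OF f] le integral_nonneg_AE) auto
qed

lemma Lp_cong_AE:
  assumes "g \<in> Lp p M" "f \<in> borel_measurable M" "AE x in M. f x = g x" "p > 0"
  shows "f \<in> Lp p M" 
  by (rule Lp_dominated(1)[OF assms(1,2) _ assms(4)]) (use assms(3) in auto)

lemma Lp_norm_cong_AE:
  assumes "f \<in> borel_measurable M" "g \<in> borel_measurable M" "AE x in M. f x = g x"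
  shows "Lp_norm p M f = Lp_norm p M g"
proof -
  have "(\<integral>x. norm (f x) powr p \<partial>M) = (\<integral>x. norm (g x) powr p \<partial>M)"
    using assms by (intro integral_cong_AE) auto
  then show ?thesis by (simp add: Lp_norm_def)
qed

lemma Lp_norm_cong: "(\<And>x. norm (f x) = norm (g x)) \<Longrightarrow> Lp_norm p M f = Lp_norm p M g"
  by (simp add: Lp_norm_def)

lemma Lp_scale:
  assumes "f \<in> Lp p M"
  shows "(\<lambda>x. c * f x) \<in> Lp p M"
  using assms by (auto simp: Lp_def norm_mult powr_mult)

lemma Lp_norm_scale:
  assumes "p > 0"
  shows "Lp_norm p M (\<lambda>x. c * f x) = norm c * Lp_norm p M f"
  using assms by (simp add: Lp_norm_def norm_mult powr_mult powr_powr integral_nonneg_AE)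

lemma Lp_norm_eq_0_iff:
  assumes "f \<in> Lp p M" "p > 0"
  shows "Lp_norm p M f = 0 \<longleftrightarrow> (AE x in M. f x = 0)"
  using assms integral_nonneg_eq_0_iff_AE[OF Lp_integrable_powr[OF assms(1)]]
  by (simp add: Lp_norm_def)

lemma Lp_zero[simp]: "(\<lambda>x. 0) \<in> Lp p M"
  by (simp add: Lp_def)

lemma Lp_norm_zero[simp]: "Lp_norm p M (\<lambda>x. 0) = 0"
  by (simp add: Lp_norm_def)

text \<open>Convexity at the midpoint: |f + g|^p is at most 2^p times the average of |f|^p and
  |g|^p.\<close>

lemma Lp_add:
  assumes "f \<in> Lp p M" "g \<in> Lp p M" "p \<ge> 1"
  shows "(\<lambda>x. f x + g x) \<in> Lp p M"
proof (rule LpI)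
  note [measurable] = assms(1,2)
  show "(\<lambda>x. f x + g x) \<in> borel_measurable M" by measurable
  have "integrable M (\<lambda>x. 2 powr p * (1/2 * norm (f x) powr p + 1/2 * norm (g x) powr p))"
    using assms by (auto dest!: Lp_integrable_powr)
  then show "integrable M (\<lambda>x. norm (f x + g x) powr p)"
  proof (rule Bochner_Integration.integrable_bound)
    show "AE x in M. norm (norm (f x + g x) powr p)
       \<le> norm (2 powr p * (1/2 * norm (f x) powr p + 1/2 * norm (g x) powr p))"
    proof (rule AE_I2)
      fix x
      have "norm (f x + g x) powr p \<le> (2 * (1/2 * norm (f x) + 1/2 * norm (g x))) powr p"
        using assms(3) by (intro powr_mono2) (auto intro: norm_triangle_ineq)
      also have "\<dots> = 2 powr p * (1/2 * norm (f x) + 1/2 * norm (g x)) powr p"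
        by (subst powr_mult) auto
      also have "\<dots> \<le> 2 powr p * (1/2 * norm (f x) powr p + 1/2 * norm (g x) powr p)"
        using assms(3) by (intro mult_left_mono powr_convex_ge0) auto
      finally show "norm (norm (f x + g x) powr p)
       \<le> norm (2 powr p * (1/2 * norm (f x) powr p + 1/2 * norm (g x) powr p))" by simp
    qed
  qed measurable
qed

text \<open>Minkowski from convexity alone: divided by the sum of the two norms, f + g is a convex
  combination, with weights \<open>?u\<close> and \<open>?v\<close>, of f and g scaled to norm 1,
  and the integral of its p-th power is at most \<open>?u + ?v = 1\<close>. Zero norms are split off
  because of the division.\<close>

lemma Lp_norm_triangle:
  assumes "f \<in> Lp p M" "g \<in> Lp p M" "p \<ge> 1"
  shows "Lp_norm p M (\<lambda>x. f x + g x) \<le> Lp_norm p M f + Lp_norm p M g"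
proof -
  note [measurable] = assms(1,2)
  let ?a = "Lp_norm p M f" and ?b = "Lp_norm p M g"
  have p: "p > 0" using assms by simp
  consider "?a = 0" | "?b = 0" | "?a > 0" "?b > 0"
    using Lp_norm_nonneg by (metis order_le_less)
  then show ?thesis
  proof cases
    case 1
    then have "AE x in M. f x = 0" using Lp_norm_eq_0_iff[OF assms(1) p] by simp
    then have "Lp_norm p M (\<lambda>x. f x + g x) = ?b"
      by (intro Lp_norm_cong_AE) auto
    then show ?thesis by simp
  next
    case 2
    then have "AE x in M. g x = 0" using Lp_norm_eq_0_iff[OF assms(2) p] by simp
    then have "Lp_norm p M (\<lambda>x. f x + g x) = ?a"
      by (intro Lp_norm_cong_AE) auto
    then show ?thesis by simp
  next
    case 3
    let ?u = "?a / (?a + ?b)" and ?v = "?b / (?a + ?b)"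
    let ?R = "\<lambda>x. (?a + ?b) powr p * (?u * (norm (f x) powr p / ?a powr p) + ?v * (norm (g x) powr p / ?b powr p))"
    have uv: "?u + ?v = 1" using 3 by (simp add: add_divide_distrib[symmetric])
    have "(\<integral>x. norm (f x + g x) powr p \<partial>M) \<le> (\<integral>x. ?R x \<partial>M)"
    proof (rule integral_mono)
      show "integrable M (\<lambda>x. norm (f x + g x) powr p)"
        using Lp_add[OF assms] by (rule Lp_integrable_powr)
      show "integrable M ?R" using assms by (auto dest!: Lp_integrable_powr)
      fix x
      have "norm (f x + g x) powr p \<le> ((?a + ?b) * (?u * (norm (f x) / ?a) + ?v * (norm (g x) / ?b))) powr p"
        using 3 p by (intro powr_mono2) (auto simp: divide_simps norm_triangle_ineq)
      also have "\<dots> = (?a + ?b) powr p * (?u * (norm (f x) / ?a) + ?v * (norm (g x) / ?b)) powr p"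
        using 3 by (subst powr_mult) auto
      also have "\<dots> \<le> (?a + ?b) powr p * (?u * (norm (f x) / ?a) powr p + ?v * (norm (g x) / ?b) powr p)"
        using 3 uv assms by (intro mult_left_mono powr_convex_ge0) auto
      finally show "norm (f x + g x) powr p \<le> ?R x"
        using 3 by (simp add: powr_divide)
    qed
    also have "\<dots> = (?a + ?b) powr p * (?u * ((\<integral>x. norm (f x) powr p \<partial>M) / ?a powr p)
                      + ?v * ((\<integral>x. norm (g x) powr p \<partial>M) / ?b powr p))"
      using assms by (auto dest!: Lp_integrable_powr)
    also have "\<dots> = (?a + ?b) powr p * (?u + ?v)"
      using 3 p by (simp add: Lp_norm_powr[symmetric])
    finally show ?thesis using uv 3 p by (subst Lp_norm_le_iff) auto
  qed
qed

lemma Lp_diff: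
  assumes "f \<in> Lp p M" "g \<in> Lp p M" "p \<ge> 1"
  shows "(\<lambda>x. f x - g x) \<in> Lp p M"
  using Lp_add[OF assms(1) Lp_scale[OF assms(2), of "-1"] assms(3)] by simp

lemma Lp_norm_triangle_diff:
  assumes "f \<in> Lp p M" "g \<in> Lp p M" "p \<ge> 1"
  shows "Lp_norm p M (\<lambda>x. f x - g x) \<le> Lp_norm p M f + Lp_norm p M g"
  using Lp_norm_triangle[OF assms(1) Lp_scale[OF assms(2), of "-1"] assms(3)] 
    Lp_norm_scale[of p M "-1" g] assms(3) by simp

lemma Lp_sum:
  assumes "finite I" "\<And>i. i \<in> I \<Longrightarrow> f i \<in> Lp p M" "p \<ge> 1"
  shows "(\<lambda>x. \<Sum>i\<in>I. f i x) \<in> Lp p M"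
  using assms by (induction I) (auto intro!: Lp_add)

lemma Lp_norm_sum:
  assumes "finite I" "\<And>i. i \<in> I \<Longrightarrow> f i \<in> Lp p M" "p \<ge> 1"
  shows "Lp_norm p M (\<lambda>x. \<Sum>i\<in>I. f i x) \<le> (\<Sum>i\<in>I. Lp_norm p M (f i))"
  using assms
proof (induction I)
  case (insert i I)
  then have "Lp_norm p M (\<lambda>x. f i x + (\<Sum>i\<in>I. f i x)) \<le> Lp_norm p M (f i) + Lp_norm p M (\<lambda>x. \<Sum>i\<in>I. f i x)"
    by (intro Lp_norm_triangle Lp_sum) auto
  then show ?case using insert by fastforce
qed auto

lemma Lp_AE_eq_iff:
  assumes "f \<in> Lp p M" "g \<in> Lp p M" "p \<ge> 1"
  shows "(AE x in M. f x = g x) \<longleftrightarrow> Lp_norm p M (\<lambda>x. f x - g x) = 0"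
  using Lp_norm_eq_0_iff[OF Lp_diff[OF assms]] assms(3) by simp

text \<open>Plays the role of completeness: limits are built pointwise, and membership and norm
  bound are read off from the sequence. It serves the truncations in L^2 and the Neumann
  series.\<close>

lemma Lp_Fatou:
  assumes s: "\<And>n. s n \<in> Lp p M" and f: "f \<in> borel_measurable M" and p: "p > 0"
    and lim: "AE x in M. (\<lambda>n. s n x) \<longlonglongrightarrow> f x"
    and bd: "\<forall>\<^sub>F n in sequentially. Lp_norm p M (s n) \<le> c" and "c \<ge> 0"
  shows "f \<in> Lp p M" "Lp_norm p M f \<le> c"
proof -
  note [measurable] = s f
  have "(\<integral>\<^sup>+x. ennreal (norm (f x) powr p) \<partial>M) = (\<integral>\<^sup>+x. liminf (\<lambda>n. ennreal (norm (s n x) powr p)) \<partial>M)"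
  proof (rule nn_integral_cong_AE, use lim in eventually_elim)
    fix x assume "(\<lambda>n. s n x) \<longlonglongrightarrow> f x"
    then have "(\<lambda>n. ennreal (norm (s n x) powr p)) \<longlonglongrightarrow> ennreal (norm (f x) powr p)"
      using p by (intro tendsto_intros) (auto intro!: always_eventually)
    from lim_imp_Liminf[OF _ this]
    show "ennreal (norm (f x) powr p) = liminf (\<lambda>n. ennreal (norm (s n x) powr p))" by simp
  qed
  also have "\<dots> \<le> liminf (\<lambda>n. \<integral>\<^sup>+x. ennreal (norm (s n x) powr p) \<partial>M)"
    by (rule nn_integral_liminf) measurable
  also have "\<dots> \<le> ennreal (c powr p)"
  proof (rule Liminf_le)
    show "\<forall>\<^sub>F n in sequentially. (\<integral>\<^sup>+x. ennreal (norm (s n x) powr p) \<partial>M) \<le> ennreal (c powr p)"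
      using bd
    proof eventually_elim
      case (elim n)
      then show ?case
        using Lp_norm_le_iff[OF p \<open>c \<ge> 0\<close>]
        by (subst nn_integral_eq_integral) (auto intro!: ennreal_leI Lp_integrable_powr s)
    qed
  qed simp
  finally have le: "(\<integral>\<^sup>+x. ennreal (norm (f x) powr p) \<partial>M) \<le> ennreal (c powr p)" .
  have int: "integrable M (\<lambda>x. norm (f x) powr p)"
    by (rule integrableI_bounded) (use le in \<open>auto simp: top_unique intro: le_less_trans\<close>)
  then show "f \<in> Lp p M" using f by (rule LpI[rotated])
  show "Lp_norm p M f \<le> c"
    using le int \<open>c \<ge> 0\<close> p by (subst Lp_norm_le_iff) (auto simp: nn_integral_eq_integral)
qed

context prob_space begin

lemma Lp_const[simp]: "(\<lambda>x. c) \<in> Lp p M"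
  by (simp add: Lp_def)

lemma Lp_norm_const: "p > 0 \<Longrightarrow> Lp_norm p M (\<lambda>x. c) = norm c"
  by (simp add: Lp_norm_def powr_powr prob_space)

lemma Lp_bounded:
  assumes "f \<in> borel_measurable M" "AE x in M. norm (f x) \<le> c" "p > 0"
  shows "f \<in> Lp p M" "Lp_norm p M f \<le> c"
proof -
  have c: "c \<ge> 0"
  proof (rule ccontr)
    assume "\<not> c \<ge> 0"
    then have "norm (f x) \<le> c \<longleftrightarrow> False" for x
      using norm_ge_zero[of "f x"] by (auto simp del: norm_ge_zero)
    then have "AE x in M. False" using assms(2) by simp
    then show False using AE_False by simp
  qed
  have *: "AE x in M. norm (f x) \<le> norm (complex_of_real c)" using assms(2) c by simp
  show "f \<in> Lp p M" "Lp_norm p M f \<le> c"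
    using Lp_dominated[OF Lp_const assms(1) * assms(3)] Lp_norm_const[OF assms(3), of "complex_of_real c"] c by auto
qed

text \<open>AM-GM with \<open>b = 0\<close> and second entry 1 gives \<open>bd\<close>. Applied to f
  divided by its L^p norm and integrated over total mass 1, it bounds the integral of the q-th power
  by 1.\<close>

lemma Lp_mono:
  assumes "f \<in> Lp p M" "0 < q" "q \<le> p"
  shows "f \<in> Lp q M" "Lp_norm q M f \<le> Lp_norm p M f"
proof -
  note [measurable] = assms(1)
  have p: "p > 0" using assms by simp
  have bd: "t powr q \<le> q / p * t powr p + (1 - q / p)" if "t \<ge> 0" for t :: real
    using powr_weighted_am_gm[of "q/p" 0 "t powr p" 1] that assms p by (simp add: powr_powr)
  have int: "integrable M (\<lambda>x. q / p * (r * norm (f x)) powr p + (1 - q / p))" if "r \<ge> 0" for r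
    using Lp_integrable_powr[OF assms(1)] that by (simp add: powr_mult)
  show fq: "f \<in> Lp q M"
  proof (rule LpI)
    show "integrable M (\<lambda>x. norm (f x) powr q)"
      using int[of 1] bd assms p
      by (intro Bochner_Integration.integrable_bound[OF int[of 1]] AE_I2) (auto intro: order_trans)
  qed measurable
  show "Lp_norm q M f \<le> Lp_norm p M f"
  proof (cases "Lp_norm p M f = 0")
    case True
    then have "AE x in M. f x = 0" using Lp_norm_eq_0_iff[OF assms(1) p] by simp
    then have "Lp_norm q M f = 0" using Lp_norm_eq_0_iff[OF fq assms(2)] by simp
    then show ?thesis using True by simp
  next
    case False
    define a where "a = Lp_norm p M f"
    have a: "a > 0" using False by (simp add: a_def order_less_le)
    have "(\<integral>x. norm (f x) powr q \<partial>M) / a powr q = (\<integral>x. (norm (f x) / a) powr q \<partial>M)"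
      using a by (simp add: powr_divide)
    also have "\<dots> \<le> (\<integral>x. q / p * (norm (f x) / a) powr p + (1 - q / p) \<partial>M)"
      using int[of "1/a"] a Lp_integrable_powr[OF fq]
      by (intro integral_mono bd) (auto simp: powr_divide)
    also have "\<dots> = q / p * ((\<integral>x. norm (f x) powr p \<partial>M) / a powr p) + (1 - q / p)"
      using Lp_integrable_powr[OF assms(1)] a by (simp add: powr_divide prob_space)
    also have "\<dots> = 1" using a p by (simp add: Lp_norm_powr[OF p, symmetric] a_def[symmetric])
    finally have "(\<integral>x. norm (f x) powr q \<partial>M) \<le> a powr q" using a by (simp add: divide_simps)
    then show ?thesis using assms a by (subst Lp_norm_le_iff) (auto simp: a_def)
  qed
qed

lemma Lp_1_iff: "f \<in> Lp 1 M \<longleftrightarrow> integrable M f"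
  using integrable_norm_iff[of f M] by (auto simp: Lp_def)

lemma Lp_integrable: "f \<in> Lp p M \<Longrightarrow> p \<ge> 1 \<Longrightarrow> integrable M f"
  using Lp_mono(1)[of f p 1] by (auto simp: Lp_1_iff)

lemma Lp_norm_1: "Lp_norm 1 M f = (\<integral>x. norm (f x) \<partial>M)"
  by (simp add: Lp_norm_def powr_one integral_nonneg_AE)

lemma integral_norm_le_Lp_norm: "f \<in> Lp p M \<Longrightarrow> p \<ge> 1 \<Longrightarrow> (\<integral>x. norm (f x) \<partial>M) \<le> Lp_norm p M f"
  using Lp_mono(2)[of f p 1] by (simp add: Lp_norm_1)

lemma norm_integral_le_Lp_norm: "f \<in> Lp p M \<Longrightarrow> p \<ge> 1 \<Longrightarrow> norm (\<integral>x. f x \<partial>M) \<le> Lp_norm p M f"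
  by (rule order_trans[OF integral_norm_bound integral_norm_le_Lp_norm])

end

section \<open>The transfer operator of a stationary kernel\<close>

locale stationary_kernel = prob_space M for M :: "'a measure" +
  fixes K :: "'a \<Rightarrow> 'a measure"
  assumes kernel[measurable]: "K \<in> M \<rightarrow>\<^sub>M prob_algebra M"
    and stationary: "M \<bind> K = M"
begin

lemma kernel_subprob[measurable]: "K \<in> M \<rightarrow>\<^sub>M subprob_algebra M"
  using kernel by (rule measurable_prob_algebraD)

lemma kernel_prob_space: "x \<in> space M \<Longrightarrow> prob_space (K x)"
  using measurable_space[OF kernel] by (simp add: space_prob_algebra)

lemma sets_kernel[simp]: "x \<in> space M \<Longrightarrow> sets (K x) = sets M"
  using measurable_space[OF kernel] by (simp add: space_prob_algebra)

lemma space_kernel[simp]: "x \<in> space M \<Longrightarrow> space (K x) = space M"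
  using sets_eq_imp_space_eq[OF sets_kernel] .

lemma measure_kernel_measurable[measurable]:
  "A \<in> sets M \<Longrightarrow> (\<lambda>x. measure (K x) A) \<in> borel_measurable M"
  by (rule measurable_compose[OF kernel measurable_measure_prob_algebra])

lemma measure_kernel_le_1: "x \<in> space M \<Longrightarrow> measure (K x) A \<le> 1"
  using prob_space.prob_le_1[OF kernel_prob_space] by simp

lemma measure_kernel_space: "x \<in> space M \<Longrightarrow> measure (K x) (space M) = 1"
  using prob_space.prob_space[OF kernel_prob_space] by simp

lemma integral_measure_kernel:
  assumes "A \<in> sets M"
  shows "(\<integral>x. measure (K x) A \<partial>M) = measure M A"
proof -
  have "emeasure M A = (\<integral>\<^sup>+x. emeasure (K x) A \<partial>M)"
    using emeasure_bind[OF not_empty kernel_subprob assms] by (simp add: stationary)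
  also have "\<dots> = (\<integral>\<^sup>+x. ennreal (measure (K x) A) \<partial>M)"
    by (intro nn_integral_cong) (simp add: finite_measure.emeasure_eq_measure prob_space.finite_measure kernel_prob_space)
  finally show ?thesis
    using assms by (simp add: integral_eq_nn_integral measure_def)
qed

lemma integrable_kernel_mult:
  fixes \<phi> :: "'a \<Rightarrow> 'b::{banach,real_normed_algebra_1,second_countable_topology}"
  assumes "integrable M \<phi>" "A \<in> sets M"
  shows "integrable M (\<lambda>x. of_real (measure (K x) A) * \<phi> x)"
  by (rule Bochner_Integration.integrable_bound[OF assms(1)])
     (use assms in \<open>auto intro!: AE_I2 mult_left_le_one_le measure_kernel_le_1 
       order_trans[OF norm_mult_ineq]\<close>)

text \<open>Stationarity is what makes the image of f dM absolutely continuous: for a null set A the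
  integral of K x A over M is M A = 0, so K x A = 0 for almost every x. Radon-Nikodym then applies
  to nonnegative weights, and the complex case is assembled from four of them.\<close>

lemma kernel_density_ex:
  fixes f :: "'a \<Rightarrow> real"
  assumes f: "integrable M f" and nonneg: "AE x in M. f x \<ge> 0"
  obtains D where "integrable M D" "\<And>x. D x \<ge> 0"
    "\<And>A. A \<in> sets M \<Longrightarrow> (\<integral>x. indicator A x * D x \<partial>M) = (\<integral>x. measure (K x) A * f x \<partial>M)"
proof -
  note [measurable] = borel_measurable_integrable[OF f]
  define N where "N = density M (\<lambda>x. ennreal (f x)) \<bind> K"
  have K': "K \<in> density M (\<lambda>x. ennreal (f x)) \<rightarrow>\<^sub>M subprob_algebra M"
    by (simp add: measurable_cong_sets[OF sets_density refl] kernel_subprob)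
  have sets_N[simp]: "sets N = sets M"
    unfolding N_def using not_empty by (intro sets_bind) auto
  have em: "emeasure N A = (\<integral>\<^sup>+x. ennreal (f x) * emeasure (K x) A \<partial>M)" if [measurable]: "A \<in> sets M" for A
    unfolding N_def using not_empty that
    by (subst emeasure_bind[OF _ K']) (auto simp: nn_integral_density)
  have em': "emeasure N A = ennreal (\<integral>x. measure (K x) A * f x \<partial>M)" if A[measurable]: "A \<in> sets M" for A
  proof -
    have "emeasure N A = (\<integral>\<^sup>+x. ennreal (measure (K x) A * f x) \<partial>M)"
      unfolding em[OF A] 
      by (intro nn_integral_cong)
         (simp add: finite_measure.emeasure_eq_measure prob_space.finite_measure kernel_prob_space ennreal_mult'' mult.commute)
    also have "\<dots> = ennreal (\<integral>x. measure (K x) A * f x \<partial>M)"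
      using integrable_kernel_mult[OF f A] nonneg by (intro nn_integral_eq_integral) (auto elim!: eventually_mono)
    finally show ?thesis .
  qed
  have finN: "finite_measure N"
    by (rule finite_measureI) (simp add: em' sets_eq_imp_space_eq[OF sets_N])
  have ac: "absolutely_continuous M N"
    unfolding absolutely_continuous_def
  proof
    fix A assume A: "A \<in> null_sets M"
    then have [measurable]: "A \<in> sets M" by auto
    have "(\<integral>\<^sup>+x. emeasure (K x) A \<partial>M) = 0"
      using emeasure_bind[OF not_empty kernel_subprob, of A] A by (simp add: stationary null_setsD1)
    then have "AE x in M. emeasure (K x) A = 0"
      by (subst (asm) nn_integral_0_iff_AE) auto
    then have "emeasure N A = (\<integral>\<^sup>+x. 0 \<partial>M)"
      unfolding em[OF \<open>A \<in> sets M\<close>] by (intro nn_integral_cong_AE) (auto elim!: eventually_mono)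
    then show "A \<in> null_sets N" using A by (auto intro!: null_setsI)
  qed
  from real_RN_deriv[OF finN ac sets_N]
  obtain D where D[measurable]: "D \<in> borel_measurable M" and DD: "AE x in M. RN_deriv M N x = ennreal (D x)"
    and Dn: "\<And>x. 0 \<le> D x" by blast
  have emD: "emeasure N A = (\<integral>\<^sup>+x. ennreal (indicator A x * D x) \<partial>M)" if [measurable]: "A \<in> sets M" for A
  proof -
    have "emeasure N A = emeasure (density M (RN_deriv M N)) A"
      using density_RN_deriv[OF ac sets_N] by simp
    also have "\<dots> = (\<integral>\<^sup>+x. ennreal (indicator A x * D x) \<partial>M)"
      using DD by (auto simp: emeasure_density intro!: nn_integral_cong_AE elim!: eventually_mono split: split_indicator)
    finally show ?thesis .
  qed
  have intD: "integrable M D"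
  proof (rule integrableI_bounded)
    have "(\<integral>\<^sup>+x. ennreal (norm (D x)) \<partial>M) = emeasure N (space M)"
      unfolding emD[OF sets.top] by (intro nn_integral_cong) (auto simp: Dn)
    also have "\<dots> < \<infinity>" by (simp add: em')
    finally show "(\<integral>\<^sup>+x. ennreal (norm (D x)) \<partial>M) < \<infinity>" .
  qed simp
  show ?thesis
  proof (rule that[OF intD Dn])
    fix A assume A[measurable]: "A \<in> sets M"
    have "ennreal (\<integral>x. indicator A x * D x \<partial>M) = emeasure N A"
      unfolding emD[OF A] using integrable_mult_indicator[OF A intD]
      by (intro nn_integral_eq_integral[symmetric]) (auto simp: Dn)
    then show "(\<integral>x. indicator A x * D x \<partial>M) = (\<integral>x. measure (K x) A * f x \<partial>M)"
      unfolding em'[OF A] using nonneg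
      by (subst (asm) ennreal_inj) (auto intro!: integral_nonneg_AE simp: Dn elim!: eventually_mono)
  qed
qed

text \<open>The property under the choice in \<open>transfer_op\<close>. Under a name, it lets
  values of the operator be computed by exhibiting any function with this property, densities being
  unique almost everywhere.\<close>

definition is_transfer :: "('a \<Rightarrow> complex) \<Rightarrow> ('a \<Rightarrow> complex) \<Rightarrow> bool" where
  "is_transfer \<phi> \<psi> \<longleftrightarrow> integrable M \<psi> \<and> (\<forall>A\<in>sets M. (LINT x:A|M. \<psi> x) = kernel_image K M \<phi> A)"

lemma is_transfer_add:
  assumes "is_transfer \<phi> \<psi>" "is_transfer \<phi>' \<psi>'" "integrable M \<phi>" "integrable M \<phi>'"
  shows "is_transfer (\<lambda>x. \<phi> x + \<phi>' x) (\<lambda>x. \<psi> x + \<psi>' x)"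
  using assms integrable_kernel_mult[OF assms(3)] integrable_kernel_mult[OF assms(4)]
    integrable_mult_indicator[of _ M \<psi>] integrable_mult_indicator[of _ M \<psi>']
  by (auto simp: is_transfer_def kernel_image_def set_lebesgue_integral_def distrib_left scaleR_add_right)

lemma is_transfer_scale:
  assumes "is_transfer \<phi> \<psi>" "integrable M \<phi>"
  shows "is_transfer (\<lambda>x. c * \<phi> x) (\<lambda>x. c * \<psi> x)"
  using assms integrable_kernel_mult[OF assms(2)] 
  by (auto simp: is_transfer_def kernel_image_def set_lebesgue_integral_def mult.left_commute[of _ c])

text \<open>Gives more than existence: by almost-everywhere uniqueness the nonnegativity of
  \<open>D\<close> passes to \<open>transfer_op\<close>, which is where positivity of the operator
  comes from.\<close>

lemma is_transfer_nonneg_ex: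
  assumes "integrable M \<phi>" "AE x in M. \<phi> x \<in> \<real>\<^sub>\<ge>\<^sub>0"
  shows "\<exists>D. (\<forall>x. D x \<ge> 0) \<and> is_transfer \<phi> (\<lambda>x. complex_of_real (D x))"
proof -
  have "AE x in M. 0 \<le> Re (\<phi> x)" using assms(2) by (auto simp: complex_nonneg_Reals_iff)
  from kernel_density_ex[OF integrable_Re[OF assms(1)] this]
  obtain D where D: "integrable M D" "\<And>x. D x \<ge> 0"
    "\<And>A. A \<in> sets M \<Longrightarrow> (\<integral>x. indicator A x * D x \<partial>M) = (\<integral>x. measure (K x) A * Re (\<phi> x) \<partial>M)" by blast
  have "(LINT x:A|M. complex_of_real (D x)) = kernel_image K M \<phi> A" if A: "A \<in> sets M" for A
  proof -
    have "(LINT x:A|M. complex_of_real (D x)) = (\<integral>x. complex_of_real (indicator A x * D x) \<partial>M)"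
      unfolding set_lebesgue_integral_def by (intro Bochner_Integration.integral_cong) (auto simp: scaleR_conv_of_real)
    also have "\<dots> = complex_of_real (\<integral>x. measure (K x) A * Re (\<phi> x) \<partial>M)"
      by (simp only: integral_complex_of_real D(3)[OF A])
    also have "\<dots> = (\<integral>x. complex_of_real (measure (K x) A * Re (\<phi> x)) \<partial>M)"
      by (simp only: integral_complex_of_real)
    also have "\<dots> = kernel_image K M \<phi> A"
      unfolding kernel_image_def
    proof (rule integral_cong_AE)
      show "AE x in M. complex_of_real (measure (K x) A * Re (\<phi> x)) = complex_of_real (measure (K x) A) * \<phi> x"
        using assms(2) by eventually_elim (auto simp: complex_nonneg_Reals_iff complex_eq_iff)
    qed (use assms A in measurable)
    finally show ?thesis .
  qed
  then show ?thesis using D by (auto simp: is_transfer_def)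
qed

lemma is_transfer_real_ex:
  assumes "integrable M (f :: 'a \<Rightarrow> real)"
  shows "\<exists>\<psi>. is_transfer (\<lambda>x. complex_of_real (f x)) \<psi>"
proof -
  have i: "integrable M (\<lambda>x. complex_of_real (max 0 (f x)))" "integrable M (\<lambda>x. complex_of_real (max 0 (- f x)))"
    using assms by auto
  from is_transfer_nonneg_ex[OF i(1)] is_transfer_nonneg_ex[OF i(2)]
  obtain D D' where "is_transfer (\<lambda>x. complex_of_real (max 0 (f x))) (\<lambda>x. complex_of_real (D x))"
    "is_transfer (\<lambda>x. complex_of_real (max 0 (- f x))) (\<lambda>x. complex_of_real (D' x))"
    by (auto simp: complex_nonneg_Reals_iff)
  from is_transfer_add[OF this(1) is_transfer_scale[OF this(2) i(2), of "-1"] i(1)] i(2)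
  have "is_transfer (\<lambda>x. complex_of_real (max 0 (f x)) + - 1 * complex_of_real (max 0 (- f x))) (\<lambda>x. complex_of_real (D x) + - 1 * complex_of_real (D' x))"
    by simp
  moreover have "(\<lambda>x. complex_of_real (max 0 (f x)) + - 1 * complex_of_real (max 0 (- f x))) = (\<lambda>x. complex_of_real (f x))"
    by (auto simp: max_def)
  ultimately show ?thesis by auto
qed

lemma is_transfer_transfer_op:
  assumes "integrable M \<phi>"
  shows "is_transfer \<phi> (transfer_op K M \<phi>)"
proof -
  obtain \<psi>1 where 1: "is_transfer (\<lambda>x. complex_of_real (Re (\<phi> x))) \<psi>1"
    using is_transfer_real_ex[OF integrable_Re[OF assms]] by auto
  obtain \<psi>2 where 2: "is_transfer (\<lambda>x. complex_of_real (Im (\<phi> x))) \<psi>2"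
    using is_transfer_real_ex[OF integrable_Im[OF assms]] by auto
  have i: "integrable M (\<lambda>x. complex_of_real (Re (\<phi> x)))" "integrable M (\<lambda>x. complex_of_real (Im (\<phi> x)))"
    using assms by auto
  have "is_transfer (\<lambda>x. complex_of_real (Re (\<phi> x)) + \<i> * complex_of_real (Im (\<phi> x))) (\<lambda>x. \<psi>1 x + \<i> * \<psi>2 x)"
    using i by (intro is_transfer_add is_transfer_scale 1 2) auto
  then have "\<exists>\<psi>. is_transfer \<phi> \<psi>" by (auto simp: complex_eq[symmetric])
  then show ?thesis
    unfolding transfer_op_def is_transfer_def by (rule someI_ex)
qed

lemma transfer_op_integrable: "integrable M \<phi> \<Longrightarrow> integrable M (transfer_op K M \<phi>)"
  using is_transfer_transfer_op by (simp add: is_transfer_def)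

lemma transfer_op_AE_unique:
  assumes "integrable M \<phi>" "is_transfer \<phi> \<psi>"
  shows "AE x in M. transfer_op K M \<phi> x = \<psi> x"
  using is_transfer_transfer_op[OF assms(1)] assms(2)
  by (intro density_unique_banach) (auto simp: is_transfer_def)

lemma integral_transfer_op:
  assumes "integrable M \<phi>"
  shows "(\<integral>x. transfer_op K M \<phi> x \<partial>M) = (\<integral>x. \<phi> x \<partial>M)"
proof -
  have "(LINT x:space M|M. transfer_op K M \<phi> x) = kernel_image K M \<phi> (space M)"
    using is_transfer_transfer_op[OF assms] by (simp add: is_transfer_def)
  also have "\<dots> = (\<integral>x. \<phi> x \<partial>M)"
    unfolding kernel_image_def
    by (intro Bochner_Integration.integral_cong) (auto simp: measure_kernel_space)
  finally show ?thesis
    using transfer_op_integrable[OF assms] by (simp add: set_integral_space)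
qed

text \<open>Stationarity in terms of densities.\<close>

lemma is_transfer_one: "is_transfer (\<lambda>_. 1) (\<lambda>_. 1)"
proof -
  have "(\<integral>x. complex_of_real (measure (K x) A) \<partial>M) = complex_of_real (measure M A)" if "A \<in> sets M" for A
    using integral_measure_kernel[OF that] by simp
  then show ?thesis
    by (auto simp: is_transfer_def kernel_image_def set_lebesgue_integral_def scaleR_conv_of_real)
qed

end

section \<open>Abstract Markov operators\<close>

text \<open>The kernel is forgotten here. Positivity, preservation of the mean and T 1 = 1 give the
  L^p contraction and the pointwise Hoelder bounds, and the class is closed under composition;
  kernels return only for the tensorization. Identities hold almost everywhere because the operators
  in question are chosen representatives.\<close>

locale markov_op = prob_space M for M :: "'a measure" +
  fixes T :: "('a \<Rightarrow> complex) \<Rightarrow> 'a \<Rightarrow> complex"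
  assumes T_integrable: "integrable M f \<Longrightarrow> integrable M (T f)"
    and T_add: "integrable M f \<Longrightarrow> integrable M g \<Longrightarrow> AE x in M. T (\<lambda>x. f x + g x) x = T f x + T g x"
    and T_scale: "integrable M f \<Longrightarrow> AE x in M. T (\<lambda>x. c * f x) x = c * T f x"
    and T_integral: "integrable M f \<Longrightarrow> (\<integral>x. T f x \<partial>M) = (\<integral>x. f x \<partial>M)"
    and T_nonneg: "integrable M f \<Longrightarrow> AE x in M. f x \<in> \<real>\<^sub>\<ge>\<^sub>0 \<Longrightarrow> AE x in M. T f x \<in> \<real>\<^sub>\<ge>\<^sub>0"
    and T_one: "AE x in M. T (\<lambda>_. 1) x = 1"

context stationary_kernel begin

sublocale transfer: markov_op M "transfer_op K M"
proof
  fix f g :: "'a \<Rightarrow> complex" and c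
  assume f: "integrable M f"
  note [simp] = f transfer_op_integrable integral_transfer_op is_transfer_transfer_op
  show "integrable M (transfer_op K M f)" "(\<integral>x. transfer_op K M f x \<partial>M) = (\<integral>x. f x \<partial>M)" by simp_all
  show "AE x in M. transfer_op K M (\<lambda>x. c * f x) x = c * transfer_op K M f x"
    by (intro transfer_op_AE_unique is_transfer_scale) auto
  show "AE x in M. transfer_op K M (\<lambda>x. f x + g x) x = transfer_op K M f x + transfer_op K M g x" if "integrable M g"
    using that by (intro transfer_op_AE_unique is_transfer_add) auto
  assume "AE x in M. f x \<in> \<real>\<^sub>\<ge>\<^sub>0"
  then obtain D where D: "\<forall>x. D x \<ge> 0" "is_transfer f (\<lambda>x. complex_of_real (D x))"
    using is_transfer_nonneg_ex[OF f] by blast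
  from transfer_op_AE_unique[OF f D(2)] show "AE x in M. transfer_op K M f x \<in> \<real>\<^sub>\<ge>\<^sub>0"
    by eventually_elim (use D(1) in \<open>auto simp: complex_nonneg_Reals_iff\<close>)
next
  show "AE x in M. transfer_op K M (\<lambda>_. 1) x = 1"
    by (intro transfer_op_AE_unique is_transfer_one) auto
qed

end

section \<open>Hoelder's inequality on a probability space\<close>

context prob_space begin

text \<open>Weighted AM-GM integrated after scaling u and v to integral 1. With \<open>a + b\<close>
  below 1 the missing weight falls on the constant 1.\<close>

lemma holder_powr:
  fixes u v :: "'a \<Rightarrow> real"
  assumes u: "integrable M u" "\<And>x. u x \<ge> 0" and v: "integrable M v" "\<And>x. v x \<ge> 0"
    and ab: "a \<ge> 0" "b \<ge> 0" "a + b \<le> 1"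
  shows "integrable M (\<lambda>x. u x powr a * v x powr b)"
    and "(\<integral>x. u x powr a * v x powr b \<partial>M) \<le> (\<integral>x. u x \<partial>M) powr a * (\<integral>x. v x \<partial>M) powr b"
proof -
  note [measurable] = borel_measurable_integrable[OF u(1)] borel_measurable_integrable[OF v(1)]
  show int: "integrable M (\<lambda>x. u x powr a * v x powr b)"
  proof (rule Bochner_Integration.integrable_bound)
    show "integrable M (\<lambda>x. a * u x + b * v x + (1 - a - b))" using u v by auto
    show "AE x in M. norm (u x powr a * v x powr b) \<le> norm (a * u x + b * v x + (1 - a - b))"
      using powr_weighted_am_gm[OF ab u(2) v(2)] by (intro AE_I2) (auto intro: order_trans[OF _ abs_ge_self])
  qed measurable
  show "(\<integral>x. u x powr a * v x powr b \<partial>M) \<le> (\<integral>x. u x \<partial>M) powr a * (\<integral>x. v x \<partial>M) powr b"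
  proof (cases "(\<integral>x. u x \<partial>M) = 0 \<or> (\<integral>x. v x \<partial>M) = 0")
    case True
    then have "(AE x in M. u x = 0) \<or> (AE x in M. v x = 0)"
      using integral_nonneg_eq_0_iff_AE[OF u(1)] integral_nonneg_eq_0_iff_AE[OF v(1)] u v by auto
    then have "AE x in M. u x powr a * v x powr b = 0" by (auto elim!: eventually_mono)
    then have "(\<integral>x. u x powr a * v x powr b \<partial>M) = (\<integral>x. 0 \<partial>M)" by (intro integral_cong_AE) auto
    then show ?thesis using True by auto
  next
    case False
    define s where "s = (\<integral>x. u x \<partial>M)"
    define t where "t = (\<integral>x. v x \<partial>M)"
    have st: "s > 0" "t > 0"
      using False u v by (auto simp: s_def t_def order_less_le intro!: Bochner_Integration.integral_nonneg)
    have "(\<integral>x. u x powr a * v x powr b \<partial>M) / (s powr a * t powr b)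
        = (\<integral>x. (u x / s) powr a * (v x / t) powr b \<partial>M)"
      using st u v by (simp add: powr_divide field_simps)
    also have "\<dots> \<le> (\<integral>x. a * (u x / s) + b * (v x / t) + (1 - a - b) \<partial>M)"
    proof (rule integral_mono)
      show "integrable M (\<lambda>x. (u x / s) powr a * (v x / t) powr b)"
        using int st u v by (simp add: powr_divide)
      show "integrable M (\<lambda>x. a * (u x / s) + b * (v x / t) + (1 - a - b))" using u v by auto
      fix x show "(u x / s) powr a * (v x / t) powr b \<le> a * (u x / s) + b * (v x / t) + (1 - a - b)"
        using st u v ab by (intro powr_weighted_am_gm) auto
    qed
    also have "\<dots> = a * (s / s) + b * (t / t) + (1 - a - b)"
      using u v by (simp add: prob_space s_def t_def)
    also have "\<dots> = 1" using st by simp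
    finally show ?thesis using st by (simp add: s_def[symmetric] t_def[symmetric] divide_simps)
  qed
qed

lemma Cauchy_Schwarz_integral:
  fixes f g :: "'a \<Rightarrow> complex"
  assumes "f \<in> Lp 2 M" "g \<in> Lp 2 M"
  shows "integrable M (\<lambda>x. f x * g x)"
    and "norm (\<integral>x. f x * g x \<partial>M) \<le> Lp_norm 2 M f * Lp_norm 2 M g"
proof -
  note [measurable] = assms
  note h = holder_powr[of "\<lambda>x. norm (f x) powr 2" "\<lambda>x. norm (g x) powr 2" "1/2" "1/2"]
  have eq: "(norm (f x) powr 2) powr (1/2) * (norm (g x) powr 2) powr (1/2) = norm (f x * g x)" for x
    by (simp add: powr_powr norm_mult)
  have "integrable M (\<lambda>x. norm (f x * g x))"
    using h(1) assms unfolding eq by (auto dest!: Lp_integrable_powr)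
  then show "integrable M (\<lambda>x. f x * g x)"
    by (subst (asm) integrable_norm_iff) auto
  have "norm (\<integral>x. f x * g x \<partial>M) \<le> (\<integral>x. norm (f x * g x) \<partial>M)"
    by (rule integral_norm_bound)
  also have "\<dots> \<le> Lp_norm 2 M f * Lp_norm 2 M g"
    using h(2) assms unfolding eq by (auto dest!: Lp_integrable_powr simp: Lp_norm_def)
  finally show "norm (\<integral>x. f x * g x \<partial>M) \<le> Lp_norm 2 M f * Lp_norm 2 M g" .
qed

end

section \<open>Markov operators\<close>

context markov_op begin

lemma T_diff:
  assumes f: "integrable M f" and g: "integrable M g"
  shows "AE x in M. T (\<lambda>x. f x - g x) x = T f x - T g x"
proof -
  have "integrable M (\<lambda>x. - 1 * g x)" using g by simp
  from T_add[OF f this] T_scale[OF g, of "-1"] show ?thesis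
    by eventually_elim simp
qed

text \<open>If f = g almost everywhere, then f - g and g - f are both nonnegative almost everywhere,
  and positivity bounds T f - T g from both sides.\<close>

lemma T_cong_AE:
  assumes f: "integrable M f" and g: "integrable M g" and eq: "AE x in M. f x = g x"
  shows "AE x in M. T f x = T g x"
proof -
  have "AE x in M. f x - g x \<in> \<real>\<^sub>\<ge>\<^sub>0" "AE x in M. g x - f x \<in> \<real>\<^sub>\<ge>\<^sub>0"
    using eq by auto
  from this[THEN T_nonneg[rotated]] f g T_diff[OF f g] T_diff[OF g f] show ?thesis
    by (auto simp: complex_nonneg_Reals_iff complex_eq_iff elim!: eventually_elim2)
qed

text \<open>Order arguments are carried out on real functions; \<open>T_of_real\<close> justifies
  taking the real part.\<close>

definition Tr :: "('a \<Rightarrow> real) \<Rightarrow> 'a \<Rightarrow> real" where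
  "Tr f x = Re (T (\<lambda>x. complex_of_real (f x)) x)"

lemma Tr_integrable: "integrable M f \<Longrightarrow> integrable M (Tr f)"
  using T_integrable[of "\<lambda>x. complex_of_real (f x)"] by (auto simp: Tr_def[abs_def])

lemma Tr_nonneg: "integrable M f \<Longrightarrow> AE x in M. 0 \<le> f x \<Longrightarrow> AE x in M. 0 \<le> Tr f x"
  using T_nonneg[of "\<lambda>x. complex_of_real (f x)"] by (auto simp: Tr_def[abs_def] complex_nonneg_Reals_iff)

lemma T_of_real:
  assumes "integrable M f"
  shows "AE x in M. T (\<lambda>x. complex_of_real (f x)) x = complex_of_real (Tr f x)"
proof -
  let ?p = "\<lambda>x. complex_of_real (max 0 (f x))" and ?n = "\<lambda>x. complex_of_real (max 0 (- f x))"
  have eq: "(\<lambda>x. complex_of_real (f x)) = (\<lambda>x. ?p x - ?n x)"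
    by (auto simp: max_def)
  have i: "integrable M ?p" "integrable M ?n" using assms by auto
  have "AE x in M. T ?p x \<in> \<real>\<^sub>\<ge>\<^sub>0" "AE x in M. T ?n x \<in> \<real>\<^sub>\<ge>\<^sub>0"
    by (intro T_nonneg i; simp add: complex_nonneg_Reals_iff)+
  with T_diff[OF i] show ?thesis
    unfolding eq[symmetric] Tr_def
    by eventually_elim (auto simp: complex_nonneg_Reals_iff complex_eq_iff)
qed

lemma Tr_add:
  assumes "integrable M f" "integrable M g"
  shows "AE x in M. Tr (\<lambda>x. f x + g x) x = Tr f x + Tr g x"
  using T_add[of "\<lambda>x. complex_of_real (f x)" "\<lambda>x. complex_of_real (g x)"] assms
  by (auto simp: Tr_def[abs_def] elim!: eventually_mono)

lemma Tr_diff: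
  assumes "integrable M f" "integrable M g"
  shows "AE x in M. Tr (\<lambda>x. f x - g x) x = Tr f x - Tr g x"
  using T_diff[of "\<lambda>x. complex_of_real (f x)" "\<lambda>x. complex_of_real (g x)"] assms
  by (auto simp: Tr_def[abs_def] elim!: eventually_mono)

lemma Tr_scale:
  assumes "integrable M f"
  shows "AE x in M. Tr (\<lambda>x. c * f x) x = c * Tr f x"
  using T_scale[of "\<lambda>x. complex_of_real (f x)" "complex_of_real c"] assms
  by (auto simp: Tr_def[abs_def] elim!: eventually_mono)

lemma Tr_const: "AE x in M. Tr (\<lambda>_. c) x = c"
  using T_scale[of "\<lambda>_. 1" "complex_of_real c"] T_one
  by (auto simp: Tr_def[abs_def] elim!: eventually_elim2)

lemma Tr_integral:
  assumes "integrable M f" 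
  shows "(\<integral>x. Tr f x \<partial>M) = (\<integral>x. f x \<partial>M)"
proof -
  have i: "integrable M (\<lambda>x. complex_of_real (f x))" using assms by simp
  show ?thesis
    using arg_cong[OF T_integral[OF i], of Re] T_integrable[OF i]
    by (simp add: Tr_def[abs_def])
qed

lemma Tr_mono:
  assumes "integrable M f" "integrable M g" "AE x in M. f x \<le> g x"
  shows "AE x in M. Tr f x \<le> Tr g x"
proof -
  have "AE x in M. 0 \<le> Tr (\<lambda>x. g x - f x) x"
    using assms by (intro Tr_nonneg) auto
  with Tr_diff[OF assms(2,1)] show ?thesis by eventually_elim simp
qed

lemma T_Complex:
  assumes f: "integrable M f"
  shows "AE x in M. T f x = complex_of_real (Tr (\<lambda>x. Re (f x)) x) + \<i> * complex_of_real (Tr (\<lambda>x. Im (f x)) x)"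
proof -
  let ?r = "\<lambda>x. complex_of_real (Re (f x))" and ?i = "\<lambda>x. complex_of_real (Im (f x))"
  have i: "integrable M ?r" "integrable M ?i" "integrable M (\<lambda>x. \<i> * ?i x)" using f by auto
  have eq: "f = (\<lambda>x. ?r x + \<i> * ?i x)" by (simp add: complex_eq[symmetric])
  from T_add[OF i(1,3)] T_scale[OF i(2), of \<i>] 
    T_of_real[OF integrable_Re[OF f]] T_of_real[OF integrable_Im[OF f]]
  show ?thesis unfolding eq[symmetric] by eventually_elim simp
qed

text \<open>For one fixed c the bound on Re (c T f) follows from monotonicity, but the exceptional
  null set depends on c. So c runs through a countable dense set first; the set of violating c is
  open and misses it, hence is empty, and c = cnj (T f x) becomes available at each point. Where T f
  x = 0 that choice says nothing, and c = 1 gives the sign.\<close>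

lemma T_norm_le:
  assumes f: "integrable M f"
  shows "AE x in M. norm (T f x) \<le> Tr (\<lambda>x. norm (f x)) x"
proof -
  obtain D :: "complex set" where D: "countable D" "\<And>X. open X \<Longrightarrow> X \<noteq> {} \<Longrightarrow> \<exists>d\<in>D. d \<in> X"
    using countable_dense_exists by metis
  have "AE x in M. Re (c * T f x) \<le> norm c * Tr (\<lambda>x. norm (f x)) x" for c
  proof -
    have i: "integrable M (\<lambda>x. c * f x)" "integrable M (\<lambda>x. norm (f x))" using f by auto
    have "AE x in M. Tr (\<lambda>x. Re (c * f x)) x \<le> Tr (\<lambda>x. norm c * norm (f x)) x"
      by (intro Tr_mono integrable_Re AE_I2) (simp_all add: i norm_mult[symmetric] complex_Re_le_cmod del: times_complex.sel)
    with T_scale[OF f, of c] T_Complex[OF i(1)] Tr_scale[OF i(2), of "norm c"]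
    show ?thesis by eventually_elim (metis Re_complex_of_real Re_i_times Im_complex_of_real add.right_neutral minus_zero plus_complex.sel(1))
  qed
  then have "AE x in M. \<forall>c\<in>D. Re (c * T f x) \<le> norm c * Tr (\<lambda>x. norm (f x)) x"
    using D(1) by (simp add: AE_ball_countable)
  then show ?thesis
  proof eventually_elim
    case (elim x)
    let ?X = "{c. norm c * Tr (\<lambda>x. norm (f x)) x < Re (c * T f x)}"
    have "open ?X" by (intro open_Collect_less continuous_intros)
    then have "?X = {}" using D(2)[of ?X] elim by force
    then have "Re (cnj (T f x) * T f x) \<le> norm (T f x) * Tr (\<lambda>x. norm (f x)) x"
      by (metis (mono_tags, lifting) complex_mod_cnj empty_Collect_eq not_le)
    then have "norm (T f x) * norm (T f x) \<le> norm (T f x) * Tr (\<lambda>x. norm (f x)) x"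
      by (simp add: complex_norm_square[unfolded power2_eq_square, symmetric] mult.commute[of "cnj _"]
          flip: of_real_mult)
    moreover have "0 \<le> Tr (\<lambda>x. norm (f x)) x" if "T f x = 0"
    proof -
      have "Re (1 * T f x) \<le> norm (1::complex) * Tr (\<lambda>x. norm (f x)) x"
        using \<open>?X = {}\<close> by (metis (mono_tags, lifting) empty_Collect_eq not_le)
      then show ?thesis using that by simp
    qed
    ultimately show ?case
      by (cases "T f x = 0") auto
  qed
qed

lemma T_bounded:
  assumes f: "integrable M f" and le: "AE x in M. norm (f x) \<le> c"
  shows "AE x in M. norm (T f x) \<le> c"
proof -
  have "AE x in M. Tr (\<lambda>x. norm (f x)) x \<le> Tr (\<lambda>x. c) x"
    using f le by (intro Tr_mono) auto
  with T_norm_le[OF f] Tr_const[of c] show ?thesis by eventually_elim simp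
qed

text \<open>Pointwise Hoelder for a positive operator. AM-GM with parameters s, t linearizes the
  product, so linearity and monotonicity of \<open>Tr\<close> apply; the optimal s, t are the values
  of \<open>Tr u\<close> and \<open>Tr v\<close> at x, which vary with x. Rational parameters keep
  the exceptional sets countable, and the optimum is reached as a limit.\<close>

lemma Tr_powr_mult_le:
  fixes u v :: "'a \<Rightarrow> real"
  assumes u: "integrable M u" "\<And>x. u x \<ge> 0" and v: "integrable M v" "\<And>x. v x \<ge> 0"
    and ab: "a > 0" "b > 0" "a + b \<le> 1"
  shows "AE x in M. Tr (\<lambda>x. u x powr a * v x powr b) x \<le> Tr u x powr a * Tr v x powr b"
proof -
  have int: "integrable M (\<lambda>x. u x powr a * v x powr b)"
    using holder_powr(1)[OF u v] ab by simp
  have "AE x in M. Tr (\<lambda>x. u x powr a * v x powr b) x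
      \<le> s powr a * t powr b * (a * (Tr u x / s) + b * (Tr v x / t) + (1 - a - b))"
    if st: "s > 0" "t > 0" for s t
  proof -
    let ?k = "s powr a * t powr b"
    have i: "integrable M (\<lambda>x. ?k * a / s * u x)" "integrable M (\<lambda>x. ?k * b / t * v x)" using u v by auto
    have "AE x in M. Tr (\<lambda>x. u x powr a * v x powr b) x 
        \<le> Tr (\<lambda>x. (?k * a / s * u x + ?k * b / t * v x) + ?k * (1 - a - b)) x"
    proof (rule Tr_mono[OF int])
      show "AE x in M. u x powr a * v x powr b \<le> (?k * a / s * u x + ?k * b / t * v x) + ?k * (1 - a - b)"
      proof (rule AE_I2)
        fix x
        have "u x powr a * v x powr b = ?k * ((u x / s) powr a * (v x / t) powr b)"
          using st u v by (simp add: powr_divide)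
        also have "\<dots> \<le> ?k * (a * (u x / s) + b * (v x / t) + (1 - a - b))"
          using st u v ab by (intro mult_left_mono powr_weighted_am_gm) auto
        finally show "u x powr a * v x powr b \<le> (?k * a / s * u x + ?k * b / t * v x) + ?k * (1 - a - b)"
          by (simp add: algebra_simps)
      qed
    qed (use i in auto)
    with Tr_add[OF Bochner_Integration.integrable_add[OF i] integrable_const[of "?k * (1 - a - b)"]] Tr_add[OF i]
      Tr_scale[OF u(1), of "?k * a / s"] Tr_scale[OF v(1), of "?k * b / t"] Tr_const[of "?k * (1 - a - b)"]
    show ?thesis
    proof eventually_elim
      case (elim x)
      have "?k * a / s * Tr u x + ?k * b / t * Tr v x + ?k * (1 - a - b)
          = ?k * (a * (Tr u x / s) + b * (Tr v x / t) + (1 - a - b))"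
        by (simp only: distrib_left times_divide_eq_right times_divide_eq_left mult.assoc)
      with elim(6) show ?case unfolding elim(1-5) by (simp only:)
    qed
  qed
  note key = this
  define R where "R = {s::real. s \<in> \<rat> \<and> s > 0}"
  have cR: "countable R" unfolding R_def by (rule countable_subset[OF _ countable_rat]) auto
  have "AE x in M. \<forall>s\<in>R. \<forall>t\<in>R. Tr (\<lambda>x. u x powr a * v x powr b) x
      \<le> s powr a * t powr b * (a * (Tr u x / s) + b * (Tr v x / t) + (1 - a - b))"
    by (intro AE_ball_countable' key cR) (auto simp: R_def)
  moreover have "AE x in M. 0 \<le> Tr u x" "AE x in M. 0 \<le> Tr v x"
    using u v by (auto intro!: Tr_nonneg)
  ultimately show ?thesis
  proof eventually_elim
    case (elim x)
    let ?W = "Tr (\<lambda>x. u x powr a * v x powr b) x"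
    \<comment> \<open>The margin d keeps the parameters positive where \<open>Tr u x\<close> or
      \<open>Tr v x\<close> vanishes. Rational s, t above these values make the linear bracket at
      most 1.\<close>
    have le: "?W \<le> (Tr u x + d) powr a * (Tr v x + d) powr b" if d: "d > 0" for d
    proof -
      obtain s where s: "s \<in> \<rat>" "Tr u x < s" "s < Tr u x + d" using Rats_dense_in_real[of "Tr u x" "Tr u x + d"] d by auto
      obtain t where t: "t \<in> \<rat>" "Tr v x < t" "t < Tr v x + d" using Rats_dense_in_real[of "Tr v x" "Tr v x + d"] d by auto
      have "s > 0" "t > 0" using s t elim(2,3) by auto
      then have "?W \<le> s powr a * t powr b * (a * (Tr u x / s) + b * (Tr v x / t) + (1 - a - b))"
        using elim(1) s t by (auto simp: R_def)
      also have "\<dots> \<le> s powr a * t powr b * (a * 1 + b * 1 + (1 - a - b))"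
        using s t elim(2,3) ab by (intro mult_left_mono add_mono) (auto simp: divide_simps)
      also have "\<dots> \<le> (Tr u x + d) powr a * (Tr v x + d) powr b"
        using s t elim(2,3) ab by (auto intro!: mult_mono powr_mono2)
      finally show ?thesis .
    qed
    have "((\<lambda>d. (Tr u x + d) powr a * (Tr v x + d) powr b) \<longlongrightarrow> (Tr u x + 0) powr a * (Tr v x + 0) powr b) (at_right 0)"
      using elim(2,3) ab 
      by (intro tendsto_mult tendsto_powr' tendsto_add tendsto_const tendsto_ident_at disjI2 conjI)
         (auto intro!: eventually_mono[OF eventually_at_right_less])
    moreover have "\<forall>\<^sub>F d in at_right 0. ?W \<le> (Tr u x + d) powr a * (Tr v x + d) powr b"
      by (rule eventually_mono[OF eventually_at_right_less]) (rule le)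
    ultimately have "?W \<le> (Tr u x + 0) powr a * (Tr v x + 0) powr b"
      by (rule tendsto_lowerbound) simp
    then show ?case by simp
  qed
qed

text \<open>Jensen as an instance of Hoelder: u is the product of two equal factors (u^p)^(1/(2p)),
  whose exponents sum to 1 / p, and the rest of the weight falls on the constant 1.\<close>

lemma Tr_powr_le:
  fixes u :: "'a \<Rightarrow> real"
  assumes u: "integrable M (\<lambda>x. u x powr p)" "u \<in> borel_measurable M" "\<And>x. u x \<ge> 0" and p: "p \<ge> 1"
  shows "AE x in M. Tr u x powr p \<le> Tr (\<lambda>x. u x powr p) x"
proof -
  have eq: "(u x powr p) powr (1/(2*p)) * (u x powr p) powr (1/(2*p)) = u x" for x
    using p u(3)[of x] by (cases "u x = 0") (auto simp: powr_powr powr_add[symmetric] field_simps)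
  have "AE x in M. 0 \<le> Tr (\<lambda>x. u x powr p) x" using u by (intro Tr_nonneg) auto
  moreover have "integrable M u"
    using holder_powr(1)[OF u(1) _ u(1), of "1/(2*p)" "1/(2*p)"] p unfolding eq by (simp add: divide_simps)
  then have "AE x in M. 0 \<le> Tr u x" using u by (intro Tr_nonneg) auto
  moreover have "AE x in M. Tr u x \<le> Tr (\<lambda>x. u x powr p) x powr (1/(2*p)) * Tr (\<lambda>x. u x powr p) x powr (1/(2*p))"
    using Tr_powr_mult_le[OF u(1) _ u(1), of "1/(2*p)" "1/(2*p)"] p unfolding eq by (simp add: divide_simps)
  ultimately show ?thesis
  proof eventually_elim
    fix x assume *: "0 \<le> Tr (\<lambda>x. u x powr p) x" "0 \<le> Tr u x"
      "Tr u x \<le> Tr (\<lambda>x. u x powr p) x powr (1/(2*p)) * Tr (\<lambda>x. u x powr p) x powr (1/(2*p))" 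
    let ?v = "Tr (\<lambda>x. u x powr p) x"
    have "Tr u x powr p \<le> (?v powr (1/(2*p)) * ?v powr (1/(2*p))) powr p"
      using * p by (intro powr_mono2) auto
    also have "\<dots> = ?v"
      using p *(1) by (cases "?v = 0") (auto simp: powr_powr powr_add[symmetric] field_simps)
    finally show "Tr u x powr p \<le> ?v" .
  qed
qed

text \<open>Jensen bounds |T f|^p by T applied to |f|^p, and integration removes T because it
  preserves the mean.\<close>

lemma T_Lp:
  assumes f: "f \<in> Lp p M" and p: "p \<ge> 1"
  shows "T f \<in> Lp p M" "Lp_norm p M (T f) \<le> Lp_norm p M f"
proof -
  have fi: "integrable M f" using Lp_integrable[OF f p] .
  have pi: "integrable M (\<lambda>x. norm (f x) powr p)" using Lp_integrable_powr[OF f] .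
  have [measurable]: "T f \<in> borel_measurable M" "f \<in> borel_measurable M" using T_integrable[OF fi] fi by auto
  have le: "AE x in M. norm (T f x) powr p \<le> Tr (\<lambda>x. norm (f x) powr p) x"
    using T_norm_le[OF fi] Tr_powr_le[OF pi measurable_compose[OF Lp_measurable[OF f] borel_measurable_norm] norm_ge_zero p]
  proof eventually_elim
    case (elim x)
    have "norm (T f x) powr p \<le> Tr (\<lambda>x. norm (f x)) x powr p"
      using p elim(1) by (intro powr_mono2) auto
    then show ?case using elim(2) by simp
  qed
  have "integrable M (\<lambda>x. norm (T f x) powr p)"
    by (rule Bochner_Integration.integrable_bound[OF Tr_integrable[OF pi]]) (use le in auto)
  then show Tf: "T f \<in> Lp p M" by (intro LpI) auto
  have "(\<integral>x. norm (T f x) powr p \<partial>M) \<le> (\<integral>x. Tr (\<lambda>x. norm (f x) powr p) x \<partial>M)"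
    by (intro integral_mono_AE le Lp_integrable_powr[OF Tf] Tr_integrable pi)
  also have "\<dots> = (\<integral>x. norm (f x) powr p \<partial>M)" by (rule Tr_integral[OF pi])
  finally show "Lp_norm p M (T f) \<le> Lp_norm p M f"
    using p unfolding Lp_norm_def by (intro powr_mono2) (auto intro: integral_nonneg_AE)
qed

lemma markov_op_compose:
  assumes "markov_op M S"
  shows "markov_op M (\<lambda>f. T (S f))"
proof -
  interpret S: markov_op M S by fact
  note [simp] = S.T_integrable T_integrable S.T_integral T_integral
  show ?thesis
  proof
    fix f g :: "'a \<Rightarrow> complex" and c
    assume f: "integrable M f"
    show "integrable M (T (S f))" "(\<integral>x. T (S f) x \<partial>M) = (\<integral>x. f x \<partial>M)" using f by simp_all
    show "AE x in M. T (S (\<lambda>x. c * f x)) x = c * T (S f) x"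
      using T_cong_AE[OF _ _ S.T_scale[OF f, of c]] T_scale[of "S f" c] f by (auto elim!: eventually_elim2)
    show "AE x in M. T (S f) x \<in> \<real>\<^sub>\<ge>\<^sub>0" if "AE x in M. f x \<in> \<real>\<^sub>\<ge>\<^sub>0"
      using f that by (intro T_nonneg S.T_nonneg) auto
    assume g: "integrable M g"
    show "AE x in M. T (S (\<lambda>x. f x + g x)) x = T (S f) x + T (S g) x"
      using T_cong_AE[OF _ _ S.T_add[OF f g]] T_add[of "S f" "S g"] f g by (auto elim!: eventually_elim2)
  next
    show "AE x in M. T (S (\<lambda>_. 1)) x = 1"
      using T_cong_AE[OF _ _ S.T_one] T_one by (auto elim!: eventually_elim2)
  qed
qed

lemma markov_op_funpow: "markov_op M (T ^^ n)"
proof (induction n)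
  case 0
  show ?case by unfold_locales auto
next
  case (Suc n)
  from markov_op_compose[OF this] show ?case by (simp add: comp_def)
qed

end

section \<open>The dual operator on bounded functions\<close>

text \<open>Defined at every point, unlike the transfer operator, so sections and iterated integrals
  can be treated without null sets. This is why the gap is moved to this side before it is
  tensorized and moved back afterwards.\<close>

definition koopman :: "('a \<Rightarrow> 'a measure) \<Rightarrow> ('a \<Rightarrow> real) \<Rightarrow> 'a \<Rightarrow> real" where
  "koopman L f x = (\<integral>y. f y \<partial>L x)"

primrec kernel_power :: "'a measure \<Rightarrow> ('a \<Rightarrow> 'a measure) \<Rightarrow> nat \<Rightarrow> 'a \<Rightarrow> 'a measure" where
  "kernel_power M K 0 = return M"
| "kernel_power M K (Suc n) = (\<lambda>x. kernel_power M K n x \<bind> K)"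

definition bounded_measurable :: "'a measure \<Rightarrow> ('a \<Rightarrow> real) \<Rightarrow> bool" where
  "bounded_measurable M f \<longleftrightarrow> f \<in> borel_measurable M \<and> (\<exists>b. \<forall>x\<in>space M. \<bar>f x\<bar> \<le> b)"

text \<open>
  On mean-zero functions this is the bound \<open>\<kappa>\<close> for the operator norm on \<open>L\<^sup>2\<close>; the
  mean enters explicitly because the form below is the one that tensorizes.
\<close>

definition koopman_contracts :: "'a measure \<Rightarrow> ('a \<Rightarrow> 'a measure) \<Rightarrow> real \<Rightarrow> bool" where
  "koopman_contracts M L \<kappa> \<longleftrightarrow> (\<forall>f. bounded_measurable M f \<longrightarrow>
     (\<integral>x. (koopman L f x)\<^sup>2 \<partial>M) \<le> \<kappa>\<^sup>2 * (\<integral>x. (f x)\<^sup>2 \<partial>M) + (1 - \<kappa>\<^sup>2) * (\<integral>x. f x \<partial>M)\<^sup>2)"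

lemma bounded_measurableI:
  "f \<in> borel_measurable M \<Longrightarrow> (\<And>x. x \<in> space M \<Longrightarrow> \<bar>f x\<bar> \<le> b) \<Longrightarrow> bounded_measurable M f"
  by (auto simp: bounded_measurable_def)

lemma bounded_measurableD[measurable_dest]: "bounded_measurable M f \<Longrightarrow> f \<in> borel_measurable M"
  by (simp add: bounded_measurable_def)

lemma bounded_measurable_diff:
  assumes "bounded_measurable M f" "bounded_measurable M g"
  shows "bounded_measurable M (\<lambda>x. f x - g x)"
proof -
  from assms obtain b c where "\<forall>x\<in>space M. \<bar>f x\<bar> \<le> b" "\<forall>x\<in>space M. \<bar>g x\<bar> \<le> c"
    by (auto simp: bounded_measurable_def)
  then have "\<bar>f x - g x\<bar> \<le> b + c" if "x \<in> space M" for x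
    using that abs_triangle_ineq4[of "f x" "g x"] by fastforce
  then show ?thesis using assms by (intro bounded_measurableI[where b="b + c"]) (auto dest: bounded_measurableD)
qed

lemma bounded_measurable_mult:
  assumes "bounded_measurable M f" "bounded_measurable M g"
  shows "bounded_measurable M (\<lambda>x. f x * g x)"
proof -
  from assms obtain b c where bc: "\<forall>x\<in>space M. \<bar>f x\<bar> \<le> b" "\<forall>x\<in>space M. \<bar>g x\<bar> \<le> c"
    by (auto simp: bounded_measurable_def)
  have "\<bar>f x * g x\<bar> \<le> b * c" if "x \<in> space M" for x
    using that bc unfolding abs_mult by (intro mult_mono) (auto intro: order_trans[OF abs_ge_zero])
  then show ?thesis using assms by (intro bounded_measurableI[where b="b * c"]) (auto dest: bounded_measurableD)
qed

lemma bounded_measurable_const: "bounded_measurable M (\<lambda>_. c)"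
  by (auto simp: bounded_measurable_def)

lemma bounded_measurable_power2:
  "bounded_measurable M f \<Longrightarrow> bounded_measurable M (\<lambda>x. (f x)\<^sup>2)"
  using bounded_measurable_mult[of M f f] by (simp add: power2_eq_square)

lemma (in finite_measure) integrable_bounded_measurable:
  assumes "bounded_measurable M f"
  shows "integrable M f"
proof -
  obtain b where "\<forall>x\<in>space M. \<bar>f x\<bar> \<le> b" using assms by (auto simp: bounded_measurable_def)
  then show ?thesis
    using bounded_measurableD[OF assms] by (intro integrable_const_bound[where B=b]) auto
qed

lemma (in prob_space) integral_variance_eq:
  assumes "bounded_measurable M f"
  shows "(\<integral>x. (f x - (\<integral>x. f x \<partial>M))\<^sup>2 \<partial>M) = (\<integral>x. (f x)\<^sup>2 \<partial>M) - (\<integral>x. f x \<partial>M)\<^sup>2"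
  using assms by (intro variance_eq integrable_bounded_measurable bounded_measurable_power2)

context stationary_kernel begin

lemma bounded_measurable_kernel: 
  "bounded_measurable M f \<Longrightarrow> x \<in> space M \<Longrightarrow> bounded_measurable (K x) f"
  by (auto simp: bounded_measurable_def measurable_cong_sets[OF sets_kernel refl])

lemma integrable_kernel: "bounded_measurable M f \<Longrightarrow> x \<in> space M \<Longrightarrow> integrable (K x) f"
  by (intro finite_measure.integrable_bounded_measurable prob_space.finite_measure kernel_prob_space
      bounded_measurable_kernel)

lemma koopman_measurable[measurable]: "f \<in> borel_measurable M \<Longrightarrow> koopman K f \<in> borel_measurable M"
  unfolding koopman_def[abs_def]
  by (rule measurable_compose[OF kernel_subprob integral_measurable_subprob_algebra])

lemma koopman_abs_le:
  assumes "f \<in> borel_measurable M" "\<And>x. x \<in> space M \<Longrightarrow> \<bar>f x\<bar> \<le> b" "x \<in> space M"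
  shows "\<bar>koopman K f x\<bar> \<le> b"
proof -
  interpret Kx: prob_space "K x" using kernel_prob_space[OF assms(3)] .
  have i: "integrable (K x) f" using assms by (intro integrable_kernel bounded_measurableI) auto
  have "\<bar>koopman K f x\<bar> \<le> (\<integral>y. \<bar>f y\<bar> \<partial>K x)"
    unfolding koopman_def using integral_norm_bound[of "K x" f] by simp
  also have "\<dots> \<le> (\<integral>y. b \<partial>K x)"
    using assms i by (intro integral_mono) auto
  also have "\<dots> = b" by (simp add: Kx.prob_space[simplified])
  finally show ?thesis .
qed

lemma bounded_measurable_koopman:
  assumes "bounded_measurable M f"
  shows "bounded_measurable M (koopman K f)"
proof -
  obtain b where b: "\<And>x. x \<in> space M \<Longrightarrow> \<bar>f x\<bar> \<le> b"
    using assms by (auto simp: bounded_measurable_def)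
  show ?thesis
    using koopman_abs_le[OF bounded_measurableD[OF assms] b] bounded_measurableD[OF assms]
    by (intro bounded_measurableI[where b=b] koopman_measurable) auto
qed

lemma integrable_mult_bounded:
  assumes "integrable M \<phi>" "bounded_measurable M f"
  shows "integrable M (\<lambda>x. \<phi> x * complex_of_real (f x))"
proof -
  obtain b where b: "\<And>x. x \<in> space M \<Longrightarrow> \<bar>f x\<bar> \<le> b"
    using assms by (auto simp: bounded_measurable_def)
  have "integrable M (\<lambda>x. b * norm (\<phi> x))" using assms by auto
  then show ?thesis
    by (rule Bochner_Integration.integrable_bound)
       (use assms b in \<open>auto simp: norm_mult mult.commute[of b] dest!: bounded_measurableD
         intro!: AE_I2 mult_left_mono order_trans[OF _ abs_ge_self]\<close>)
qed

text \<open>For indicators the claim is the defining property of the transfer operator, and it is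
  extended by monotone induction. The bound \<open>b\<close> is generalized because scaling changes
  it.\<close>

lemma transfer_duality_nonneg:
  assumes \<phi>: "integrable M \<phi>" and f: "f \<in> borel_measurable M" "\<And>x. 0 \<le> f x"
    and bd: "\<And>x. x \<in> space M \<Longrightarrow> \<bar>f x\<bar> \<le> b"
  shows "(\<integral>x. transfer_op K M \<phi> x * complex_of_real (f x) \<partial>M) = (\<integral>x. \<phi> x * complex_of_real (koopman K f x) \<partial>M)"
  using f bd
proof (induction f arbitrary: b rule: borel_measurable_induct_real)
  case (set A b)
  have "(\<integral>x. transfer_op K M \<phi> x * complex_of_real (indicator A x) \<partial>M) = (LINT x:A|M. transfer_op K M \<phi> x)"
    by (auto simp: set_lebesgue_integral_def scaleR_conv_of_real mult.commute)
  also have "\<dots> = kernel_image K M \<phi> A"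
    using is_transfer_transfer_op[OF \<phi>] set by (auto simp: is_transfer_def)
  also have "\<dots> = (\<integral>x. \<phi> x * complex_of_real (koopman K (indicator A) x) \<partial>M)"
    unfolding kernel_image_def koopman_def 
    by (intro Bochner_Integration.integral_cong)
      (use set sets.sets_into_space[OF set(1)] in \<open>auto simp: mult.commute Int_absorb2\<close>)
  finally show ?case .
next
  case (mult u c b)
  show ?case
  proof (cases "c = 0")
    case True then show ?thesis by (simp add: koopman_def)
  next
    case False
    have "\<bar>u x\<bar> \<le> b / c" if "x \<in> space M" for x
      using mult.prems[OF that] False mult.hyps by (simp add: field_simps abs_mult)
    from mult.IH[OF this]
    show ?thesis by (simp add: koopman_def mult.left_commute[of _ "complex_of_real c"])
  qed
next
  case (add u v b)
  \<comment> \<open>Nonnegativity hands the bound on the sum down to each summand.\<close>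
  have b: "\<bar>u x\<bar> \<le> b" "\<bar>v x\<bar> \<le> b" if "x \<in> space M" for x
    using add.prems[OF that] add.hyps(2,4)[of x] by auto
  have bm: "bounded_measurable M u" "bounded_measurable M v"
    by (intro bounded_measurableI[where b=b] add.hyps b; assumption)+
  note i = integrable_mult_bounded[OF transfer_op_integrable[OF \<phi>]] integrable_mult_bounded[OF \<phi> bounded_measurable_koopman]
  have k: "koopman K (\<lambda>x. v x + u x) x = koopman K v x + koopman K u x" if "x \<in> space M" for x
    unfolding koopman_def using bm that by (intro Bochner_Integration.integral_add integrable_kernel)
  have "(\<integral>x. \<phi> x * complex_of_real (koopman K (\<lambda>x. v x + u x) x) \<partial>M) 
      = (\<integral>x. \<phi> x * complex_of_real (koopman K v x) + \<phi> x * complex_of_real (koopman K u x) \<partial>M)"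
    by (intro Bochner_Integration.integral_cong refl) (simp only: k of_real_add distrib_left)
  then show ?case
    using add.IH(1)[OF b(1)] add.IH(2)[OF b(2)] i bm by (simp add: distrib_left)
next
  case (seq U b)
  have le: "U i x \<le> f x" if "x \<in> space M" for i x
    using seq that by (intro incseq_le) (auto simp: incseq_def le_fun_def)
  have b: "\<bar>U i x\<bar> \<le> b" if "x \<in> space M" for i x
    using le[OF that, of i] seq.prems[OF that] seq.hyps(2)[of i x] by auto
  have bm: "bounded_measurable M (U i)" for i
    by (intro bounded_measurableI[where b=b] seq.hyps b)
  have [measurable]: "f \<in> borel_measurable M"
    by (rule borel_measurable_LIMSEQ_real[where u=U]) (use seq.hyps(1,4) in auto)
  note [measurable] = seq.hyps(1) borel_measurable_integrable[OF \<phi>] borel_measurable_integrable[OF transfer_op_integrable[OF \<phi>]]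
  have "(\<lambda>i. \<integral>x. transfer_op K M \<phi> x * complex_of_real (U i x) \<partial>M) \<longlonglongrightarrow> (\<integral>x. transfer_op K M \<phi> x * complex_of_real (f x) \<partial>M)"
  proof (rule integral_dominated_convergence)
    show "integrable M (\<lambda>x. norm (transfer_op K M \<phi> x) * b)" using transfer_op_integrable[OF \<phi>] by auto
  qed (use b seq.hyps(4) in \<open>auto intro!: AE_I2 tendsto_intros mult_left_mono simp: norm_mult\<close>)
  moreover have "(\<lambda>i. \<integral>x. \<phi> x * complex_of_real (koopman K (U i) x) \<partial>M) \<longlonglongrightarrow> (\<integral>x. \<phi> x * complex_of_real (koopman K f x) \<partial>M)"
  proof (rule integral_dominated_convergence)
    show "integrable M (\<lambda>x. norm (\<phi> x) * b)" using \<phi> by auto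
    show "AE x in M. norm (\<phi> x * complex_of_real (koopman K (U i) x)) \<le> norm (\<phi> x) * b" for i
      using koopman_abs_le[OF seq.hyps(1) b] by (auto intro!: AE_I2 mult_left_mono simp: norm_mult)
    show "AE x in M. (\<lambda>i. \<phi> x * complex_of_real (koopman K (U i) x)) \<longlonglongrightarrow> \<phi> x * complex_of_real (koopman K f x)"
    proof (rule AE_I2)
      fix x assume x: "x \<in> space M"
      interpret Kx: prob_space "K x" using kernel_prob_space[OF x] .
      note [measurable_cong] = sets_kernel[OF x]
      have "(\<lambda>i. koopman K (U i) x) \<longlonglongrightarrow> koopman K f x"
        unfolding koopman_def
        by (rule integral_dominated_convergence[where w="\<lambda>_. b"])
           (use b x seq.hyps(1,4) in \<open>auto intro!: AE_I2\<close>)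
      then show "(\<lambda>i. \<phi> x * complex_of_real (koopman K (U i) x)) \<longlonglongrightarrow> \<phi> x * complex_of_real (koopman K f x)"
        by (intro tendsto_intros)
    qed
  qed auto
  ultimately show ?case
    using seq.IH[OF b] by (simp add: LIMSEQ_unique)
qed

lemma transfer_duality:
  assumes \<phi>: "integrable M \<phi>" and f: "bounded_measurable M f"
  shows "(\<integral>x. transfer_op K M \<phi> x * complex_of_real (f x) \<partial>M) = (\<integral>x. \<phi> x * complex_of_real (koopman K f x) \<partial>M)"
proof -
  note [measurable] = bounded_measurableD[OF f]
  obtain b where b: "\<And>x. x \<in> space M \<Longrightarrow> \<bar>f x\<bar> \<le> b"
    using f by (auto simp: bounded_measurable_def)
  let ?p = "\<lambda>x. max 0 (f x)" and ?n = "\<lambda>x. max 0 (- f x)"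
  have bm: "bounded_measurable M ?p" "bounded_measurable M ?n"
    using b by (intro bounded_measurableI[where b=b]; fastforce)+
  have eq: "f = (\<lambda>x. ?p x - ?n x)" by (auto simp: max_def)
  have k: "koopman K f x = koopman K ?p x - koopman K ?n x" if "x \<in> space M" for x
    unfolding koopman_def 
    by (subst eq, intro Bochner_Integration.integral_diff integrable_kernel bm that)
  have d: "(\<integral>x. transfer_op K M \<phi> x * complex_of_real (?p x) \<partial>M) = (\<integral>x. \<phi> x * complex_of_real (koopman K ?p x) \<partial>M)"
    "(\<integral>x. transfer_op K M \<phi> x * complex_of_real (?n x) \<partial>M) = (\<integral>x. \<phi> x * complex_of_real (koopman K ?n x) \<partial>M)"
    using b by (intro transfer_duality_nonneg[OF \<phi>, where b=b]; fastforce)+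
  note i = integrable_mult_bounded[OF transfer_op_integrable[OF \<phi>]] integrable_mult_bounded[OF \<phi> bounded_measurable_koopman]
  have "(\<integral>x. transfer_op K M \<phi> x * complex_of_real (f x) \<partial>M) = (\<integral>x. transfer_op K M \<phi> x * complex_of_real (?p x) - transfer_op K M \<phi> x * complex_of_real (?n x) \<partial>M)"
    by (intro Bochner_Integration.integral_cong refl) (auto simp: max_def)
  also have "\<dots> = (\<integral>x. \<phi> x * complex_of_real (koopman K ?p x) \<partial>M) - (\<integral>x. \<phi> x * complex_of_real (koopman K ?n x) \<partial>M)"
    by (subst Bochner_Integration.integral_diff, intro i bm, intro i bm, simp only: d)
  also have "\<dots> = (\<integral>x. \<phi> x * complex_of_real (koopman K ?p x) - \<phi> x * complex_of_real (koopman K ?n x) \<partial>M)"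
    by (subst Bochner_Integration.integral_diff, intro i bm, intro i bm, simp)
  also have "\<dots> = (\<integral>x. \<phi> x * complex_of_real (koopman K f x) \<partial>M)"
    by (intro Bochner_Integration.integral_cong refl) (simp add: k algebra_simps)
  finally show ?thesis .
qed

lemma kernel_power_stationary: "stationary_kernel M (kernel_power M K n)"
proof (induction n)
  case 0
  show ?case by unfold_locales (auto simp: bind_return'')
next
  case (Suc n)
  interpret L: stationary_kernel M "kernel_power M K n" by fact
  show ?case
  proof
    show "kernel_power M K (Suc n) \<in> M \<rightarrow>\<^sub>M prob_algebra M"
      by simp
    show "M \<bind> kernel_power M K (Suc n) = M"
      using bind_assoc[OF L.kernel_subprob kernel_subprob] by (simp add: L.stationary stationary)
  qed
qed

lemma integral_bind_kernel:
  assumes L: "L \<in> N \<rightarrow>\<^sub>M prob_algebra M" and N: "prob_space N" and f: "bounded_measurable M f"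
  shows "(\<integral>x. f x \<partial>(N \<bind> L)) = (\<integral>x. koopman L f x \<partial>N)"
proof -
  interpret N: prob_space N by fact
  obtain b where b: "\<And>x. x \<in> space M \<Longrightarrow> \<bar>f x\<bar> \<le> b"
    using f by (auto simp: bounded_measurable_def)
  have "prob_space (L x)" if "x \<in> space N" for x
    using measurable_space[OF L that] by (simp add: space_prob_algebra)
  then have "AE x in N. emeasure (L x) (space (L x)) \<le> ennreal 1"
    by (auto intro!: AE_I2 simp: prob_space.emeasure_space_1)
  then show ?thesis
    unfolding koopman_def
    by (intro integral_bind[OF bounded_measurableD[OF f] b measurable_prob_algebraD[OF L] N.finite_measure])
qed

text \<open>A step appended at the end of the chain acts first on functions.\<close>

lemma koopman_kernel_power_Suc:
  assumes "bounded_measurable M f" "x \<in> space M"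
  shows "koopman (kernel_power M K (Suc n)) f x = koopman (kernel_power M K n) (koopman K f) x"
proof -
  interpret L: stationary_kernel M "kernel_power M K n" by (rule kernel_power_stationary)
  have "K \<in> kernel_power M K n x \<rightarrow>\<^sub>M prob_algebra M"
    using assms(2) by (simp add: measurable_cong_sets[OF L.sets_kernel refl])
  from integral_bind_kernel[OF this L.kernel_prob_space[OF assms(2)] assms(1)]
  show ?thesis by (simp add: koopman_def)
qed

lemma transfer_duality_funpow:
  assumes \<phi>: "integrable M \<phi>" and f: "bounded_measurable M f"
  shows "(\<integral>x. (transfer_op K M ^^ n) \<phi> x * complex_of_real (f x) \<partial>M)
    = (\<integral>x. \<phi> x * complex_of_real (koopman (kernel_power M K n) f x) \<partial>M)"
  using f
proof (induction n arbitrary: f)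
  case 0
  have "(\<integral>x. \<phi> x * complex_of_real (koopman (return M) f x) \<partial>M) = (\<integral>x. \<phi> x * complex_of_real (f x) \<partial>M)"
    using 0 by (intro Bochner_Integration.integral_cong) (auto simp: koopman_def integral_return bounded_measurableD)
  then show ?case by simp
next
  case (Suc n)
  interpret P: markov_op M "transfer_op K M ^^ n" by (rule transfer.markov_op_funpow)
  have "(\<integral>x. (transfer_op K M ^^ Suc n) \<phi> x * complex_of_real (f x) \<partial>M) 
     = (\<integral>x. (transfer_op K M ^^ n) \<phi> x * complex_of_real (koopman K f x) \<partial>M)"
    using transfer_duality[OF P.T_integrable[OF \<phi>] Suc.prems] by simp
  also have "\<dots> = (\<integral>x. \<phi> x * complex_of_real (koopman (kernel_power M K n) (koopman K f) x) \<partial>M)"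
    by (rule Suc.IH[OF bounded_measurable_koopman[OF Suc.prems]])
  also have "\<dots> = (\<integral>x. \<phi> x * complex_of_real (koopman (kernel_power M K (Suc n)) f x) \<partial>M)"
    by (intro Bochner_Integration.integral_cong refl) (simp only: koopman_kernel_power_Suc[OF Suc.prems])
  finally show ?case .
qed

lemma integral_koopman: "bounded_measurable M f \<Longrightarrow> (\<integral>x. koopman K f x \<partial>M) = (\<integral>x. f x \<partial>M)"
  using integral_bind_kernel[OF kernel prob_space_axioms] by (simp add: stationary)

text \<open>Duality with g = u - m, where u is the Koopman image of f: since g has mean 0, the
  integral of g^2 is that of g u, which equals that of (P^n g) (f - m). Cauchy-Schwarz and the gap
  for g bound it by \<kappa> |g| |f - m|, and one factor |g| cancels. The variance identity then
  restores the means.\<close>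

lemma koopman_contracts_of_gap:
  assumes \<kappa>: "\<kappa> \<ge> 0"
    and gap: "\<And>\<phi>. \<phi> \<in> Lp 2 M \<Longrightarrow> (\<integral>x. \<phi> x \<partial>M) = 0 \<Longrightarrow>
       Lp_norm 2 M ((transfer_op K M ^^ n) \<phi>) \<le> \<kappa> * Lp_norm 2 M \<phi>"
  shows "koopman_contracts M (kernel_power M K n) \<kappa>"
  unfolding koopman_contracts_def
proof (intro allI impI)
  fix f assume f: "bounded_measurable M f"
  interpret L: stationary_kernel M "kernel_power M K n" by (rule kernel_power_stationary)
  interpret P: markov_op M "transfer_op K M ^^ n" by (rule transfer.markov_op_funpow)
  define u where "u = koopman (kernel_power M K n) f"
  define m where "m = (\<integral>x. f x \<partial>M)"
  define g where "g = (\<lambda>x. u x - m)"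
  have u: "bounded_measurable M u" unfolding u_def by (rule L.bounded_measurable_koopman[OF f])
  have mu: "m = (\<integral>x. u x \<partial>M)" unfolding m_def u_def by (rule L.integral_koopman[OF f, symmetric])
  have g: "bounded_measurable M g" unfolding g_def by (intro bounded_measurable_diff u bounded_measurable_const)
  have fm: "bounded_measurable M (\<lambda>x. f x - m)" by (intro bounded_measurable_diff f bounded_measurable_const)
  have g0: "(\<integral>x. g x \<partial>M) = 0"
    unfolding g_def using integrable_bounded_measurable[OF u] mu by (simp add: prob_space)
  let ?g = "\<lambda>x. complex_of_real (g x)" and ?fm = "\<lambda>x. complex_of_real (f x - m)"
  have Lp2: "(\<lambda>x. complex_of_real (w x)) \<in> Lp 2 M" if w: "bounded_measurable M w" for w
  proof -
    obtain b where "\<forall>x\<in>space M. \<bar>w x\<bar> \<le> b" using w by (auto simp: bounded_measurable_def)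
    then show ?thesis using w by (intro Lp_bounded(1)[where c=b]) (auto dest: bounded_measurableD)
  qed
  have ig: "integrable M ?g" using integrable_bounded_measurable[OF g] by simp
  have Lp_sq: "(Lp_norm 2 M (\<lambda>x. complex_of_real (w x)))\<^sup>2 = (\<integral>x. (w x)\<^sup>2 \<partial>M)" for w
    using Lp_norm_powr[of 2 M "\<lambda>x. complex_of_real (w x)"] by simp
  have T2: "(transfer_op K M ^^ n) ?g \<in> Lp 2 M"
    using P.T_Lp(1)[OF Lp2[OF g]] by simp
  have Tg0: "(\<integral>x. (transfer_op K M ^^ n) ?g x \<partial>M) = 0"
    using P.T_integral[OF ig] g0 by simp
  note gf = integrable_mult_bounded[OF P.T_integrable[OF ig] f] 
  have "complex_of_real (\<integral>x. (g x)\<^sup>2 \<partial>M) = complex_of_real (\<integral>x. g x * u x \<partial>M)"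
  proof -
    have "(\<integral>x. g x * u x \<partial>M) = (\<integral>x. (g x)\<^sup>2 + m * g x \<partial>M)"
      by (intro Bochner_Integration.integral_cong) (auto simp: g_def power2_eq_square algebra_simps)
    also have "\<dots> = (\<integral>x. (g x)\<^sup>2 \<partial>M) + m * (\<integral>x. g x \<partial>M)"
      using integrable_bounded_measurable[OF g] integrable_bounded_measurable[OF bounded_measurable_power2[OF g]] by simp
    finally show ?thesis using g0 by simp
  qed
  also have "\<dots> = (\<integral>x. ?g x * complex_of_real (u x) \<partial>M)"
    by (simp only: integral_complex_of_real[symmetric] of_real_mult)
  also have "\<dots> = (\<integral>x. (transfer_op K M ^^ n) ?g x * complex_of_real (f x) \<partial>M)"
    unfolding u_def by (rule transfer_duality_funpow[OF ig f, symmetric])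
  also have "\<dots> = (\<integral>x. (transfer_op K M ^^ n) ?g x * ?fm x \<partial>M)"
    using gf P.T_integrable[OF ig] Tg0 by (simp add: algebra_simps)
  finally have "\<bar>\<integral>x. (g x)\<^sup>2 \<partial>M\<bar> = norm (\<integral>x. (transfer_op K M ^^ n) ?g x * ?fm x \<partial>M)"
    by (metis norm_of_real)
  also have "\<dots> \<le> Lp_norm 2 M ((transfer_op K M ^^ n) ?g) * Lp_norm 2 M ?fm"
    by (intro Cauchy_Schwarz_integral T2 Lp2 fm)
  also have "\<dots> \<le> (\<kappa> * Lp_norm 2 M ?g) * Lp_norm 2 M ?fm"
    using g0 by (intro mult_right_mono gap Lp2 g) auto
  finally have "Lp_norm 2 M ?g * Lp_norm 2 M ?g \<le> Lp_norm 2 M ?g * (\<kappa> * Lp_norm 2 M ?fm)"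
    using Lp_sq[of g] by (simp add: power2_eq_square ac_simps)
  then have "Lp_norm 2 M ?g \<le> \<kappa> * Lp_norm 2 M ?fm"
    using \<kappa> by (cases "Lp_norm 2 M ?g = 0") (auto simp: order_less_le)
  then have "(Lp_norm 2 M ?g)\<^sup>2 \<le> (\<kappa> * Lp_norm 2 M ?fm)\<^sup>2"
    by (intro power_mono) auto
  then have "(\<integral>x. (g x)\<^sup>2 \<partial>M) \<le> \<kappa>\<^sup>2 * (\<integral>x. (f x - m)\<^sup>2 \<partial>M)"
    using Lp_sq[of g] Lp_sq[of "\<lambda>x. f x - m"] by (simp add: power_mult_distrib)
  also have "(\<integral>x. (f x - m)\<^sup>2 \<partial>M) = (\<integral>x. (f x)\<^sup>2 \<partial>M) - m\<^sup>2"
    unfolding m_def by (rule integral_variance_eq[OF f])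
  also have "(\<integral>x. (g x)\<^sup>2 \<partial>M) = (\<integral>x. (u x)\<^sup>2 \<partial>M) - m\<^sup>2"
    unfolding g_def mu by (rule integral_variance_eq[OF u])
  finally show "(\<integral>x. (koopman (kernel_power M K n) f x)\<^sup>2 \<partial>M) \<le> \<kappa>\<^sup>2 * (\<integral>x. (f x)\<^sup>2 \<partial>M) + (1 - \<kappa>\<^sup>2) * (\<integral>x. f x \<partial>M)\<^sup>2"
    unfolding u_def m_def by (simp add: algebra_simps)
qed

end

context stationary_kernel begin

text \<open>The way back to the transfer operator. Duality needs bounded test functions, so w = P^n
  g - m is tested against its own truncations \<open>s k\<close>: the integral of (s k)^2 is that of
  w times s k, and the Koopman contraction of s k leaves a factor |s k| that cancels. Fatou removes
  the truncation.\<close>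

lemma Lp_2_transfer_gap:
  assumes contr: "koopman_contracts M (kernel_power M K n) \<kappa>" and \<kappa>: "0 \<le> \<kappa>"
    and g: "(\<lambda>x. complex_of_real (g x)) \<in> Lp 2 M"
  shows "(\<lambda>x. (transfer_op K M ^^ n) (\<lambda>x. complex_of_real (g x)) x - complex_of_real (\<integral>x. g x \<partial>M)) \<in> Lp 2 M"
    and "Lp_norm 2 M (\<lambda>x. (transfer_op K M ^^ n) (\<lambda>x. complex_of_real (g x)) x - complex_of_real (\<integral>x. g x \<partial>M))
         \<le> \<kappa> * Lp_norm 2 M (\<lambda>x. complex_of_real (g x))"
proof -
  interpret L: stationary_kernel M "kernel_power M K n" by (rule kernel_power_stationary)
  interpret P: markov_op M "transfer_op K M ^^ n" by (rule transfer.markov_op_funpow)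
  have gi: "integrable M g" using integrable_Re[OF Lp_integrable[OF g]] by simp
  note [measurable] = borel_measurable_integrable[OF gi]
  have g2: "integrable M (\<lambda>x. (g x)\<^sup>2)" using Lp_integrable_powr[OF g] by simp
  define m where "m = (\<integral>x. g x \<partial>M)"
  define g0 where "g0 = (\<lambda>x. g x - m)"
  have g0i: "integrable M g0" "(\<integral>x. g0 x \<partial>M) = 0"
    using gi by (simp_all add: g0_def m_def prob_space)
  define w where "w = (\<lambda>x. P.Tr g x - m)"
  define G where "G = Lp_norm 2 M (\<lambda>x. complex_of_real (g x))"
  have Lp_sq: "(Lp_norm 2 M (\<lambda>x. complex_of_real (w x)))\<^sup>2 = (\<integral>x. (w x)\<^sup>2 \<partial>M)" for w
    using Lp_norm_powr[of 2 M "\<lambda>x. complex_of_real (w x)"] by simp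
  have wi: "integrable M w" using P.Tr_integrable[OF gi] by (simp add: w_def)
  note [measurable] = borel_measurable_integrable[OF wi] borel_measurable_integrable[OF g0i(1)]
  have g0L: "(\<lambda>x. complex_of_real (g0 x)) \<in> Lp 2 M"
    using Lp_diff[OF g Lp_const[of "complex_of_real m"]] by (simp add: g0_def)
  have g0G: "Lp_norm 2 M (\<lambda>x. complex_of_real (g0 x)) \<le> G"
  proof -
    have "(\<integral>x. (g0 x)\<^sup>2 \<partial>M) = (\<integral>x. (g x)\<^sup>2 \<partial>M) - m\<^sup>2"
      unfolding g0_def m_def by (rule variance_eq[OF gi g2])
    then have "(Lp_norm 2 M (\<lambda>x. complex_of_real (g0 x)))\<^sup>2 \<le> G\<^sup>2"
      unfolding G_def Lp_sq by simp
    then show ?thesis by (rule power2_le_imp_le) (simp add: G_def)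
  qed
  have wP: "AE x in M. (transfer_op K M ^^ n) (\<lambda>x. complex_of_real (g0 x)) x = complex_of_real (w x)"
    using P.T_of_real[OF g0i(1)] P.Tr_diff[OF gi integrable_const[of m]] P.Tr_const[of m]
    by eventually_elim (simp add: w_def g0_def)
  define s where "s = (\<lambda>k x. if \<bar>w x\<bar> \<le> real k then w x else 0)"
  have s_bm: "bounded_measurable M (s k)" for k
    unfolding s_def by (intro bounded_measurableI[where b="real k"]) auto
  have sL: "(\<lambda>x. complex_of_real (s k x)) \<in> Lp 2 M" for k
    using s_bm[THEN bounded_measurableD] by (intro Lp_bounded(1)[where c="real k"]) (auto simp: s_def)
  have s_le: "Lp_norm 2 M (\<lambda>x. complex_of_real (s k x)) \<le> \<kappa> * G" for k
  proof -
    define v where "v = koopman (kernel_power M K n) (s k)"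
    define c where "c = (\<integral>x. s k x \<partial>M)"
    have v: "bounded_measurable M v" unfolding v_def by (rule L.bounded_measurable_koopman[OF s_bm])
    have vc: "c = (\<integral>x. v x \<partial>M)" unfolding c_def v_def by (rule L.integral_koopman[OF s_bm, symmetric])
    have vL: "(\<lambda>x. complex_of_real (v x - c)) \<in> Lp 2 M"
    proof -
      obtain b where "\<forall>x\<in>space M. \<bar>v x\<bar> \<le> b" using v by (auto simp: bounded_measurable_def)
      then have "(\<lambda>x. complex_of_real (v x)) \<in> Lp 2 M" 
        using v by (intro Lp_bounded(1)[where c=b]) (auto dest: bounded_measurableD)
      from Lp_diff[OF this Lp_const[of "complex_of_real c"]] show ?thesis by simp
    qed
    have "complex_of_real (\<integral>x. (s k x)\<^sup>2 \<partial>M) = (\<integral>x. complex_of_real ((s k x)\<^sup>2) \<partial>M)"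
      by (simp only: integral_complex_of_real)
    also have "\<dots> = (\<integral>x. complex_of_real (w x) * complex_of_real (s k x) \<partial>M)"
      by (intro Bochner_Integration.integral_cong) (auto simp: s_def power2_eq_square)
    also have "\<dots> = (\<integral>x. (transfer_op K M ^^ n) (\<lambda>x. complex_of_real (g0 x)) x * complex_of_real (s k x) \<partial>M)"
      using wP P.T_integrable[of "\<lambda>x. complex_of_real (g0 x)"] g0i s_bm[of k]
      by (intro integral_cong_AE) (auto dest!: bounded_measurableD borel_measurable_integrable elim!: eventually_mono)
    also have "\<dots> = (\<integral>x. complex_of_real (g0 x) * complex_of_real (v x) \<partial>M)"
      unfolding v_def using g0i by (intro transfer_duality_funpow s_bm) auto
    \<comment> \<open>Subtracting the constant c is free because g0 has mean 0.\<close>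
    also have "\<dots> = (\<integral>x. complex_of_real (g0 x) * complex_of_real (v x - c) \<partial>M)"
      using integrable_mult_bounded[OF _ v, of "\<lambda>x. complex_of_real (g0 x)"] g0i by (simp add: algebra_simps)
    finally have "\<bar>\<integral>x. (s k x)\<^sup>2 \<partial>M\<bar> = norm (\<integral>x. complex_of_real (g0 x) * complex_of_real (v x - c) \<partial>M)"
      by (metis norm_of_real)
    also have "\<dots> \<le> Lp_norm 2 M (\<lambda>x. complex_of_real (g0 x)) * Lp_norm 2 M (\<lambda>x. complex_of_real (v x - c))"
      by (intro Cauchy_Schwarz_integral g0L vL)
    also have "\<dots> \<le> G * (\<kappa> * Lp_norm 2 M (\<lambda>x. complex_of_real (s k x)))"
    proof (intro mult_mono g0G)
      have "(Lp_norm 2 M (\<lambda>x. complex_of_real (v x - c)))\<^sup>2 = (\<integral>x. (v x)\<^sup>2 \<partial>M) - c\<^sup>2"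
        unfolding Lp_sq vc by (rule integral_variance_eq[OF v])
      also have "\<dots> \<le> \<kappa>\<^sup>2 * ((\<integral>x. (s k x)\<^sup>2 \<partial>M) - c\<^sup>2)"
        using contr s_bm[of k] unfolding koopman_contracts_def v_def c_def by (auto simp: algebra_simps)
      also have "\<dots> \<le> \<kappa>\<^sup>2 * (\<integral>x. (s k x)\<^sup>2 \<partial>M)" by (intro mult_left_mono) auto
      also have "\<dots> = (\<kappa> * Lp_norm 2 M (\<lambda>x. complex_of_real (s k x)))\<^sup>2"
        by (simp add: power_mult_distrib Lp_sq)
      finally show "Lp_norm 2 M (\<lambda>x. complex_of_real (v x - c)) \<le> \<kappa> * Lp_norm 2 M (\<lambda>x. complex_of_real (s k x))"
        by (rule power2_le_imp_le) (simp add: \<kappa>)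
    qed (auto simp: G_def)
    finally have "Lp_norm 2 M (\<lambda>x. complex_of_real (s k x)) * Lp_norm 2 M (\<lambda>x. complex_of_real (s k x))
        \<le> Lp_norm 2 M (\<lambda>x. complex_of_real (s k x)) * (\<kappa> * G)"
      using Lp_sq[of "s k"] by (simp add: power2_eq_square ac_simps)
    then show ?thesis
      using \<kappa> by (cases "Lp_norm 2 M (\<lambda>x. complex_of_real (s k x)) = 0") (auto simp: order_less_le G_def)
  qed
  have lim: "AE x in M. (\<lambda>k. complex_of_real (s k x)) \<longlonglongrightarrow> complex_of_real (w x)"
  proof (rule AE_I2)
    fix x
    have "eventually (\<lambda>k. s k x = w x) sequentially"
      using eventually_ge_at_top[of "nat \<lceil>\<bar>w x\<bar>\<rceil>"] by eventually_elim (auto simp: s_def nat_le_iff ceiling_le_iff)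
    then show "(\<lambda>k. complex_of_real (s k x)) \<longlonglongrightarrow> complex_of_real (w x)"
      by (intro tendsto_of_real tendsto_eventually)
  qed
  have wL: "(\<lambda>x. complex_of_real (w x)) \<in> Lp 2 M" "Lp_norm 2 M (\<lambda>x. complex_of_real (w x)) \<le> \<kappa> * G"
    using Lp_Fatou[OF sL _ _ lim, of "\<kappa> * G"] s_le \<kappa> by (auto simp: G_def)
  have eq: "AE x in M. (transfer_op K M ^^ n) (\<lambda>x. complex_of_real (g x)) x - complex_of_real m = complex_of_real (w x)"
    using P.T_of_real[OF gi] by eventually_elim (simp add: w_def)
  have [measurable]: "(transfer_op K M ^^ n) (\<lambda>x. complex_of_real (g x)) \<in> borel_measurable M"
    using P.T_integrable[of "\<lambda>x. complex_of_real (g x)"] gi by auto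
  show "(\<lambda>x. (transfer_op K M ^^ n) (\<lambda>x. complex_of_real (g x)) x - complex_of_real (\<integral>x. g x \<partial>M)) \<in> Lp 2 M"
    using Lp_cong_AE[OF wL(1) _ eq] by (simp add: m_def)
  show "Lp_norm 2 M (\<lambda>x. (transfer_op K M ^^ n) (\<lambda>x. complex_of_real (g x)) x - complex_of_real (\<integral>x. g x \<partial>M))
         \<le> \<kappa> * Lp_norm 2 M (\<lambda>x. complex_of_real (g x))"
    using Lp_norm_cong_AE[OF _ _ eq, of 2] wL(2) by (simp add: m_def G_def)
qed

end

section \<open>Tensorization of the spectral gap\<close>

text \<open>The integrand varies with x together with the measure. Pushing L x forward under y to
  (x, y) turns the expression into the integral of one fixed function against a kernel.\<close>

lemma measurable_integral_kernel:
  fixes f :: "'a \<Rightarrow> 'b \<Rightarrow> real"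
  assumes f[measurable]: "(\<lambda>(x, y). f x y) \<in> borel_measurable (M \<Otimes>\<^sub>M N)"
    and L[measurable]: "L \<in> M \<rightarrow>\<^sub>M subprob_algebra N"
  shows "(\<lambda>x. \<integral>y. f x y \<partial>L x) \<in> borel_measurable M"
proof -
  note measurable_distr2[measurable]
  have "(\<lambda>x. integral\<^sup>L (distr (L x) (M \<Otimes>\<^sub>M N) (\<lambda>y. (x, y))) (\<lambda>(x, y). f x y)) \<in> borel_measurable M"
    by measurable
  then show ?thesis
  proof (rule measurable_cong[THEN iffD1, rotated])
    fix x assume x: "x \<in> space M"
    have Lx: "sets (L x) = sets N"
      using measurable_space[OF L x] by (simp add: space_subprob_algebra)
    have [measurable]: "Pair x \<in> L x \<rightarrow>\<^sub>M M \<Otimes>\<^sub>M N"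
      using measurable_Pair1'[OF x] by (simp add: measurable_cong_sets[OF Lx refl])
    show "integral\<^sup>L (distr (L x) (M \<Otimes>\<^sub>M N) (Pair x)) (\<lambda>(x, y). f x y) = (\<integral>y. f x y \<partial>L x)"
      by (subst integral_distr) auto
  qed
qed

lemma bounded_measurable_section:
  assumes "bounded_measurable (M \<Otimes>\<^sub>M N) (\<lambda>(x, y). F x y)"
  shows "x \<in> space M \<Longrightarrow> bounded_measurable N (F x)"
    and "y \<in> space N \<Longrightarrow> bounded_measurable M (\<lambda>x. F x y)"
proof -
  obtain b where b: "\<And>x y. x \<in> space M \<Longrightarrow> y \<in> space N \<Longrightarrow> \<bar>F x y\<bar> \<le> b"
    using assms by (auto simp: bounded_measurable_def space_pair_measure)
  note [measurable] = bounded_measurableD[OF assms]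
  show "bounded_measurable N (F x)" if "x \<in> space M"
    using b[OF that] measurable_Pair2[OF bounded_measurableD[OF assms] that]
    by (intro bounded_measurableI[where b=b]) auto
  show "bounded_measurable M (\<lambda>x. F x y)" if "y \<in> space N"
    using b[OF _ that] measurable_Pair1[OF bounded_measurableD[OF assms] that]
    by (intro bounded_measurableI[where b=b]) auto
qed

lemma (in prob_space) abs_integral_le:
  fixes f :: "'a \<Rightarrow> real"
  assumes "\<And>x. x \<in> space M \<Longrightarrow> \<bar>f x\<bar> \<le> b" "f \<in> borel_measurable M"
  shows "\<bar>\<integral>x. f x \<partial>M\<bar> \<le> b"
proof -
  have i: "integrable M f" by (intro integrable_bounded_measurable bounded_measurableI[where b=b] assms)
  have "\<bar>\<integral>x. f x \<partial>M\<bar> \<le> (\<integral>x. \<bar>f x\<bar> \<partial>M)" using integral_norm_bound[of M f] by simp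
  also have "\<dots> \<le> (\<integral>x. b \<partial>M)" using i assms by (intro integral_mono) auto
  finally show ?thesis by (simp add: prob_space)
qed

lemma bounded_measurable_integral_kernel:
  assumes F: "bounded_measurable (M \<Otimes>\<^sub>M N) (\<lambda>(x, y). F x y)" and L: "L \<in> M \<rightarrow>\<^sub>M prob_algebra N"
  shows "bounded_measurable M (\<lambda>x. \<integral>y. F x y \<partial>L x)"
proof -
  obtain b where b: "\<And>x y. x \<in> space M \<Longrightarrow> y \<in> space N \<Longrightarrow> \<bar>F x y\<bar> \<le> b"
    using F by (auto simp: bounded_measurable_def space_pair_measure)
  show ?thesis
  proof (rule bounded_measurableI)
    show "(\<lambda>x. \<integral>y. F x y \<partial>L x) \<in> borel_measurable M"
      by (intro measurable_integral_kernel[where N=N] bounded_measurableD[OF F] measurable_prob_algebraD[OF L])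
    fix x assume x: "x \<in> space M"
    have Lx: "prob_space (L x)" "sets (L x) = sets N" using measurable_space[OF L x] by (auto simp: space_prob_algebra)
    show "\<bar>\<integral>y. F x y \<partial>L x\<bar> \<le> b"
      using b[OF x] bounded_measurableD[OF bounded_measurable_section(1)[OF F x]]
      by (intro prob_space.abs_integral_le[OF Lx(1)])
         (auto simp: measurable_cong_sets[OF Lx(2) refl] sets_eq_imp_space_eq[OF Lx(2)])
  qed
qed

lemma bounded_measurable_swap:
  assumes F: "bounded_measurable (M \<Otimes>\<^sub>M N) (\<lambda>(x, y). F x y)"
  shows "bounded_measurable (N \<Otimes>\<^sub>M M) (\<lambda>(y, x). F x y)"
  using F measurable_pair_swap[of "\<lambda>(x, y). F x y" M N] 
  by (auto simp: bounded_measurable_def space_pair_measure split_beta)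

lemma Fubini_bounded:
  assumes "prob_space M" "prob_space N"
    and F: "bounded_measurable (M \<Otimes>\<^sub>M N) (\<lambda>(x, y). F x y)"
  shows "(\<integral>x. \<integral>y. F x y \<partial>N \<partial>M) = (\<integral>y. \<integral>x. F x y \<partial>M \<partial>N)"
proof -
  interpret M: prob_space M by fact
  interpret N: prob_space N by fact
  interpret P: pair_prob_space M N ..
  show ?thesis
    by (rule P.Fubini_integral[symmetric]) (rule P.integrable_bounded_measurable[OF F])
qed

text \<open>The contraction in y for fixed x, then in x for fixed y, bounds the left side by
  \<kappa>^4 S + \<kappa>^2 (1 - \<kappa>^2) (a + b) + (1 - \<kappa>^2)^2 m^2, where a and b are the
  squared norms of the two marginal averages. By a + b <= S + m^2 the coefficients recombine to
  exactly \<kappa>^2 and 1 - \<kappa>^2, so no constant is lost.\<close>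

lemma koopman_contracts_pair:
  assumes M1: "stationary_kernel M1 K1" and M2: "stationary_kernel M2 K2"
    and c1: "koopman_contracts M1 K1 \<kappa>" and c2: "koopman_contracts M2 K2 \<kappa>" and \<kappa>: "0 \<le> \<kappa>" "\<kappa> \<le> 1"
    and F: "bounded_measurable (M1 \<Otimes>\<^sub>M M2) (\<lambda>(x, y). F x y)"
  shows "(\<integral>x. \<integral>y. (koopman K1 (\<lambda>x'. koopman K2 (F x') y) x)\<^sup>2 \<partial>M2 \<partial>M1)
    \<le> \<kappa>\<^sup>2 * (\<integral>x. \<integral>y. (F x y)\<^sup>2 \<partial>M2 \<partial>M1) + (1 - \<kappa>\<^sup>2) * (\<integral>x. \<integral>y. F x y \<partial>M2 \<partial>M1)\<^sup>2"
proof -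
  interpret M1: stationary_kernel M1 K1 by fact
  interpret M2: stationary_kernel M2 K2 by fact
  note p = M1.prob_space_axioms M2.prob_space_axioms
  note sec = bounded_measurable_section and ker = bounded_measurable_integral_kernel
  define G where "G = (\<lambda>x y. koopman K2 (F x) y)"
  define V where "V = (\<lambda>x y. koopman K1 (\<lambda>x'. G x' y) x)"
  define A where "A = (\<lambda>x. \<integral>y. F x y \<partial>M2)"
  define B where "B = (\<lambda>y. \<integral>x. F x y \<partial>M1)"
  \<comment> \<open>Averages over one coordinate are integrals against a constant kernel, so one
    lemma covers both marginals and kernels.\<close>
  have const: "(\<lambda>_. M1) \<in> M2 \<rightarrow>\<^sub>M prob_algebra M1" "(\<lambda>_. M2) \<in> M1 \<rightarrow>\<^sub>M prob_algebra M2"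
    using p by (auto simp: space_prob_algebra)
  have comp: "bounded_measurable (M1 \<Otimes>\<^sub>M M2) (\<lambda>(x, y). H x y) \<Longrightarrow>
      bounded_measurable (M1 \<Otimes>\<^sub>M M2) (\<lambda>(x, y). (H x y)\<^sup>2)" for H :: "_ \<Rightarrow> _ \<Rightarrow> real"
    using bounded_measurable_power2[of "M1 \<Otimes>\<^sub>M M2" "\<lambda>(x, y). H x y"] by (simp add: case_prod_unfold)
  have G: "bounded_measurable (M1 \<Otimes>\<^sub>M M2) (\<lambda>(x, y). G x y)"
  proof -
    obtain b where b: "\<And>x y. x \<in> space M1 \<Longrightarrow> y \<in> space M2 \<Longrightarrow> \<bar>F x y\<bar> \<le> b"
      using F by (auto simp: bounded_measurable_def space_pair_measure)
    \<comment> \<open>Both free variables are packed into z, so that the kernel K2 (snd z) and the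
      integrand depend on the same parameter.\<close>
    have "bounded_measurable ((M1 \<Otimes>\<^sub>M M2) \<Otimes>\<^sub>M M2) (\<lambda>(z, y). F (fst z) y)"
    proof (rule bounded_measurableI[where b=b])
      have "(\<lambda>z. (fst (fst z), snd z)) \<in> (M1 \<Otimes>\<^sub>M M2) \<Otimes>\<^sub>M M2 \<rightarrow>\<^sub>M M1 \<Otimes>\<^sub>M M2" by measurable
      from measurable_compose[OF this bounded_measurableD[OF F]]
      show "(\<lambda>(z, y). F (fst z) y) \<in> borel_measurable ((M1 \<Otimes>\<^sub>M M2) \<Otimes>\<^sub>M M2)" by (simp add: case_prod_unfold)
    qed (auto simp: space_pair_measure intro!: b)
    from ker[OF this, of "\<lambda>z. K2 (snd z)"] show ?thesis
      by (simp add: G_def koopman_def case_prod_unfold)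
  qed
  have V: "bounded_measurable (M1 \<Otimes>\<^sub>M M2) (\<lambda>(x, y). V x y)"
  proof -
    obtain b where b: "\<And>x y. x \<in> space M1 \<Longrightarrow> y \<in> space M2 \<Longrightarrow> \<bar>G x y\<bar> \<le> b"
      using G by (auto simp: bounded_measurable_def space_pair_measure)
    have "bounded_measurable ((M1 \<Otimes>\<^sub>M M2) \<Otimes>\<^sub>M M1) (\<lambda>(z, x). G x (snd z))"
    proof (rule bounded_measurableI[where b=b])
      have "(\<lambda>z. (snd z, snd (fst z))) \<in> (M1 \<Otimes>\<^sub>M M2) \<Otimes>\<^sub>M M1 \<rightarrow>\<^sub>M M1 \<Otimes>\<^sub>M M2" by measurable
      from measurable_compose[OF this bounded_measurableD[OF G]]
      show "(\<lambda>(z, x). G x (snd z)) \<in> borel_measurable ((M1 \<Otimes>\<^sub>M M2) \<Otimes>\<^sub>M M1)" by (simp add: case_prod_unfold)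
    qed (auto simp: space_pair_measure intro!: b)
    from ker[OF this, of "\<lambda>z. K1 (fst z)"] show ?thesis
      by (simp add: V_def koopman_def case_prod_unfold)
  qed
  have A: "bounded_measurable M1 A" unfolding A_def by (rule ker[OF F const(2)])
  have B: "bounded_measurable M2 B" unfolding B_def by (rule ker[OF bounded_measurable_swap[OF F] const(1)])
  note int1 = M1.integrable_bounded_measurable and int2 = M2.integrable_bounded_measurable
  define S where "S = (\<integral>x. \<integral>y. (F x y)\<^sup>2 \<partial>M2 \<partial>M1)"
  define a where "a = (\<integral>x. (A x)\<^sup>2 \<partial>M1)"
  define b where "b = (\<integral>y. (B y)\<^sup>2 \<partial>M2)"
  define m where "m = (\<integral>x. \<integral>y. F x y \<partial>M2 \<partial>M1)"
  have mA: "m = (\<integral>x. A x \<partial>M1)" by (simp add: m_def A_def)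
  have mB: "m = (\<integral>y. B y \<partial>M2)" unfolding m_def B_def by (rule Fubini_bounded[OF p F])
  have G1: "(\<integral>x. \<integral>y. (G x y)\<^sup>2 \<partial>M2 \<partial>M1) \<le> \<kappa>\<^sup>2 * S + (1 - \<kappa>\<^sup>2) * a"
  proof -
    have "(\<integral>x. \<integral>y. (G x y)\<^sup>2 \<partial>M2 \<partial>M1) \<le> (\<integral>x. \<kappa>\<^sup>2 * (\<integral>y. (F x y)\<^sup>2 \<partial>M2) + (1 - \<kappa>\<^sup>2) * (A x)\<^sup>2 \<partial>M1)"
    proof (rule integral_mono)
      show "integrable M1 (\<lambda>x. \<integral>y. (G x y)\<^sup>2 \<partial>M2)" by (rule int1[OF ker[OF comp[OF G] const(2)]])
      show "integrable M1 (\<lambda>x. \<kappa>\<^sup>2 * (\<integral>y. (F x y)\<^sup>2 \<partial>M2) + (1 - \<kappa>\<^sup>2) * (A x)\<^sup>2)"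
        using int1[OF ker[OF comp[OF F] const(2)]] int1[OF bounded_measurable_power2[OF A]] by simp
      fix x assume "x \<in> space M1"
      from c2 sec(1)[OF F this]
      show "(\<integral>y. (G x y)\<^sup>2 \<partial>M2) \<le> \<kappa>\<^sup>2 * (\<integral>y. (F x y)\<^sup>2 \<partial>M2) + (1 - \<kappa>\<^sup>2) * (A x)\<^sup>2"
        by (auto simp: koopman_contracts_def G_def A_def)
    qed
    also have "\<dots> = \<kappa>\<^sup>2 * S + (1 - \<kappa>\<^sup>2) * a"
      using int1[OF ker[OF comp[OF F] const(2)]] int1[OF bounded_measurable_power2[OF A]] by (simp add: S_def a_def)
    finally show ?thesis .
  qed
  \<comment> \<open>Fubini for M1 and K2 y: averaging over the first coordinate commutes with the
    kernel in the second.\<close>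
  have GB: "(\<integral>x. G x y \<partial>M1) = koopman K2 B y" if y: "y \<in> space M2" for y
  proof -
    have F': "bounded_measurable (M1 \<Otimes>\<^sub>M K2 y) (\<lambda>(x, y). F x y)"
      using F y M2.space_kernel[OF y]
      by (simp add: bounded_measurable_def space_pair_measure measurable_cong_sets[OF sets_pair_measure_cong[OF refl M2.sets_kernel[OF y]] refl])
    show ?thesis
      unfolding G_def koopman_def B_def by (rule Fubini_bounded[OF p(1) M2.kernel_prob_space[OF y] F'])
  qed
  have G2: "(\<integral>y. (\<integral>x. G x y \<partial>M1)\<^sup>2 \<partial>M2) \<le> \<kappa>\<^sup>2 * b + (1 - \<kappa>\<^sup>2) * m\<^sup>2"
  proof -
    have "(\<integral>y. (\<integral>x. G x y \<partial>M1)\<^sup>2 \<partial>M2) = (\<integral>y. (koopman K2 B y)\<^sup>2 \<partial>M2)"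
      by (intro Bochner_Integration.integral_cong refl) (simp add: GB)
    also have "\<dots> \<le> \<kappa>\<^sup>2 * b + (1 - \<kappa>\<^sup>2) * m\<^sup>2"
      using c2 B unfolding koopman_contracts_def mB b_def by blast
    finally show ?thesis .
  qed
  have V1: "(\<integral>x. \<integral>y. (V x y)\<^sup>2 \<partial>M2 \<partial>M1) \<le> \<kappa>\<^sup>2 * (\<integral>x. \<integral>y. (G x y)\<^sup>2 \<partial>M2 \<partial>M1) + (1 - \<kappa>\<^sup>2) * (\<integral>y. (\<integral>x. G x y \<partial>M1)\<^sup>2 \<partial>M2)"
  proof -
    have "(\<integral>x. \<integral>y. (V x y)\<^sup>2 \<partial>M2 \<partial>M1) = (\<integral>y. \<integral>x. (V x y)\<^sup>2 \<partial>M1 \<partial>M2)"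
      by (rule Fubini_bounded[OF p comp[OF V]])
    also have "\<dots> \<le> (\<integral>y. \<kappa>\<^sup>2 * (\<integral>x. (G x y)\<^sup>2 \<partial>M1) + (1 - \<kappa>\<^sup>2) * (\<integral>x. G x y \<partial>M1)\<^sup>2 \<partial>M2)"
    proof (rule integral_mono)
      show "integrable M2 (\<lambda>y. \<integral>x. (V x y)\<^sup>2 \<partial>M1)" by (rule int2[OF ker[OF bounded_measurable_swap[OF comp[OF V]] const(1)]])
      show "integrable M2 (\<lambda>y. \<kappa>\<^sup>2 * (\<integral>x. (G x y)\<^sup>2 \<partial>M1) + (1 - \<kappa>\<^sup>2) * (\<integral>x. G x y \<partial>M1)\<^sup>2)"
        using int2[OF ker[OF bounded_measurable_swap[OF comp[OF G]] const(1)]] 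
          int2[OF bounded_measurable_power2[OF ker[OF bounded_measurable_swap[OF G] const(1)]]] by simp
      fix y assume "y \<in> space M2"
      from c1 sec(2)[OF G this]
      show "(\<integral>x. (V x y)\<^sup>2 \<partial>M1) \<le> \<kappa>\<^sup>2 * (\<integral>x. (G x y)\<^sup>2 \<partial>M1) + (1 - \<kappa>\<^sup>2) * (\<integral>x. G x y \<partial>M1)\<^sup>2"
        by (auto simp: koopman_contracts_def V_def)
    qed
    also have "\<dots> = \<kappa>\<^sup>2 * (\<integral>y. \<integral>x. (G x y)\<^sup>2 \<partial>M1 \<partial>M2) + (1 - \<kappa>\<^sup>2) * (\<integral>y. (\<integral>x. G x y \<partial>M1)\<^sup>2 \<partial>M2)"
      using int2[OF ker[OF bounded_measurable_swap[OF comp[OF G]] const(1)]] 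
          int2[OF bounded_measurable_power2[OF ker[OF bounded_measurable_swap[OF G] const(1)]]] by simp
    also have "(\<integral>y. \<integral>x. (G x y)\<^sup>2 \<partial>M1 \<partial>M2) = (\<integral>x. \<integral>y. (G x y)\<^sup>2 \<partial>M2 \<partial>M1)"
      by (rule Fubini_bounded[OF p comp[OF G], symmetric])
    finally show ?thesis .
  qed
  \<comment> \<open>F - A - B + m is the interaction part of F, orthogonal to functions of one
    coordinate; its squared norm is S - a - b + m^2, hence nonnegative.\<close>
  have ab: "a + b \<le> S + m\<^sup>2"
  proof -
    have *: "(\<integral>y. (F x y - A x - B y + m)\<^sup>2 \<partial>M2) = (\<integral>y. (F x y)\<^sup>2 \<partial>M2) - (A x)\<^sup>2 + b - m\<^sup>2
       - 2 * (\<integral>y. F x y * B y \<partial>M2) + 2 * m * A x" if x: "x \<in> space M1" for x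
    proof -
      note bm = sec(1)[OF F x]
      have i: "integrable M2 (\<lambda>y. (F x y)\<^sup>2)" "integrable M2 (F x)" "integrable M2 (\<lambda>y. F x y * B y)"
        "integrable M2 B" "integrable M2 (\<lambda>y. (B y)\<^sup>2)"
        by (intro int2 bounded_measurable_power2 bounded_measurable_mult bm B)+
      have "(\<integral>y. (F x y - A x - B y + m)\<^sup>2 \<partial>M2)
        = (\<integral>y. (F x y)\<^sup>2 - 2 * (A x - m) * F x y - 2 * (F x y * B y) + 2 * (A x - m) * B y + (B y)\<^sup>2 + (A x - m)\<^sup>2 \<partial>M2)"
        by (intro Bochner_Integration.integral_cong refl) (simp add: power2_eq_square algebra_simps)
      also have "\<dots> = (\<integral>y. (F x y)\<^sup>2 \<partial>M2) - 2 * (A x - m) * A x - 2 * (\<integral>y. F x y * B y \<partial>M2) + 2 * (A x - m) * m + b + (A x - m)\<^sup>2"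
        using i by (simp add: A_def mB b_def M2.prob_space)
      finally show ?thesis by (simp add: power2_eq_square algebra_simps)
    qed
    have FB: "bounded_measurable (M1 \<Otimes>\<^sub>M M2) (\<lambda>(x, y). F x y * B y)"
    proof -
      have "bounded_measurable (M1 \<Otimes>\<^sub>M M2) (\<lambda>z. B (snd z))"
        using B by (auto simp: bounded_measurable_def space_pair_measure intro: measurable_compose[OF measurable_snd])
      from bounded_measurable_mult[OF F this] show ?thesis by (simp add: case_prod_unfold)
    qed
    have "(\<integral>x. \<integral>y. F x y * B y \<partial>M2 \<partial>M1) = (\<integral>y. \<integral>x. F x y * B y \<partial>M1 \<partial>M2)"
      by (rule Fubini_bounded[OF p FB])
    also have "\<dots> = b" by (simp add: b_def B_def power2_eq_square)
    finally have FBb: "(\<integral>x. \<integral>y. F x y * B y \<partial>M2 \<partial>M1) = b" .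
    have "0 \<le> (\<integral>x. \<integral>y. (F x y - A x - B y + m)\<^sup>2 \<partial>M2 \<partial>M1)"
      by (intro Bochner_Integration.integral_nonneg) auto
    also have "\<dots> = (\<integral>x. (\<integral>y. (F x y)\<^sup>2 \<partial>M2) - (A x)\<^sup>2 + b - m\<^sup>2 - 2 * (\<integral>y. F x y * B y \<partial>M2) + 2 * m * A x \<partial>M1)"
      by (intro Bochner_Integration.integral_cong refl *)
    also have "\<dots> = S - a + b - m\<^sup>2 - 2 * b + 2 * m * m"
      using int1[OF ker[OF comp[OF F] const(2)]] int1[OF bounded_measurable_power2[OF A]]
        int1[OF ker[OF FB const(2)]] int1[OF A] FBb
      by (simp add: S_def a_def mA M1.prob_space)
    finally show ?thesis by (simp add: power2_eq_square)
  qed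
  have k: "0 \<le> 1 - \<kappa>\<^sup>2" "0 \<le> \<kappa>\<^sup>2" using \<kappa> by (auto simp: power_le_one)
  have "(\<integral>x. \<integral>y. (V x y)\<^sup>2 \<partial>M2 \<partial>M1) \<le> \<kappa>\<^sup>2 * (\<kappa>\<^sup>2 * S + (1 - \<kappa>\<^sup>2) * a) + (1 - \<kappa>\<^sup>2) * (\<kappa>\<^sup>2 * b + (1 - \<kappa>\<^sup>2) * m\<^sup>2)"
    using V1 mult_left_mono[OF G1 k(2)] mult_left_mono[OF G2 k(1)] by linarith
  also have "\<dots> = \<kappa>\<^sup>2 * \<kappa>\<^sup>2 * S + \<kappa>\<^sup>2 * (1 - \<kappa>\<^sup>2) * (a + b) + (1 - \<kappa>\<^sup>2) * (1 - \<kappa>\<^sup>2) * m\<^sup>2"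
    by (simp add: algebra_simps)
  also have "\<dots> \<le> \<kappa>\<^sup>2 * \<kappa>\<^sup>2 * S + \<kappa>\<^sup>2 * (1 - \<kappa>\<^sup>2) * (S + m\<^sup>2) + (1 - \<kappa>\<^sup>2) * (1 - \<kappa>\<^sup>2) * m\<^sup>2"
    using k by (intro add_mono order_refl mult_left_mono ab mult_nonneg_nonneg)
  also have "\<dots> = \<kappa>\<^sup>2 * S + (1 - \<kappa>\<^sup>2) * m\<^sup>2" by (simp add: algebra_simps)
  finally show ?thesis by (simp add: V_def G_def S_def m_def)
qed

section \<open>Products of kernels\<close>

text \<open>In K (x i) the value x i is meaningful only for i in I, whereas product measures are
  handled for families that are sigma-finite at every index. A one-point space is put outside I;
  products over I do not notice it.\<close>

definition prob_extend :: "'i set \<Rightarrow> ('i \<Rightarrow> 'a measure) \<Rightarrow> 'i \<Rightarrow> 'a measure" where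
  "prob_extend I N i = (if i \<in> I then N i else count_space {undefined})"

lemma product_sigma_finite_prob_extend:
  assumes "\<And>i. i \<in> I \<Longrightarrow> prob_space (N i)"
  shows "product_sigma_finite (prob_extend I N)"
proof -
  have "prob_space (prob_extend I N i)" for i
    using assms by (auto simp: prob_extend_def intro!: prob_spaceI)
  then show ?thesis
    by (simp add: product_sigma_finite_def prob_space_imp_sigma_finite)
qed

lemma PiM_prob_extend: "J \<subseteq> I \<Longrightarrow> PiM J (prob_extend I N) = PiM J N"
  by (rule PiM_cong) (auto simp: prob_extend_def)

lemma emeasure_PiM_prob:
  assumes "finite I" "\<And>i. i \<in> I \<Longrightarrow> prob_space (N i)" "\<And>i. i \<in> I \<Longrightarrow> A i \<in> sets (N i)"
  shows "emeasure (PiM I N) (Pi\<^sub>E I A) = (\<Prod>i\<in>I. emeasure (N i) (A i))"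
  using product_sigma_finite.emeasure_PiM[OF product_sigma_finite_prob_extend[of I N, OF assms(2)] assms(1), where A=A] assms(3)
  by (simp add: PiM_prob_extend prob_extend_def)

lemma PiM_eqI_prob:
  assumes "finite I" "\<And>i. i \<in> I \<Longrightarrow> prob_space (N i)" "sets P = sets (PiM I N)"
    and "\<And>A. (\<And>i. i \<in> I \<Longrightarrow> A i \<in> sets (N i)) \<Longrightarrow> emeasure P (Pi\<^sub>E I A) = (\<Prod>i\<in>I. emeasure (N i) (A i))"
  shows "P = PiM I N"
  using product_sigma_finite.PiM_eqI[OF product_sigma_finite_prob_extend[of I N, OF assms(2)] assms(1), where P=P] assms(3,4)
  by (simp add: PiM_prob_extend prob_extend_def)

lemma integral_PiM_insert:
  fixes f :: "('i \<Rightarrow> 'a) \<Rightarrow> real"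
  assumes "finite I" "i \<notin> I" "\<And>j. j \<in> insert i I \<Longrightarrow> prob_space (N j)" "integrable (PiM (insert i I) N) f"
  shows "integral\<^sup>L (PiM (insert i I) N) f = (\<integral>x. (\<integral>y. f (x(i:=y)) \<partial>N i) \<partial>PiM I N)"
  using product_sigma_finite.product_integral_insert[OF product_sigma_finite_prob_extend[of "insert i I" N, OF assms(3)] assms(1,2), where f=f] assms(4)
  by (simp add: PiM_prob_extend subset_insertI) (simp add: prob_extend_def)

definition product_kernel :: "'i set \<Rightarrow> ('a \<Rightarrow> 'a measure) \<Rightarrow> ('i \<Rightarrow> 'a) \<Rightarrow> ('i \<Rightarrow> 'a) measure" where
  "product_kernel I L x = PiM I (\<lambda>i. L (x i))"

text \<open>Measurability is checked on rectangles, where the measure is a finite product of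
  measurable functions of single coordinates.\<close>

lemma product_kernel_measurable:
  assumes I: "finite I" and L[measurable]: "L \<in> M \<rightarrow>\<^sub>M prob_algebra M"
  shows "product_kernel I L \<in> PiM I (\<lambda>_. M) \<rightarrow>\<^sub>M prob_algebra (PiM I (\<lambda>_. M))"
proof (rule measurable_prob_algebra_generated[OF sets_PiM Int_stable_prod_algebra prod_algebra_sets_into_space])
  have Lx: "prob_space (L (x i)) \<and> sets (L (x i)) = sets M" if "x \<in> space (PiM I (\<lambda>_. M))" "i \<in> I" for x i
    using measurable_space[OF L, of "x i"] that by (auto simp: space_prob_algebra space_PiM)
  show "prob_space (product_kernel I L x)" if "x \<in> space (PiM I (\<lambda>_. M))" for x
    unfolding product_kernel_def using Lx[OF that] by (intro prob_space_PiM) auto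
  show "sets (product_kernel I L x) = sets (PiM I (\<lambda>_. M))" if "x \<in> space (PiM I (\<lambda>_. M))" for x
    unfolding product_kernel_def using Lx[OF that] by (intro sets_PiM_cong) auto
  fix A assume "A \<in> prod_algebra I (\<lambda>_. M)"
  then obtain E where E: "A = Pi\<^sub>E I E" "E \<in> (\<Pi> i\<in>I. sets M)" by (rule prod_algebraE_all)
  have "(\<lambda>x. \<Prod>i\<in>I. emeasure (L (x i)) (E i)) \<in> borel_measurable (PiM I (\<lambda>_. M))"
  proof (rule borel_measurable_prod_ennreal)
    fix i assume i: "i \<in> I"
    have "(\<lambda>y. emeasure (L y) (E i)) \<in> borel_measurable M"
      using i E by (intro measurable_emeasure_kernel[OF measurable_prob_algebraD[OF L]]) auto
    from measurable_compose[OF measurable_component_singleton[OF i] this]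
    show "(\<lambda>x. emeasure (L (x i)) (E i)) \<in> borel_measurable (PiM I (\<lambda>_. M))" .
  qed
  then show "(\<lambda>x. emeasure (product_kernel I L x) A) \<in> borel_measurable (PiM I (\<lambda>_. M))"
  proof (rule measurable_cong[THEN iffD1, rotated])
    fix x assume x: "x \<in> space (PiM I (\<lambda>_. M))"
    show "(\<Prod>i\<in>I. emeasure (L (x i)) (E i)) = emeasure (product_kernel I L x) A"
      unfolding product_kernel_def E(1) using Lx[OF x] E(2) I by (intro emeasure_PiM_prob[symmetric]) auto
  qed
qed

text \<open>Independence: on a rectangle the integrand is a product of functions of separate
  coordinates, so the integral factors. The initial measures \<open>N i\<close> may differ, as they
  do for a chain that has already run for n steps from x.\<close>

lemma PiM_bind_product_kernel:
  assumes I: "finite I" and L: "L \<in> M \<rightarrow>\<^sub>M prob_algebra M"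
    and N: "\<And>i. i \<in> I \<Longrightarrow> prob_space (N i)" "\<And>i. i \<in> I \<Longrightarrow> sets (N i) = sets M"
  shows "PiM I N \<bind> product_kernel I L = PiM I (\<lambda>i. N i \<bind> L)"
proof (rule PiM_eqI_prob[OF I])
  have Ni: "N i \<in> space (prob_algebra M)" if "i \<in> I" for i using N that by (simp add: space_prob_algebra)
  show "prob_space (N i \<bind> L)" if "i \<in> I" for i by (rule prob_space_bind'[OF Ni[OF that] L])
  have sNi: "sets (N i \<bind> L) = sets M" if "i \<in> I" for i by (rule sets_bind'[OF Ni[OF that] L])
  have sP: "sets (PiM I N) = sets (PiM I (\<lambda>_. M))" using N by (intro sets_PiM_cong) auto
  have P: "PiM I N \<in> space (prob_algebra (PiM I (\<lambda>_. M)))"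
    using N by (simp add: space_prob_algebra prob_space_PiM sP)
  show "sets (PiM I N \<bind> product_kernel I L) = sets (PiM I (\<lambda>i. N i \<bind> L))"
    using sets_bind'[OF P product_kernel_measurable[OF I L]] sets_PiM_cong[OF refl sNi, of I] by simp
  fix A assume "\<And>i. i \<in> I \<Longrightarrow> A i \<in> sets (N i \<bind> L)"
  then have A: "A i \<in> sets M" if "i \<in> I" for i using sNi that by blast
  have Lx: "prob_space (L (x i)) \<and> sets (L (x i)) = sets M" if "x \<in> space (PiM I N)" "i \<in> I" for x i
    using measurable_space[OF L, of "x i"] that sets_eq_imp_space_eq[OF N(2)[OF that(2)]]
    by (auto simp: space_prob_algebra space_PiM)
  have m: "(\<lambda>y. emeasure (L y) (A i)) \<in> borel_measurable (N i)" if "i \<in> I" for i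
    using measurable_emeasure_kernel[OF measurable_prob_algebraD[OF L] A[OF that]]
    by (simp add: measurable_cong_sets[OF N(2)[OF that] refl])
  have "emeasure (PiM I N \<bind> product_kernel I L) (Pi\<^sub>E I A) = (\<integral>\<^sup>+x. emeasure (product_kernel I L x) (Pi\<^sub>E I A) \<partial>PiM I N)"
    using A I by (intro emeasure_bind_prob_algebra[OF P product_kernel_measurable[OF I L]]) (auto intro!: sets_PiM_I_finite)
  also have "\<dots> = (\<integral>\<^sup>+x. (\<Prod>i\<in>I. emeasure (L (x i)) (A i)) \<partial>PiM I N)"
    unfolding product_kernel_def using Lx A I by (intro nn_integral_cong emeasure_PiM_prob) auto
  also have "\<dots> = (\<Prod>i\<in>I. \<integral>\<^sup>+y. emeasure (L y) (A i) \<partial>N i)"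
    using product_sigma_finite.product_nn_integral_prod[OF product_sigma_finite_prob_extend[of I N, OF N(1)] I, where f="\<lambda>i y. emeasure (L y) (A i)"] m
    by (simp add: PiM_prob_extend prob_extend_def)
  also have "\<dots> = (\<Prod>i\<in>I. emeasure (N i \<bind> L) (A i))"
    using A by (intro prod.cong refl emeasure_bind_prob_algebra[OF Ni L, symmetric]) auto
  finally show "emeasure (PiM I N \<bind> product_kernel I L) (Pi\<^sub>E I A) = (\<Prod>i\<in>I. emeasure (N i \<bind> L) (A i))" .
qed

context stationary_kernel begin

lemma product_stationary: "finite I \<Longrightarrow> stationary_kernel (PiM I (\<lambda>_. M)) (product_kernel I K)"
  by (intro stationary_kernel.intro prob_space_PiM stationary_kernel_axioms.intro product_kernel_measurable kernel)
     (simp_all add: prob_space_axioms PiM_bind_product_kernel[OF _ kernel] stationary)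

text \<open>The gap comes with a constant for each n, so the n-step kernel is what gets tensorized;
  this identifies the result with n steps of the product chain. The start of the induction says that
  a point mass is a product of point masses.\<close>

lemma kernel_power_product_kernel:
  assumes I: "finite I" and x: "x \<in> space (PiM I (\<lambda>_. M))"
  shows "kernel_power (PiM I (\<lambda>_. M)) (product_kernel I K) n x = product_kernel I (kernel_power M K n) x"
proof (induction n)
  case 0
  have xi: "x i \<in> space M" if "i \<in> I" for i using x that by (auto simp: space_PiM)
  have "return (PiM I (\<lambda>_. M)) x = PiM I (\<lambda>i. return M (x i))"
  proof (rule PiM_eqI_prob[OF I])
    show "sets (return (PiM I (\<lambda>_. M)) x) = sets (PiM I (\<lambda>i. return M (x i)))"
      by (simp cong: sets_PiM_cong)
    fix A assume A: "\<And>i. i \<in> I \<Longrightarrow> A i \<in> sets (return M (x i))"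
    have "indicator (Pi\<^sub>E I A) x = (\<Prod>i\<in>I. indicator (A i) (x i) :: ennreal)"
      using x I by (auto simp: indicator_def space_PiM PiE_iff prod_zero_iff)
    then show "emeasure (return (PiM I (\<lambda>_. M)) x) (Pi\<^sub>E I A) = (\<Prod>i\<in>I. emeasure (return M (x i)) (A i))"
      using A I by (simp add: sets_PiM_I_finite)
  qed (simp add: prob_space_return xi)
  then show ?case by (simp add: product_kernel_def)
next
  case (Suc n)
  interpret L: stationary_kernel M "kernel_power M K n" by (rule kernel_power_stationary)
  have xi: "x i \<in> space M" if "i \<in> I" for i using x that by (auto simp: space_PiM)
  have "PiM I (\<lambda>i. kernel_power M K n (x i)) \<bind> product_kernel I K = PiM I (\<lambda>i. kernel_power M K n (x i) \<bind> K)"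
    by (rule PiM_bind_product_kernel[OF I kernel]) (simp_all add: L.kernel_prob_space xi)
  with Suc show ?case
    by (simp only: kernel_power.simps product_kernel_def[of I "kernel_power M K n"]
        product_kernel_def[of I "\<lambda>x. kernel_power M K n x \<bind> K"])
qed

text \<open>Coordinates are added one at a time, and the two-factor estimate returns the constant
  unchanged; the bound is therefore the same for any number of factors.\<close>

lemma koopman_contracts_product:
  assumes "finite I" and contr: "koopman_contracts M K \<kappa>" and \<kappa>: "0 \<le> \<kappa>" "\<kappa> \<le> 1"
  shows "koopman_contracts (PiM I (\<lambda>_. M)) (product_kernel I K) \<kappa>"
  using assms(1)
proof (induction I)
  \<comment> \<open>Over a one-point space the operator is the identity, and both sides
    agree.\<close>
  case empty
  show ?case
    unfolding koopman_contracts_def koopman_def product_kernel_def PiM_empty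
    by (simp add: lebesgue_integral_count_space_finite algebra_simps)
next
  case (insert i I)
  let ?P = "PiM I (\<lambda>_. M)" and ?P' = "PiM (insert i I) (\<lambda>_. M)"
  interpret P: stationary_kernel ?P "product_kernel I K" by (rule product_stationary[OF insert(1)])
  interpret P': stationary_kernel ?P' "product_kernel (insert i I) K" using insert(1) by (intro product_stationary) auto
  show ?case
    unfolding koopman_contracts_def
  proof (intro allI impI)
    fix f assume f: "bounded_measurable ?P' f"
    define F where "F = (\<lambda>x y. f (x(i := y)))"
    have F: "bounded_measurable (?P \<Otimes>\<^sub>M M) (\<lambda>(x, y). F x y)"
    proof -
      have m: "(\<lambda>(x, y). x(i := y)) \<in> ?P \<Otimes>\<^sub>M M \<rightarrow>\<^sub>M ?P'" by (rule measurable_add_dim)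
      obtain b where b: "\<And>x. x \<in> space ?P' \<Longrightarrow> \<bar>f x\<bar> \<le> b" using f by (auto simp: bounded_measurable_def)
      show ?thesis
        using measurable_compose[OF m bounded_measurableD[OF f]] b[OF measurable_space[OF m]]
        by (intro bounded_measurableI[where b=b]) (auto simp: F_def case_prod_unfold)
    qed
    have int: "integral\<^sup>L ?P' g = (\<integral>x. (\<integral>y. g (x(i:=y)) \<partial>M) \<partial>?P)" if "bounded_measurable ?P' g" for g
      using insert(1,2) that
      by (intro integral_PiM_insert P'.integrable_bounded_measurable) (auto simp: prob_space_axioms)
    have koop: "koopman (product_kernel (insert i I) K) f (x(i := y)) = koopman (product_kernel I K) (\<lambda>x'. koopman K (F x') y) x"
      if x: "x \<in> space ?P" and y: "y \<in> space M" for x y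
    proof -
      have xy: "x(i := y) \<in> space ?P'" using x y by (auto simp: space_PiM PiE_iff extensional_def)
      have "integrable (product_kernel (insert i I) K (x(i := y))) f"
        by (rule P'.integrable_kernel[OF f xy])
      moreover have "prob_space (K ((x(i := y)) j))" if "j \<in> insert i I" for j
        using x y that by (intro kernel_prob_space) (auto simp: space_PiM)
      moreover have "PiM I (\<lambda>j. K ((x(i := y)) j)) = PiM I (\<lambda>j. K (x j))"
        using insert(2) by (intro PiM_cong) auto
      ultimately show ?thesis
        using integral_PiM_insert[OF insert(1,2), of "\<lambda>j. K ((x(i := y)) j)" f]
        by (simp add: koopman_def product_kernel_def F_def)
    qed
    have "(\<integral>x. (koopman (product_kernel (insert i I) K) f x)\<^sup>2 \<partial>?P')
        = (\<integral>x. (\<integral>y. (koopman (product_kernel I K) (\<lambda>x'. koopman K (F x') y) x)\<^sup>2 \<partial>M) \<partial>?P)"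
      unfolding int[OF bounded_measurable_power2[OF P'.bounded_measurable_koopman[OF f]]]
      by (intro Bochner_Integration.integral_cong refl) (simp add: koop)
    also have "\<dots> \<le> \<kappa>\<^sup>2 * (\<integral>x. \<integral>y. (F x y)\<^sup>2 \<partial>M \<partial>?P) + (1 - \<kappa>\<^sup>2) * (\<integral>x. \<integral>y. F x y \<partial>M \<partial>?P)\<^sup>2"
      by (rule koopman_contracts_pair[OF P.stationary_kernel_axioms stationary_kernel_axioms insert(3) contr \<kappa> F])
    also have "\<dots> = \<kappa>\<^sup>2 * (\<integral>x. (f x)\<^sup>2 \<partial>?P') + (1 - \<kappa>\<^sup>2) * (\<integral>x. f x \<partial>?P')\<^sup>2"
      unfolding int[OF bounded_measurable_power2[OF f]] int[OF f] F_def ..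
    finally show "(\<integral>x. (koopman (product_kernel (insert i I) K) f x)\<^sup>2 \<partial>?P')
       \<le> \<kappa>\<^sup>2 * (\<integral>x. (f x)\<^sup>2 \<partial>?P') + (1 - \<kappa>\<^sup>2) * (\<integral>x. f x \<partial>?P')\<^sup>2" .
  qed
qed

lemma koopman_contracts_kernel_power_product:
  assumes I: "finite I" and contr: "koopman_contracts M (kernel_power M K n) \<kappa>" and \<kappa>: "0 \<le> \<kappa>" "\<kappa> \<le> 1"
  shows "koopman_contracts (PiM I (\<lambda>_. M)) (kernel_power (PiM I (\<lambda>_. M)) (product_kernel I K) n) \<kappa>"
proof -
  interpret L: stationary_kernel M "kernel_power M K n" by (rule kernel_power_stationary)
  have "koopman_contracts (PiM I (\<lambda>_. M)) (product_kernel I (kernel_power M K n)) \<kappa>"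
    by (rule L.koopman_contracts_product[OF I contr \<kappa>])
  moreover have "(\<integral>x. (koopman (kernel_power (PiM I (\<lambda>_. M)) (product_kernel I K) n) f x)\<^sup>2 \<partial>PiM I (\<lambda>_. M))
      = (\<integral>x. (koopman (product_kernel I (kernel_power M K n)) f x)\<^sup>2 \<partial>PiM I (\<lambda>_. M))" for f
    by (intro Bochner_Integration.integral_cong refl) (simp add: koopman_def kernel_power_product_kernel[OF I])
  ultimately show ?thesis by (simp add: koopman_contracts_def)
qed

end

section \<open>Bounded operators\<close>

lemma Lp_bounded_linear_Lp: "Lp_bounded_linear p M A \<Longrightarrow> f \<in> Lp p M \<Longrightarrow> A f \<in> Lp p M"
  by (simp add: Lp_bounded_linear_def)

lemma Lp_bounded_linear_add: "Lp_bounded_linear p M A \<Longrightarrow> f \<in> Lp p M \<Longrightarrow> g \<in> Lp p M \<Longrightarrow>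
    AE x in M. A (\<lambda>y. f y + g y) x = A f x + A g x"
  by (simp add: Lp_bounded_linear_def)

lemma Lp_bounded_linear_scale: "Lp_bounded_linear p M A \<Longrightarrow> f \<in> Lp p M \<Longrightarrow>
    AE x in M. A (\<lambda>y. c * f y) x = c * A f x"
  by (simp add: Lp_bounded_linear_def)

lemma Lp_bounded_linear_bound:
  assumes "Lp_bounded_linear p M A"
  obtains B where "B \<ge> 0" "\<And>f. f \<in> Lp p M \<Longrightarrow> Lp_norm p M (A f) \<le> B * Lp_norm p M f"
proof -
  obtain B where B: "\<And>f. f \<in> Lp p M \<Longrightarrow> Lp_norm p M (A f) \<le> B * Lp_norm p M f"
    using assms unfolding Lp_bounded_linear_def by blast
  have "Lp_norm p M (A f) \<le> \<bar>B\<bar> * Lp_norm p M f" if "f \<in> Lp p M" for f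
    using B[OF that] mult_right_mono[OF abs_ge_self[of B] Lp_norm_nonneg[of p M f]] by linarith
  then show ?thesis by (intro that[of "\<bar>B\<bar>"]) auto
qed

lemma Lp_bounded_linear_diff:
  assumes A: "Lp_bounded_linear p M A" and f: "f \<in> Lp p M" "g \<in> Lp p M"
  shows "AE x in M. A (\<lambda>y. f y - g y) x = A f x - A g x"
  using Lp_bounded_linear_add[OF A f(1) Lp_scale[OF f(2), of "-1"]] Lp_bounded_linear_scale[OF A f(2), of "-1"]
  by eventually_elim simp

lemma Lp_bounded_linear_cong_AE:
  assumes A: "Lp_bounded_linear p M A" and f: "f \<in> Lp p M" "g \<in> Lp p M" and p: "p \<ge> 1"
    and eq: "AE x in M. f x = g x"
  shows "AE x in M. A f x = A g x"
proof -
  obtain B where B: "B \<ge> 0" "\<And>f. f \<in> Lp p M \<Longrightarrow> Lp_norm p M (A f) \<le> B * Lp_norm p M f"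
    using Lp_bounded_linear_bound[OF A] by blast
  have d: "(\<lambda>x. f x - g x) \<in> Lp p M" by (rule Lp_diff[OF f p])
  have "Lp_norm p M (\<lambda>x. f x - g x) = 0" using Lp_AE_eq_iff[OF f p] eq by simp
  then have "Lp_norm p M (A (\<lambda>x. f x - g x)) = 0"
    using B(2)[OF d] by (intro antisym Lp_norm_nonneg) auto
  then have "AE x in M. A (\<lambda>x. f x - g x) x = 0"
    using Lp_norm_eq_0_iff[OF Lp_bounded_linear_Lp[OF A d]] p by simp
  with Lp_bounded_linear_diff[OF A f] show ?thesis by eventually_elim simp
qed

lemma Lp_bounded_linear_id: "Lp_bounded_linear p M (\<lambda>f. f)"
  by (auto simp: Lp_bounded_linear_def intro: exI[of _ 1])

lemma Lp_bounded_linear_compose: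
  assumes A: "Lp_bounded_linear p M A" and B: "Lp_bounded_linear p M B" and p: "p \<ge> 1"
  shows "Lp_bounded_linear p M (\<lambda>f. A (B f))"
proof -
  note [simp] = Lp_bounded_linear_Lp[OF A] Lp_bounded_linear_Lp[OF B]
  obtain a where a: "a \<ge> 0" "\<And>f. f \<in> Lp p M \<Longrightarrow> Lp_norm p M (A f) \<le> a * Lp_norm p M f"
    using Lp_bounded_linear_bound[OF A] by blast
  obtain b where b: "b \<ge> 0" "\<And>f. f \<in> Lp p M \<Longrightarrow> Lp_norm p M (B f) \<le> b * Lp_norm p M f"
    using Lp_bounded_linear_bound[OF B] by blast
  show ?thesis
    unfolding Lp_bounded_linear_def
  proof (intro conjI ballI allI exI[of _ "a * b"])
    fix f g assume f: "f \<in> Lp p M" and g: "g \<in> Lp p M"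
    show "AE x in M. A (B (\<lambda>y. f y + g y)) x = A (B f) x + A (B g) x"
      using Lp_bounded_linear_cong_AE[OF A _ _ p Lp_bounded_linear_add[OF B f g]] 
        Lp_bounded_linear_add[OF A, of "B f" "B g"] f g by (auto simp: Lp_add p elim!: eventually_elim2)
  next
    fix c f assume f: "f \<in> Lp p M"
    show "AE x in M. A (B (\<lambda>y. c * f y)) x = c * A (B f) x"
      using Lp_bounded_linear_cong_AE[OF A _ _ p Lp_bounded_linear_scale[OF B f, of c]] 
        Lp_bounded_linear_scale[OF A, of "B f" c] f by (auto simp: Lp_scale p elim!: eventually_elim2)
  next
    fix f assume f: "f \<in> Lp p M"
    show "A (B f) \<in> Lp p M" using f by simp
    have "Lp_norm p M (A (B f)) \<le> a * Lp_norm p M (B f)" using f by (intro a) simp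
    also have "\<dots> \<le> a * (b * Lp_norm p M f)" using f by (intro mult_left_mono b a)
    finally show "Lp_norm p M (A (B f)) \<le> a * b * Lp_norm p M f" by (simp add: mult.assoc)
  qed
qed

lemma Lp_bounded_linear_funpow:
  assumes A: "Lp_bounded_linear p M A" and p: "p \<ge> 1"
  shows "Lp_bounded_linear p M (A ^^ n)"
proof (induction n)
  case 0
  show ?case using Lp_bounded_linear_id by (simp add: id_def)
next
  case (Suc n)
  show ?case using Lp_bounded_linear_compose[OF A Suc p] by (simp add: comp_def)
qed

context markov_op begin

lemma Lp_bounded_linear_T:
  assumes "p \<ge> 1"
  shows "Lp_bounded_linear p M T"
  unfolding Lp_bounded_linear_def
  using T_Lp[OF _ assms] T_add T_scale Lp_integrable[OF _ assms]
  by (auto intro!: exI[of _ 1])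

end

section \<open>The tensor power of the transfer operator\<close>

lemma (in finite_measure) integrable_indicator_complex:
  "A \<in> sets M \<Longrightarrow> integrable M (indicator A :: 'a \<Rightarrow> complex)"
  by (intro integrable_const_bound[where B=1]) (auto simp: indicator_def)

lemma L1_operators_eq_limit:
  assumes M: "prob_space M"
    and Q: "Lp_bounded_linear 1 M Q" and R: "Lp_bounded_linear 1 M R"
    and s: "\<And>n. integrable M (s n)" and f: "integrable M f"
    and lim: "(\<lambda>n. \<integral>x. norm (f x - s n x) \<partial>M) \<longlonglongrightarrow> 0"
    and eq: "\<And>n. AE x in M. Q (s n) x = R (s n) x"
  shows "AE x in M. Q f x = R f x"
proof -
  interpret prob_space M by fact
  obtain a where a: "a \<ge> 0" "\<And>f. f \<in> Lp 1 M \<Longrightarrow> Lp_norm 1 M (Q f) \<le> a * Lp_norm 1 M f"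
    using Lp_bounded_linear_bound[OF Q] by blast
  obtain b where b: "b \<ge> 0" "\<And>f. f \<in> Lp 1 M \<Longrightarrow> Lp_norm 1 M (R f) \<le> b * Lp_norm 1 M f"
    using Lp_bounded_linear_bound[OF R] by blast
  have L: "f \<in> Lp 1 M" "s n \<in> Lp 1 M" for n using f s by (simp_all add: Lp_1_iff)
  note LQ = Lp_bounded_linear_Lp[OF Q] and LR = Lp_bounded_linear_Lp[OF R]
  let ?N = "Lp_norm 1 M (\<lambda>x. Q f x - R f x)"
  have "?N \<le> (a + b) * (\<integral>x. norm (f x - s n x) \<partial>M)" for n
  proof -
    have d: "(\<lambda>x. f x - s n x) \<in> Lp 1 M" by (intro Lp_diff L) simp
    have "AE x in M. Q f x - R f x = Q (\<lambda>x. f x - s n x) x - R (\<lambda>x. f x - s n x) x"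
      using Lp_bounded_linear_diff[OF Q L(1) L(2)[of n]] Lp_bounded_linear_diff[OF R L(1) L(2)[of n]] eq[of n]
      by eventually_elim simp
    then have "?N = Lp_norm 1 M (\<lambda>x. Q (\<lambda>x. f x - s n x) x - R (\<lambda>x. f x - s n x) x)"
      using LQ[OF L(1)] LR[OF L(1)] LQ[OF d] LR[OF d] by (intro Lp_norm_cong_AE) (auto dest!: Lp_measurable)
    also have "\<dots> \<le> Lp_norm 1 M (Q (\<lambda>x. f x - s n x)) + Lp_norm 1 M (R (\<lambda>x. f x - s n x))"
      by (intro Lp_norm_triangle_diff LQ LR d) simp
    also have "\<dots> \<le> a * Lp_norm 1 M (\<lambda>x. f x - s n x) + b * Lp_norm 1 M (\<lambda>x. f x - s n x)"
      by (intro add_mono a b d)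
    finally show ?thesis by (simp add: Lp_norm_1 algebra_simps)
  qed
  moreover have "(\<lambda>n. (a + b) * (\<integral>x. norm (f x - s n x) \<partial>M)) \<longlonglongrightarrow> (a + b) * 0"
    by (intro tendsto_mult_left lim)
  ultimately have "?N \<le> 0" by (intro LIMSEQ_le_const[where x=0]) auto
  then have "?N = 0" by (intro antisym Lp_norm_nonneg) 
  then show ?thesis using Lp_AE_eq_iff[OF LQ[OF L(1)] LR[OF L(1)]] by simp
qed

text \<open>A pi-lambda argument passes from the generator to all measurable sets, linearity to
  simple functions, and L^1 continuity to the rest. That the whole space lies in G provides the
  complements.\<close>

lemma L1_operators_eqI:
  assumes M: "prob_space M"
    and Q: "Lp_bounded_linear 1 M Q" and R: "Lp_bounded_linear 1 M R"
    and G: "sets M = sigma_sets (space M) G" "Int_stable G" "G \<subseteq> Pow (space M)" "space M \<in> G"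
    and eq: "\<And>A. A \<in> G \<Longrightarrow> AE x in M. Q (indicator A) x = R (indicator A) x"
    and f: "integrable M f"
  shows "AE x in M. Q f x = R f x"
proof -
  interpret prob_space M by fact
  have ind: "(indicator A :: _ \<Rightarrow> complex) \<in> Lp 1 M" if "A \<in> sets M" for A
    using that by (simp add: Lp_1_iff integrable_indicator_complex)
  have cong: "AE x in M. Q f x = R f x" if "AE x in M. Q g x = R g x" "AE x in M. f x = g x" 
    "f \<in> Lp 1 M" "g \<in> Lp 1 M" for f g
    using Lp_bounded_linear_cong_AE[OF Q that(3,4) order_refl that(2)] Lp_bounded_linear_cong_AE[OF R that(3,4) order_refl that(2)] that(1)
    by eventually_elim simp
  have Q_add: "AE x in M. Q (\<lambda>x. f x + g x) x = R (\<lambda>x. f x + g x) x"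
    if "AE x in M. Q f x = R f x" "AE x in M. Q g x = R g x" "f \<in> Lp 1 M" "g \<in> Lp 1 M" for f g
    using Lp_bounded_linear_add[OF Q that(3,4)] Lp_bounded_linear_add[OF R that(3,4)] that(1,2)
    by eventually_elim simp
  have scale: "AE x in M. Q (\<lambda>x. c * f x) x = R (\<lambda>x. c * f x) x"
    if "AE x in M. Q f x = R f x" "f \<in> Lp 1 M" for f c
    using Lp_bounded_linear_scale[OF Q that(2), of c] Lp_bounded_linear_scale[OF R that(2), of c] that(1)
    by eventually_elim simp
  have zero: "AE x in M. Q (\<lambda>x. 0) x = R (\<lambda>x. 0) x"
    using Lp_bounded_linear_scale[OF Q Lp_zero, of 0] Lp_bounded_linear_scale[OF R Lp_zero, of 0]
    by eventually_elim simp
  have indeq: "AE x in M. Q (indicator A) x = R (indicator A) x" if "A \<in> sets M" for A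
    using G(2,3) that unfolding G(1)
  proof (induction rule: sigma_sets_induct_disjoint)
    case (basic A) then show ?case by (rule eq)
  next
    case empty
    then show ?case using zero by (simp add: indicator_def[abs_def])
  next
    case (compl A)
    then have A: "A \<in> sets M" by (simp add: G(1))
    have "AE x in M. Q (\<lambda>x. indicator (space M) x + - 1 * indicator A x) x = R (\<lambda>x. indicator (space M) x + - 1 * indicator A x) x"
      by (intro Q_add scale Lp_scale compl.IH eq[OF G(4)] ind A) auto
    then show ?case
    proof (rule cong)
      show "AE x in M. indicator (space M - A) x = (indicator (space M) x + - 1 * indicator A x :: complex)"
        using sets.sets_into_space[OF A] by (intro AE_I2) (auto simp: indicator_def)
    qed (use A in \<open>auto intro!: ind Lp_diff simp del: indicator_simps\<close>)
  next
    case (union A)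
    then have A: "A i \<in> sets M" for i by (auto simp: G(1))
    have fin: "AE x in M. Q (\<lambda>x. \<Sum>i<n. indicator (A i) x) x = R (\<lambda>x. \<Sum>i<n. indicator (A i) x) x" for n
    proof (induction n)
      case 0 show ?case using zero by simp
    next
      case (Suc n)
      show ?case using Q_add[OF Suc union.IH[of n] Lp_sum ind[OF A]] by (simp add: ind A)
    qed
    show ?case
    proof (rule L1_operators_eq_limit[OF M Q R _ _ _ fin])
      \<comment> \<open>The L^1 distance from the union to the partial sums is the measure of what
        remains, because the sets are disjoint.\<close>
      have eqI: "norm (indicator (\<Union>i. A i) x - (\<Sum>i<n. indicator (A i) x) :: complex) 
          = indicator (\<Union>i. A i) x - indicator (\<Union>i<n. A i) x" for n x
        using union(1)
        by (subst indicator_UN_disjoint[symmetric]) (auto simp: disjoint_family_on_def indicator_def)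
      have U: "(\<Union>i<n. A i) \<in> sets M" "(\<Union>i. A i) \<in> sets M" for n using A by auto
      have "(\<integral>x. norm (indicator (\<Union>i. A i) x - (\<Sum>i<n. indicator (A i) x) :: complex) \<partial>M)
          = prob (\<Union>i. A i) - prob (\<Union>i<n. A i)" for n
        unfolding eqI using U(1)[of n] U(2) by (subst Bochner_Integration.integral_diff) (auto intro!: integrable_const_bound[where B=1])
      moreover have "(\<lambda>n. prob (\<Union>i. A i) - prob (\<Union>i<n. A i)) \<longlonglongrightarrow> prob (\<Union>i. A i) - prob (\<Union>n. \<Union>i<n. A i)"
        using A by (intro tendsto_diff tendsto_const finite_Lim_measure_incseq) (force simp: incseq_def)+
      moreover have "(\<Union>n. \<Union>i<n. A i) = (\<Union>i. A i)" by auto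
      ultimately show "(\<lambda>n. \<integral>x. norm (indicator (\<Union>i. A i) x - (\<Sum>i<n. indicator (A i) x) :: complex) \<partial>M) \<longlonglongrightarrow> 0"
        by simp
    qed (use A in \<open>auto simp: Lp_1_iff[symmetric] intro!: ind Lp_sum\<close>)
  qed
  show ?thesis
    using f
  proof (induction rule: integrable_induct)
    case (base A c)
    have "AE x in M. Q (\<lambda>x. c * indicator A x) x = R (\<lambda>x. c * indicator A x) x"
      by (intro scale indeq ind base)
    moreover have "(\<lambda>x. c * indicator A x) = (\<lambda>x. indicator A x *\<^sub>R c)" by (auto simp: indicator_def)
    ultimately show ?case by simp
  next
    case (add f g)
    then show ?case by (intro Q_add) (auto simp: Lp_1_iff)
  next
    case (lim f s)
    note [measurable] = borel_measurable_integrable[OF lim.hyps(1)] borel_measurable_integrable[OF lim.hyps(4)]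
    show ?case
    proof (rule L1_operators_eq_limit[OF M Q R lim.hyps(1) lim.hyps(4) _ lim.IH])
      have "(\<lambda>n. \<integral>x. norm (f x - s n x) \<partial>M) \<longlonglongrightarrow> (\<integral>x. 0 \<partial>M)"
      proof (rule integral_dominated_convergence[where w="\<lambda>x. 3 * norm (f x)"])
        show "AE x in M. (\<lambda>n. norm (f x - s n x)) \<longlonglongrightarrow> 0"
          using lim.hyps(2) by (intro AE_I2 tendsto_norm_zero) (auto intro!: tendsto_eq_intros)
        show "AE x in M. norm (norm (f x - s n x)) \<le> 3 * norm (f x)" for n
          using lim.hyps(3) by (intro AE_I2) (auto intro: order_trans[OF norm_triangle_ineq4])
      qed (use lim.hyps in auto)
      then show "(\<lambda>n. \<integral>x. norm (f x - s n x) \<partial>M) \<longlonglongrightarrow> 0" by simp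
    qed
  qed
qed

text \<open>Dominated convergence with majorant |\<phi>|, since the partial sums of the kernel
  masses stay below 1.\<close>

lemma (in stationary_kernel) kernel_image_UNION:
  assumes \<phi>: "integrable M \<phi>" and A: "disjoint_family A" "range A \<subseteq> sets M"
  shows "(\<lambda>i. kernel_image K M \<phi> (A i)) sums kernel_image K M \<phi> (\<Union>i. A i)"
proof -
  have A': "A i \<in> sets M" for i using A by auto
  have sum: "(\<Sum>i<n. kernel_image K M \<phi> (A i)) = (\<integral>x. complex_of_real (\<Sum>i<n. measure (K x) (A i)) * \<phi> x \<partial>M)" for n
    using integrable_kernel_mult[OF \<phi> A'] by (simp add: kernel_image_def sum_distrib_right)
  have K: "(\<lambda>i. measure (K x) (A i)) sums measure (K x) (\<Union>i. A i)" if "x \<in> space M" for x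
    using A that by (intro finite_measure.finite_measure_UNION prob_space.finite_measure kernel_prob_space) auto
  have "(\<lambda>n. \<integral>x. complex_of_real (\<Sum>i<n. measure (K x) (A i)) * \<phi> x \<partial>M) \<longlonglongrightarrow> (\<integral>x. complex_of_real (measure (K x) (\<Union>i. A i)) * \<phi> x \<partial>M)"
  proof (rule integral_dominated_convergence[where w="\<lambda>x. norm (\<phi> x)"])
    have [measurable]: "(\<Union>i. A i) \<in> sets M" "\<phi> \<in> borel_measurable M" using A' \<phi> by auto
    show "(\<lambda>x. complex_of_real (measure (K x) (\<Union>i. A i)) * \<phi> x) \<in> borel_measurable M"
      "(\<lambda>x. complex_of_real (\<Sum>i<n. measure (K x) (A i)) * \<phi> x) \<in> borel_measurable M" for n
      using A' by measurable
    show "AE x in M. (\<lambda>n. complex_of_real (\<Sum>i<n. measure (K x) (A i)) * \<phi> x) \<longlonglongrightarrow> complex_of_real (measure (K x) (\<Union>i. A i)) * \<phi> x"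
      using K by (intro AE_I2 tendsto_intros) (auto simp: sums_def)
    show "AE x in M. norm (complex_of_real (\<Sum>i<n. measure (K x) (A i)) * \<phi> x) \<le> norm (\<phi> x)" for n
    proof (rule AE_I2)
      fix x assume x: "x \<in> space M"
      have "(\<Sum>i<n. measure (K x) (A i)) \<le> measure (K x) (\<Union>i. A i)"
        using sum_le_suminf[OF sums_summable[OF K[OF x]], of "{..<n}"] sums_unique[OF K[OF x]] by simp
      also have "\<dots> \<le> 1" by (rule measure_kernel_le_1[OF x])
      finally show "norm (complex_of_real (\<Sum>i<n. measure (K x) (A i)) * \<phi> x) \<le> norm (\<phi> x)"
        unfolding norm_mult norm_of_real by (intro mult_left_le_one_le) (auto simp: sum_nonneg)
    qed
  qed (use \<phi> in auto)
  then show ?thesis unfolding sums_def sum kernel_image_def[of _ _ _ "\<Union>i. A i"] .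
qed

text \<open>Pi-lambda for complex measures. Both sides carry a kernel because one of them will be
  \<open>return\<close>, for which \<open>kernel_image\<close> is the indefinite integral of a
  density; so an image measure can be compared with a candidate density.\<close>

lemma kernel_image_eqI:
  assumes K: "stationary_kernel M K" and L: "stationary_kernel M L"
    and \<phi>: "integrable M \<phi>" and \<psi>: "integrable M \<psi>"
    and G: "sets M = sigma_sets (space M) G" "Int_stable G" "G \<subseteq> Pow (space M)" "space M \<in> G"
    and eq: "\<And>A. A \<in> G \<Longrightarrow> kernel_image K M \<phi> A = kernel_image L M \<psi> A"
    and A: "A \<in> sets M"
  shows "kernel_image K M \<phi> A = kernel_image L M \<psi> A"
proof -
  interpret K: stationary_kernel M K by fact
  interpret L: stationary_kernel M L by fact
  have kcompl: "kernel_image R M \<eta> (space M - A) = kernel_image R M \<eta> (space M) - kernel_image R M \<eta> A"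
    if R: "stationary_kernel M R" and \<eta>: "integrable M \<eta>" and A: "A \<in> sets M" for R \<eta> A
  proof -
    interpret R: stationary_kernel M R by fact
    have "kernel_image R M \<eta> (space M - A) = (\<integral>x. complex_of_real (measure (R x) (space M)) * \<eta> x - complex_of_real (measure (R x) A) * \<eta> x \<partial>M)"
      unfolding kernel_image_def
    proof (intro Bochner_Integration.integral_cong refl)
      fix x assume x: "x \<in> space M"
      have "measure (R x) (space M - A) = measure (R x) (space M) - measure (R x) A"
        using finite_measure.finite_measure_compl[OF prob_space.finite_measure[OF R.kernel_prob_space[OF x]], of A] x A by simp
      then show "complex_of_real (measure (R x) (space M - A)) * \<eta> x = complex_of_real (measure (R x) (space M)) * \<eta> x - complex_of_real (measure (R x) A) * \<eta> x"
        by (simp add: left_diff_distrib)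
    qed
    also have "\<dots> = kernel_image R M \<eta> (space M) - kernel_image R M \<eta> A"
      unfolding kernel_image_def using R.integrable_kernel_mult[OF \<eta>] A by (intro Bochner_Integration.integral_diff) auto
    finally show ?thesis .
  qed
  show ?thesis
    using G(2,3) A unfolding G(1)
  proof (induction rule: sigma_sets_induct_disjoint)
    case (basic A) then show ?case by (rule eq)
  next
    case empty show ?case by (simp add: kernel_image_def)
  next
    case (compl A)
    then have "A \<in> sets M" by (simp add: G(1))
    then show ?case
      using kcompl[OF K \<phi>] kcompl[OF L \<psi>] eq[OF G(4)] compl by simp
  next
    case (union A)
    then have r: "range A \<subseteq> sets M" by (simp add: G(1))
    show ?case
      using K.kernel_image_UNION[OF \<phi> union(1) r] L.kernel_image_UNION[OF \<psi> union(1) r] union.IH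
      by (simp add: sums_unique2)
  qed
qed

section \<open>The tensor power as the transfer operator of the product kernel\<close>

context stationary_kernel begin

text \<open>On a rectangle both the density and the image measure factor into integrals over single
  coordinates, and rectangles determine a complex measure.\<close>

lemma transfer_op_product_tensor:
  assumes \<phi>: "\<And>i. i < N \<Longrightarrow> integrable M (\<phi> i)"
    and P_def: "P = power_measure M N"
  shows "integrable P (tensor N \<phi>)"
    and "AE x in P. transfer_op (product_kernel {..<N} K) P (tensor N \<phi>) x = tensor N (\<lambda>i. transfer_op K M (\<phi> i)) x"
proof -
  interpret product_sigma_finite "\<lambda>_::nat. M"
    by (simp add: product_sigma_finite_def sigma_finite_measure_axioms)
  have Pdef: "P = PiM {..<N} (\<lambda>_. M)" by (simp add: P_def power_measure_def)
  interpret P: stationary_kernel P "product_kernel {..<N} K"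
    unfolding Pdef by (rule product_stationary) simp
  interpret R: stationary_kernel P "return P"
    using P.kernel_power_stationary[of 0] by simp
  have int: "integrable P (tensor N \<phi>)" if "\<And>i. i < N \<Longrightarrow> integrable M (\<phi> i)" for \<phi>
    unfolding tensor_def[abs_def] Pdef using that by (intro product_integrable_prod) auto
  show i\<phi>: "integrable P (tensor N \<phi>)" by (rule int[OF \<phi>])
  have iT: "integrable P (tensor N (\<lambda>i. transfer_op K M (\<phi> i)))"
    by (intro int transfer_op_integrable \<phi>)
  have eq: "kernel_image (return P) P \<psi> A = (LINT x:A|P. \<psi> x)" if "A \<in> sets P" for A \<psi>
    unfolding kernel_image_def set_lebesgue_integral_def
    using that by (intro Bochner_Integration.integral_cong) (auto simp: measure_return scaleR_conv_of_real of_real_indicator)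
  have "kernel_image (return P) P (tensor N (\<lambda>i. transfer_op K M (\<phi> i))) A
      = kernel_image (product_kernel {..<N} K) P (tensor N \<phi>) A" if "A \<in> sets P" for A
  proof (rule kernel_image_eqI[OF R.stationary_kernel_axioms P.stationary_kernel_axioms iT i\<phi> _ _ _ _ _ that])
    let ?G = "prod_algebra {..<N} (\<lambda>_. M)"
    show "sets P = sigma_sets (space P) ?G" unfolding Pdef by (simp add: sets_PiM space_PiM)
    show "Int_stable ?G" by (rule Int_stable_prod_algebra)
    show "?G \<subseteq> Pow (space P)" unfolding Pdef space_PiM by (rule prod_algebra_sets_into_space)
    show "space P \<in> ?G" unfolding Pdef space_PiM by (rule prod_algebraI_finite) auto
    fix A assume "A \<in> ?G"
    then obtain E where E: "A = Pi\<^sub>E {..<N} E" "E \<in> {..<N} \<rightarrow> sets M" by (rule prod_algebraE_all)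
    then have Ei: "E i \<in> sets M" if "i < N" for i using that by auto
    have A: "A \<in> sets P" unfolding Pdef E(1) using Ei by (intro sets_PiM_I_finite) auto
    have xi: "x i \<in> space M" if "x \<in> space P" "i < N" for x i using that by (auto simp: Pdef space_PiM)
    have ind: "indicator A x = (\<Prod>i<N. indicator (E i) (x i) :: complex)" if x: "x \<in> space P" for x
      using x by (auto simp: indicator_def E(1) Pdef space_PiM PiE_iff prod_zero_iff)
    have "kernel_image (return P) P (tensor N (\<lambda>i. transfer_op K M (\<phi> i))) A
        = (\<integral>x. (\<Prod>i<N. indicator (E i) (x i) * transfer_op K M (\<phi> i) (x i)) \<partial>P)"
      unfolding eq[OF A] set_lebesgue_integral_def
      by (intro Bochner_Integration.integral_cong refl)
         (simp add: tensor_def prod.distrib ind[symmetric] scaleR_conv_of_real of_real_indicator)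
    also have "\<dots> = (\<Prod>i<N. \<integral>y. indicator (E i) y * transfer_op K M (\<phi> i) y \<partial>M)"
      unfolding Pdef
    proof (rule product_integral_prod)
      fix i assume "i \<in> {..<N}"
      then show "integrable M (\<lambda>y. indicator (E i) y * transfer_op K M (\<phi> i) y)"
        using integrable_mult_indicator[OF Ei transfer_op_integrable[OF \<phi>], of i i]
        by (simp add: scaleR_conv_of_real of_real_indicator)
    qed simp
    also have "\<dots> = (\<Prod>i<N. kernel_image K M (\<phi> i) (E i))"
    proof (rule prod.cong)
      fix i assume "i \<in> {..<N}"
      then have i: "i < N" by simp
      show "(\<integral>y. indicator (E i) y * transfer_op K M (\<phi> i) y \<partial>M) = kernel_image K M (\<phi> i) (E i)"
        using is_transfer_transfer_op[OF \<phi>[OF i]] Ei[OF i]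
        by (simp add: is_transfer_def set_lebesgue_integral_def scaleR_conv_of_real of_real_indicator)
    qed simp
    also have "\<dots> = (\<integral>x. (\<Prod>i<N. complex_of_real (measure (K (x i)) (E i)) * \<phi> i (x i)) \<partial>P)"
      unfolding Pdef kernel_image_def using integrable_kernel_mult[OF \<phi> Ei]
      by (intro product_integral_prod[symmetric]) auto
    also have "\<dots> = kernel_image (product_kernel {..<N} K) P (tensor N \<phi>) A"
      unfolding kernel_image_def
    proof (intro Bochner_Integration.integral_cong refl)
      fix x assume x: "x \<in> space P"
      have "emeasure (product_kernel {..<N} K x) A = (\<Prod>i<N. emeasure (K (x i)) (E i))"
        unfolding product_kernel_def E(1) using xi[OF x] Ei
        by (intro emeasure_PiM_prob) (auto intro!: kernel_prob_space)
      also have "\<dots> = ennreal (\<Prod>i<N. measure (K (x i)) (E i))"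
        using xi[OF x] by (simp add: finite_measure.emeasure_eq_measure prob_space.finite_measure kernel_prob_space prod_ennreal)
      finally have "measure (product_kernel {..<N} K x) A = (\<Prod>i<N. measure (K (x i)) (E i))"
        by (simp add: measure_eq_emeasure_eq_ennreal prod_nonneg)
      then show "(\<Prod>i<N. complex_of_real (measure (K (x i)) (E i)) * \<phi> i (x i))
          = complex_of_real (measure (product_kernel {..<N} K x) A) * tensor N \<phi> x"
        by (simp add: tensor_def prod.distrib)
    qed
    finally show "kernel_image (return P) P (tensor N (\<lambda>i. transfer_op K M (\<phi> i))) A
        = kernel_image (product_kernel {..<N} K) P (tensor N \<phi>) A" .
  qed
  then have "P.is_transfer (tensor N \<phi>) (tensor N (\<lambda>i. transfer_op K M (\<phi> i)))"
    using iT by (simp add: P.is_transfer_def eq)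
  then show "AE x in P. transfer_op (product_kernel {..<N} K) P (tensor N \<phi>) x = tensor N (\<lambda>i. transfer_op K M (\<phi> i)) x"
    by (rule P.transfer_op_AE_unique[OF i\<phi>])
qed

text \<open>The transfer operator of N independent chains witnesses the existence behind the choice.
  Whatever operator is chosen agrees with it, because indicators of rectangles are tensors and
  determine a bounded operator on L^1.\<close>

lemma tensor_power_op:
  assumes P_def: "P = power_measure M N"
  shows tensor_power_op_bounded_linear: "Lp_bounded_linear 1 P (tensor_power_op M N (transfer_op K M))"
    and tensor_power_op_eq: "integrable P f \<Longrightarrow>
      AE x in P. tensor_power_op M N (transfer_op K M) f x = transfer_op (product_kernel {..<N} K) P f x"
proof -
  have Pdef: "P = PiM {..<N} (\<lambda>_. M)" by (simp add: P_def power_measure_def)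
  interpret P: stationary_kernel P "product_kernel {..<N} K"
    unfolding Pdef by (rule product_stationary) simp
  let ?T = "transfer_op (product_kernel {..<N} K) P" and ?Q = "tensor_power_op M N (transfer_op K M)"
  have T: "Lp_bounded_linear 1 P ?T" by (rule P.transfer.Lp_bounded_linear_T) simp
  have Tt: "AE x in P. ?T (tensor N \<phi>) x = tensor N (\<lambda>i. transfer_op K M (\<phi> i)) x" if "\<forall>i<N. \<phi> i \<in> Lp 1 M" for \<phi>
    using transfer_op_product_tensor(2)[of N \<phi> P] that by (simp add: Lp_1_iff P_def)
  have "\<exists>Q. Lp_bounded_linear 1 (power_measure M N) Q \<and>
        (\<forall>\<phi>. (\<forall>i<N. \<phi> i \<in> Lp 1 M) \<longrightarrow>
           (AE x in power_measure M N. Q (tensor N \<phi>) x = tensor N (\<lambda>i. transfer_op K M (\<phi> i)) x))"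
    using T Tt unfolding P_def by blast
  from someI_ex[OF this]
  have Q: "Lp_bounded_linear 1 P ?Q" and Qt: "\<And>\<phi>. \<forall>i<N. \<phi> i \<in> Lp 1 M \<Longrightarrow> AE x in P. ?Q (tensor N \<phi>) x = tensor N (\<lambda>i. transfer_op K M (\<phi> i)) x"
    unfolding tensor_power_op_def P_def by blast+
  show "Lp_bounded_linear 1 P ?Q" by (rule Q)
  assume f: "integrable P f"
  show "AE x in P. ?Q f x = ?T f x"
  proof (rule L1_operators_eqI[OF P.prob_space_axioms Q T _ _ _ _ _ f])
    let ?G = "prod_algebra {..<N} (\<lambda>_. M)"
    show "sets P = sigma_sets (space P) ?G" unfolding Pdef by (simp add: sets_PiM space_PiM)
    show "Int_stable ?G" by (rule Int_stable_prod_algebra)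
    show "?G \<subseteq> Pow (space P)" unfolding Pdef space_PiM by (rule prod_algebra_sets_into_space)
    show "space P \<in> ?G" unfolding Pdef space_PiM by (rule prod_algebraI_finite) auto
    fix A assume "A \<in> ?G"
    then obtain E where E: "A = Pi\<^sub>E {..<N} E" "E \<in> {..<N} \<rightarrow> sets M" by (rule prod_algebraE_all)
    have A: "A \<in> sets P" unfolding Pdef E(1) using E(2) by (intro sets_PiM_I_finite) auto
    let ?\<phi> = "\<lambda>i. indicator (E i) :: 'a \<Rightarrow> complex"
    have L: "\<forall>i<N. ?\<phi> i \<in> Lp 1 M" using E(2) by (auto simp: Lp_1_iff Pi_iff intro!: integrable_indicator_complex)
    have tL: "tensor N ?\<phi> \<in> Lp 1 P"
      unfolding P.Lp_1_iff using transfer_op_product_tensor(1)[OF _ P_def, of ?\<phi>] L by (simp add: Lp_1_iff)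
    have iL: "(indicator A :: _ \<Rightarrow> complex) \<in> Lp 1 P" using A by (simp add: P.Lp_1_iff P.integrable_indicator_complex)
    have ind: "AE x in P. indicator A x = tensor N ?\<phi> x"
      by (rule AE_I2) (auto simp: indicator_def E(1) Pdef space_PiM PiE_iff prod_zero_iff tensor_def)
    from Lp_bounded_linear_cong_AE[OF Q iL tL _ ind] Lp_bounded_linear_cong_AE[OF T iL tL _ ind]
    have "AE x in P. ?Q (indicator A) x = ?Q (tensor N ?\<phi>) x" "AE x in P. ?T (indicator A) x = ?T (tensor N ?\<phi>) x" by auto
    with Qt[OF L] Tt[OF L] show "AE x in P. ?Q (indicator A) x = ?T (indicator A) x"
      by eventually_elim simp
  qed
qed

end

section \<open>Uniform integrability of iterates\<close>

text \<open>The mean is subtracted from the image and not from the argument: the estimate is applied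
  to g = |f|^(p/2), which has to stay nonnegative.\<close>

definition L2_gap :: "'a measure \<Rightarrow> (('a \<Rightarrow> complex) \<Rightarrow> 'a \<Rightarrow> complex) \<Rightarrow> real \<Rightarrow> bool" where
  "L2_gap M P \<kappa> \<longleftrightarrow> (\<forall>g :: 'a \<Rightarrow> real. (\<lambda>x. complex_of_real (g x)) \<in> Lp 2 M \<longrightarrow>
     (\<lambda>x. P (\<lambda>x. complex_of_real (g x)) x - complex_of_real (\<integral>x. g x \<partial>M)) \<in> Lp 2 M \<and>
     Lp_norm 2 M (\<lambda>x. P (\<lambda>x. complex_of_real (g x)) x - complex_of_real (\<integral>x. g x \<partial>M))
       \<le> \<kappa> * Lp_norm 2 M (\<lambda>x. complex_of_real (g x)))"

context markov_op begin

text \<open>\<open>r\<close> is the deviation of T g from its mean and \<open>V\<close> represents T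
  |f|^p. The first term on the right has a better exponent than p, and the second is small in L^p
  once \<kappa> is small; together they replace a bound on T |f| that need not exist.\<close>

lemma Tr_le_gain_integrability:
  fixes f :: "'a \<Rightarrow> complex"
  assumes gap: "L2_gap M T \<kappa>" and \<kappa>: "\<kappa> \<ge> 0" and p: "p > 1"
    and f: "f \<in> Lp p M" "Lp_norm p M f \<le> 1"
  obtains r V :: "'a \<Rightarrow> real"
  where "integrable M V" "\<And>x. V x \<ge> 0" "(\<integral>x. V x \<partial>M) \<le> 1"
    and "integrable M (\<lambda>x. (r x)\<^sup>2)" "r \<in> borel_measurable M" "(\<integral>x. (r x)\<^sup>2 \<partial>M) \<le> \<kappa>\<^sup>2"
    and "AE x in M. Tr (\<lambda>x. norm (f x)) x
      \<le> 2 * V x powr (1 / p\<^sup>2) + 2 * (\<bar>r x\<bar> powr (2 * (p - 1) / p\<^sup>2) * V x powr (1 / p\<^sup>2))"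
proof -
  define a where "a = 2 * (p - 1) / p\<^sup>2"
  define b where "b = 1 / p\<^sup>2"
  have ab: "a > 0" "b > 0" "a + b \<le> 1"
  proof -
    show "a > 0" "b > 0" using p by (auto simp: a_def b_def)
    have "0 \<le> (p - 1)\<^sup>2" by simp
    then have "2 * (p - 1) + 1 \<le> p\<^sup>2" by (simp add: power2_eq_square algebra_simps)
    then show "a + b \<le> 1" using p by (simp add: a_def b_def add_divide_distrib[symmetric])
  qed
  note [measurable] = f(1)
  define u where "u = (\<lambda>x. norm (f x))"
  define g where "g = (\<lambda>x. u x powr (p / 2))"
  define v where "v = (\<lambda>x. u x powr p)"
  have vi: "integrable M v" using f(1) by (simp add: v_def u_def Lp_integrable_powr)
  have v1: "(\<integral>x. v x \<partial>M) \<le> 1"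
    using f(2) p Lp_norm_le_iff[of p 1 M f] by (simp add: v_def u_def)
  have g2: "(g x)\<^sup>2 = v x" for x
    unfolding g_def v_def power2_eq_square by (simp add: powr_add[symmetric])
  have g2': "norm (complex_of_real (g x)) powr 2 = v x" for x
    using g2[of x] by simp
  have [measurable]: "g \<in> borel_measurable M" unfolding g_def u_def by measurable
  have gL: "(\<lambda>x. complex_of_real (g x)) \<in> Lp 2 M"
    by (rule LpI) (use vi in \<open>simp_all only: g2'\<close>, measurable)
  have gn: "Lp_norm 2 M (\<lambda>x. complex_of_real (g x)) \<le> 1"
    using v1 by (subst Lp_norm_le_iff) (simp_all only: g2', auto)
  have gi: "integrable M g" using integrable_Re[OF Lp_integrable[OF gL]] by simp
  define m where "m = (\<integral>x. g x \<partial>M)"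
  have m: "m \<le> 1"
    using norm_integral_le_Lp_norm[OF gL] gn by (simp add: m_def)
  define r where "r = (\<lambda>x. Tr g x - m)"
  have [measurable]: "r \<in> borel_measurable M" using Tr_integrable[OF gi] by (auto simp: r_def)
  have rT: "AE x in M. T (\<lambda>x. complex_of_real (g x)) x - complex_of_real m = complex_of_real (r x)"
    using T_of_real[OF gi] by eventually_elim (simp add: r_def)
  note gapg = gap[unfolded L2_gap_def, rule_format, OF gL, folded m_def]
  have rL: "(\<lambda>x. complex_of_real (r x)) \<in> Lp 2 M"
    using rT by (intro Lp_cong_AE[OF conjunct1[OF gapg]]) (auto elim!: eventually_mono)
  have "Lp_norm 2 M (\<lambda>x. complex_of_real (r x)) = Lp_norm 2 M (\<lambda>x. T (\<lambda>x. complex_of_real (g x)) x - complex_of_real m)"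
    using rT conjunct1[OF gapg] by (intro Lp_norm_cong_AE) (auto elim!: eventually_mono dest: Lp_measurable)
  also have "\<dots> \<le> \<kappa> * Lp_norm 2 M (\<lambda>x. complex_of_real (g x))" using gapg by simp
  also have "\<dots> \<le> \<kappa>" using gn \<kappa> mult_left_le[of _ \<kappa>] by blast
  finally have "Lp_norm 2 M (\<lambda>x. complex_of_real (r x)) \<le> \<kappa>" .
  then have r2: "(\<integral>x. (r x)\<^sup>2 \<partial>M) \<le> \<kappa>\<^sup>2"
    using \<kappa> by (subst (asm) Lp_norm_le_iff) auto
  have r2i: "integrable M (\<lambda>x. (r x)\<^sup>2)" using Lp_integrable_powr[OF rL] by simp
  \<comment> \<open>The maximum alters \<open>Tr v\<close> on a null set only and makes V
    nonnegative everywhere, as the power estimates require.\<close>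
  define V where "V = (\<lambda>x. max 0 (Tr v x))"
  have VT: "AE x in M. V x = Tr v x"
    using Tr_nonneg[OF vi] by (auto simp: V_def v_def elim!: eventually_mono)
  have Vi: "integrable M V" using Tr_integrable[OF vi] by (simp add: V_def)
  have V1: "(\<integral>x. V x \<partial>M) \<le> 1"
  proof -
    have "(\<integral>x. V x \<partial>M) = (\<integral>x. Tr v x \<partial>M)"
      using VT Vi Tr_integrable[OF vi] by (intro integral_cong_AE) auto
    then show ?thesis using v1 by (simp add: Tr_integral[OF vi])
  qed
  have eq: "u = (\<lambda>x. g x powr a * v x powr b)"
  proof
    fix x
    have "p / 2 * a + p * b = 1" using p by (simp add: a_def b_def power2_eq_square field_simps)
    then show "u x = g x powr a * v x powr b"
      by (simp add: g_def v_def powr_powr powr_add[symmetric] u_def)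
  qed
  have "AE x in M. Tr u x \<le> Tr g x powr a * Tr v x powr b"
    by (subst eq, rule Tr_powr_mult_le[OF gi _ vi _ ab]) (auto simp: g_def v_def)
  moreover have "AE x in M. 0 \<le> Tr g x" using gi by (intro Tr_nonneg) (auto simp: g_def)
  ultimately have "AE x in M. Tr u x \<le> 2 * V x powr b + 2 * (\<bar>r x\<bar> powr a * V x powr b)"
    using VT
  proof eventually_elim
    case (elim x)
    have "Tr g x \<le> 1 + \<bar>r x\<bar>" using m abs_ge_self[of "r x"] unfolding r_def by linarith
    also have "\<dots> \<le> 2 * max 1 \<bar>r x\<bar>" by (auto simp: max_def)
    finally have "Tr g x \<le> 2 * max 1 \<bar>r x\<bar>" .
    then have "Tr g x powr a \<le> (2 * max 1 \<bar>r x\<bar>) powr a"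
      using elim(2) ab by (intro powr_mono2) auto
    also have "\<dots> = 2 powr a * max 1 \<bar>r x\<bar> powr a" by (intro powr_mult)
    also have "\<dots> \<le> 2 powr 1 * (1 + \<bar>r x\<bar> powr a)"
      using ab by (intro mult_mono powr_mono) (auto simp: max_def)
    finally have "Tr g x powr a \<le> 2 * (1 + \<bar>r x\<bar> powr a)" by simp
    then have "Tr g x powr a * V x powr b \<le> 2 * (1 + \<bar>r x\<bar> powr a) * V x powr b"
      by (intro mult_right_mono) auto
    then show ?case using elim(1,3) by (simp add: algebra_simps)
  qed
  then show ?thesis
    using Vi V1 r2i r2 by (intro that[of V r]) (auto simp: V_def u_def a_def b_def)
qed

text \<open>Above the threshold one of the two terms dominates. If it is V^(1/p^2), then V > s
  there, and V^(1/p) <= s^(1/p - 1) V is small in L^1 for large s; if it is the term with r, Hoelder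
  gives a power of \<kappa>.\<close>

lemma truncation_small:
  fixes f F :: "'a \<Rightarrow> complex"
  assumes gap: "L2_gap M T \<kappa>" and \<kappa>: "\<kappa> \<ge> 0" and p: "p > 1"
    and f: "f \<in> Lp p M" "Lp_norm p M f \<le> 1" and s: "s > 0"
    and F: "F \<in> borel_measurable M" "AE x in M. norm (F x) \<le> Tr (\<lambda>x. norm (f x)) x"
  defines "F2 \<equiv> \<lambda>x. if norm (F x) \<le> 4 * s powr (1 / p\<^sup>2) then 0 else F x"
  shows "F2 \<in> Lp p M"
    and "Lp_norm p M F2 powr p \<le> 4 powr p * (s powr (1 / p - 1) + \<kappa> powr (2 * (p - 1) / p))"
proof -
  note [measurable] = F(1)
  obtain r V where V: "integrable M V" "\<And>x. V x \<ge> 0" "(\<integral>x. V x \<partial>M) \<le> 1"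
    and r: "integrable M (\<lambda>x. (r x)\<^sup>2)" "r \<in> borel_measurable M" "(\<integral>x. (r x)\<^sup>2 \<partial>M) \<le> \<kappa>\<^sup>2"
    and le: "AE x in M. Tr (\<lambda>x. norm (f x)) x
      \<le> 2 * V x powr (1 / p\<^sup>2) + 2 * (\<bar>r x\<bar> powr (2 * (p - 1) / p\<^sup>2) * V x powr (1 / p\<^sup>2))"
    by (rule Tr_le_gain_integrability[OF gap \<kappa> p f]) (rule that; assumption)
  let ?Y = "\<lambda>x. (r x)\<^sup>2 powr ((p - 1) / p) * V x powr (1 / p)"
  let ?R = "\<lambda>x. 4 powr p * (s powr (1 / p - 1) * V x + ?Y x)"
  have pp: "(p - 1) / p \<ge> 0" "1 / p \<ge> 0" "(p - 1) / p + 1 / p \<le> 1" using p by (auto simp: field_simps)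
  have Y: "integrable M ?Y" "(\<integral>x. ?Y x \<partial>M) \<le> (\<integral>x. (r x)\<^sup>2 \<partial>M) powr ((p - 1) / p) * (\<integral>x. V x \<partial>M) powr (1 / p)"
    by (rule holder_powr[OF r(1) _ V(1,2) pp]; simp)+
  have Ri: "integrable M ?R" using Y(1) V(1) by auto
  have bd: "AE x in M. norm (F2 x) powr p \<le> ?R x"
    using F(2) le
  proof eventually_elim
    case (elim x)
    let ?v = "V x powr (1 / p\<^sup>2)" and ?q = "\<bar>r x\<bar> powr (2 * (p - 1) / p\<^sup>2)"
    show ?case
    proof (cases "norm (F x) \<le> 4 * s powr (1 / p\<^sup>2)")
      case True then show ?thesis using V(2)[of x] p by (simp add: F2_def)
    next
      case False
      then have F2x: "F2 x = F x" by (simp add: F2_def)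
      have Yx: "(?q * ?v) powr p = ?Y x"
      proof -
        have "(r x)\<^sup>2 = \<bar>r x\<bar> powr 2" by simp
        moreover have "2 * (p - 1) / p\<^sup>2 * p = 2 * ((p - 1) / p)" "1 / p\<^sup>2 * p = 1 / p"
          using p by (simp_all add: power2_eq_square)
        ultimately show ?thesis by (simp only: powr_mult powr_powr)
      qed
      \<comment> \<open>A sum of two terms is at most twice the larger; this is the origin of the 4
        in the threshold.\<close>
      have cases: "norm (F x) \<le> 4 * ?v \<or> norm (F x) \<le> 4 * (?q * ?v)" using elim by linarith
      show ?thesis
      proof (cases "norm (F x) \<le> 4 * ?v")
        case True
        with False have "s powr (1 / p\<^sup>2) < V x powr (1 / p\<^sup>2)" by simp
        then have "s < V x"
          using p V(2)[of x] s by (metis divide_nonneg_nonneg less_eq_real_def linorder_not_less powr_mono2 zero_le_one zero_le_power2)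
        then have Vx: "V x powr (1 / p - 1) \<le> s powr (1 / p - 1)"
          using p s by (intro powr_mono2') (auto simp: field_simps)
        have "norm (F x) powr p \<le> (4 * ?v) powr p" using True p by (intro powr_mono2) auto
        also have "\<dots> = 4 powr p * (V x powr (1 / p - 1) * V x)"
          using p s \<open>s < V x\<close> by (simp add: powr_mult powr_powr power2_eq_square powr_diff)
        also have "\<dots> \<le> 4 powr p * (s powr (1 / p - 1) * V x)"
          using Vx V(2) by (intro mult_left_mono mult_right_mono) auto
        also have "\<dots> \<le> ?R x" by (intro mult_left_mono) auto
        finally show ?thesis by (simp add: F2x)
      next
        case F': False
        have "norm (F x) powr p \<le> (4 * (?q * ?v)) powr p" using F' cases p by (intro powr_mono2) auto
        also have "\<dots> = 4 powr p * ?Y x" by (simp only: powr_mult[of 4] Yx)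
        also have "\<dots> \<le> ?R x" using V(2) by (intro mult_left_mono) auto
        finally show ?thesis by (simp add: F2x)
      qed
    qed
  qed
  have [measurable]: "F2 \<in> borel_measurable M" unfolding F2_def by measurable
  have "integrable M (\<lambda>x. norm (F2 x) powr p)"
    by (rule Bochner_Integration.integrable_bound[OF Ri]) (use bd in auto)
  then show L: "F2 \<in> Lp p M" by (intro LpI) auto
  have "Lp_norm p M F2 powr p = (\<integral>x. norm (F2 x) powr p \<partial>M)" using p by (intro Lp_norm_powr) simp
  also have "\<dots> \<le> (\<integral>x. ?R x \<partial>M)" by (intro integral_mono_AE Ri Lp_integrable_powr L bd)
  also have "\<dots> = 4 powr p * (s powr (1 / p - 1) * (\<integral>x. V x \<partial>M) + (\<integral>x. ?Y x \<partial>M))"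
    using Y(1) V(1) by simp
  also have "\<dots> \<le> 4 powr p * (s powr (1 / p - 1) * 1 + \<kappa> powr (2 * (p - 1) / p))"
  proof (intro mult_left_mono add_mono V(3))
    have "(\<integral>x. ?Y x \<partial>M) \<le> (\<integral>x. (r x)\<^sup>2 \<partial>M) powr ((p - 1) / p) * (\<integral>x. V x \<partial>M) powr (1 / p)" by (rule Y(2))
    also have "\<dots> \<le> (\<kappa>\<^sup>2) powr ((p - 1) / p) * 1 powr (1 / p)"
      using p V r(3) by (intro mult_mono powr_mono2) (auto intro: Bochner_Integration.integral_nonneg)
    also have "(\<kappa>\<^sup>2) powr ((p - 1) / p) = \<kappa> powr (2 * (p - 1) / p)"
    proof -
      have "\<kappa>\<^sup>2 = \<kappa> powr 2" using \<kappa> by simp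
      then show ?thesis by (simp only: powr_powr times_divide_eq_right)
    qed
    finally show "(\<integral>x. ?Y x \<partial>M) \<le> \<kappa> powr (2 * (p - 1) / p)" by simp
  qed auto
  finally show "Lp_norm p M F2 powr p \<le> 4 powr p * (s powr (1 / p - 1) + \<kappa> powr (2 * (p - 1) / p))" by simp
qed

end

text \<open>The condition \<kappa> n <= 1 reflects the tensorization, which needs 1 - \<kappa>^2 to
  be nonnegative; C \<gamma>^n can exceed 1 for small n, and only large n are used.\<close>

definition gap_markov :: "(nat \<Rightarrow> real) \<Rightarrow> 'a measure \<Rightarrow> (('a \<Rightarrow> complex) \<Rightarrow> 'a \<Rightarrow> complex) \<Rightarrow> bool" where
  "gap_markov \<kappa> M T \<longleftrightarrow> markov_op M T \<and> (\<forall>n. \<kappa> n \<le> 1 \<longrightarrow> L2_gap M (T ^^ n) (\<kappa> n))"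

text \<open>s and n are chosen from \<kappa>, p and \<eta> before any measure is given. Since all
  the product spaces live on one type, the quantifier over M yields constants that do not depend on
  N.\<close>

lemma uniform_truncation:
  assumes \<kappa>: "\<kappa> \<longlonglongrightarrow> 0" "\<And>n. \<kappa> n \<ge> 0" and p: "p > 1" and \<eta>: "\<eta> > 0"
  obtains n t where "t > 0"
    "\<And>(M :: 'a measure) T (f :: 'a \<Rightarrow> complex) (F :: 'a \<Rightarrow> complex). gap_markov \<kappa> M T \<Longrightarrow> f \<in> Lp p M \<Longrightarrow> Lp_norm p M f \<le> 1 \<Longrightarrow>
        F \<in> borel_measurable M \<Longrightarrow>
        AE x in M. norm (F x) \<le> markov_op.Tr (T ^^ n) (\<lambda>x. norm (f x)) x \<Longrightarrow>
        (\<lambda>x. if norm (F x) \<le> t then 0 else F x) \<in> Lp p M \<and>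
        Lp_norm p M (\<lambda>x. if norm (F x) \<le> t then 0 else F x) \<le> \<eta>"
proof -
  \<comment> \<open>Half of the budget for each of the two errors: 4^p (c + c) = \<eta>^p.\<close>
  define c where "c = (\<eta> / 4) powr p / 2"
  have c: "c > 0" using \<eta> by (simp add: c_def)
  have "((\<lambda>s::real. s powr (1 / p - 1)) \<longlongrightarrow> 0) at_top"
    using p by (intro tendsto_neg_powr filterlim_ident) (simp add: field_simps)
  then have "eventually (\<lambda>s::real. s powr (1 / p - 1) < c) at_top" using c by (rule order_tendstoD)
  then have "eventually (\<lambda>s::real. s powr (1 / p - 1) < c \<and> s > 0) at_top"
    using eventually_gt_at_top[of 0] by eventually_elim auto
  then obtain s :: real where s: "s powr (1 / p - 1) < c" "s > 0" by (auto simp: eventually_at_top_linorder)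
  have "(\<lambda>n. \<kappa> n powr (2 * (p - 1) / p)) \<longlonglongrightarrow> 0 powr (2 * (p - 1) / p)"
    using p \<kappa> by (intro tendsto_powr' tendsto_const) auto
  then have "eventually (\<lambda>n. \<kappa> n powr (2 * (p - 1) / p) < c) sequentially" using c by (intro order_tendstoD) auto
  moreover have "eventually (\<lambda>n. \<kappa> n < 1) sequentially" using \<kappa>(1) by (intro order_tendstoD) auto
  ultimately have "eventually (\<lambda>n. \<kappa> n powr (2 * (p - 1) / p) < c \<and> \<kappa> n < 1) sequentially" by eventually_elim auto
  then obtain n where n: "\<kappa> n powr (2 * (p - 1) / p) < c" "\<kappa> n < 1" by (auto simp: eventually_sequentially)
  show ?thesis
  proof (rule that[of "4 * s powr (1 / p\<^sup>2)" n])
    show "4 * s powr (1 / p\<^sup>2) > 0" using s by simp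
    fix M :: "'a measure" and T and f F :: "'a \<Rightarrow> complex"
    assume *: "gap_markov \<kappa> M T" "f \<in> Lp p M" "Lp_norm p M f \<le> 1" "F \<in> borel_measurable M"
      "AE x in M. norm (F x) \<le> markov_op.Tr (T ^^ n) (\<lambda>x. norm (f x)) x"
    interpret markov_op M T using *(1) by (simp add: gap_markov_def)
    interpret P: markov_op M "T ^^ n" by (rule markov_op_funpow)
    have gap: "L2_gap M (T ^^ n) (\<kappa> n)" using *(1) n(2) by (simp add: gap_markov_def)
    let ?F = "\<lambda>x. if norm (F x) \<le> 4 * s powr (1 / p\<^sup>2) then 0 else F x"
    note tr = P.truncation_small[OF gap \<kappa>(2) p *(2,3) s(2) *(4,5)]
    have "Lp_norm p M ?F powr p \<le> 4 powr p * (s powr (1 / p - 1) + \<kappa> n powr (2 * (p - 1) / p))" by (rule tr(2))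
    also have "\<dots> \<le> 4 powr p * (c + c)" using s n by (intro mult_left_mono add_mono) auto
    also have "\<dots> = \<eta> powr p" using \<eta> by (simp add: c_def powr_divide)
    finally have "Lp_norm p M ?F \<le> \<eta>"
      using \<eta> p by (simp add: Lp_norm_powr Lp_norm_le_iff)
    with tr(1) show "?F \<in> Lp p M \<and> Lp_norm p M ?F \<le> \<eta>" by simp
  qed
qed

section \<open>The operator with a hole\<close>

lemma Lp_bounded_linear_unit_bound:
  assumes A: "Lp_bounded_linear p M A" and p: "p \<ge> 1" and f: "f \<in> Lp p M"
    and unit: "\<And>f. f \<in> Lp p M \<Longrightarrow> Lp_norm p M f \<le> 1 \<Longrightarrow> Lp_norm p M (A f) \<le> c"
  shows "Lp_norm p M (A f) \<le> c * Lp_norm p M f"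
proof (cases "Lp_norm p M f = 0")
  case True
  obtain B where "\<And>f. f \<in> Lp p M \<Longrightarrow> Lp_norm p M (A f) \<le> B * Lp_norm p M f"
    using Lp_bounded_linear_bound[OF A] by blast
  from this[OF f] True show ?thesis by simp
next
  case False
  define r where "r = Lp_norm p M f"
  have r: "r > 0" using False by (simp add: r_def order_less_le)
  let ?c = "complex_of_real (1 / r)"
  have cf: "(\<lambda>x. ?c * f x) \<in> Lp p M" by (rule Lp_scale[OF f])
  have n: "Lp_norm p M (\<lambda>x. ?c * f x) = 1"
    using p r Lp_norm_scale[of p M ?c f] by (simp add: norm_divide r_def)
  have "(1 / r) * Lp_norm p M (A f) = Lp_norm p M (\<lambda>x. ?c * A f x)"
    using p r by (simp only: Lp_norm_scale norm_of_real) simp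
  also have "\<dots> = Lp_norm p M (A (\<lambda>x. ?c * f x))"
    using Lp_bounded_linear_scale[OF A f, of ?c]
    by (intro Lp_norm_cong_AE Lp_measurable[of _ p] Lp_scale Lp_bounded_linear_Lp[OF A] f cf) (auto elim: eventually_mono)
  also have "\<dots> \<le> c" using unit[OF cf] n by simp
  finally show ?thesis using r by (simp add: r_def[symmetric] field_simps)
qed

context prob_space begin

definition center :: "('a \<Rightarrow> complex) \<Rightarrow> 'a \<Rightarrow> complex" where
  "center f = (\<lambda>x. f x - (\<integral>y. f y \<partial>M))"

lemma center_Lp: "f \<in> Lp p M \<Longrightarrow> p \<ge> 1 \<Longrightarrow> center f \<in> Lp p M"
  unfolding center_def by (intro Lp_diff Lp_const)

lemma center_norm_le:
  assumes "f \<in> Lp p M" "p \<ge> 1"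
  shows "Lp_norm p M (center f) \<le> 2 * Lp_norm p M f"
proof -
  have "Lp_norm p M (center f) \<le> Lp_norm p M f + Lp_norm p M (\<lambda>_. \<integral>y. f y \<partial>M)"
    unfolding center_def by (intro Lp_norm_triangle_diff assms Lp_const)
  also have "Lp_norm p M (\<lambda>_. \<integral>y. f y \<partial>M) \<le> Lp_norm p M f"
    using assms norm_integral_le_Lp_norm[OF assms] by (simp add: Lp_norm_const)
  finally show ?thesis by simp
qed

lemma Lp_bounded_linear_center:
  assumes p: "p \<ge> 1"
  shows "Lp_bounded_linear p M center"
  unfolding Lp_bounded_linear_def
proof (intro conjI ballI allI exI[of _ 2] AE_I2)
  fix f g c x assume f: "f \<in> Lp p M"
  show "center f \<in> Lp p M" by (rule center_Lp[OF f p])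
  show "Lp_norm p M (center f) \<le> 2 * Lp_norm p M f" by (rule center_norm_le[OF f p])
  show "center (\<lambda>y. c * f y) x = c * center f x" by (simp add: center_def right_diff_distrib)
  show "center (\<lambda>y. f y + g y) x = center f x + center g x" if g: "g \<in> Lp p M"
    using Lp_integrable[OF f p] Lp_integrable[OF g p] by (simp add: center_def)
qed

lemma Lp_norm_indicator:
  assumes "A \<in> sets M" "p > 0"
  shows "Lp_norm p M (indicator A) = measure M A powr (1 / p)"
proof -
  have "(\<integral>x. norm (indicator A x :: complex) powr p \<partial>M) = (\<integral>x. indicator A x \<partial>M)"
    using assms by (intro Bochner_Integration.integral_cong) (auto simp: indicator_def)
  then show ?thesis using assms by (simp add: Lp_norm_def)
qed

end

locale hole_markov = markov_op +
  fixes H assumes H[measurable]: "H \<in> sets M"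
begin

definition cut :: "('a \<Rightarrow> complex) \<Rightarrow> 'a \<Rightarrow> complex" where
  "cut f = (\<lambda>x. f x * indicator (space M - H) x)"

definition hole :: "('a \<Rightarrow> complex) \<Rightarrow> 'a \<Rightarrow> complex" where
  "hole f = T (cut f)"

text \<open>\<open>Q A\<close> of the overview.\<close>

definition centered_hole :: "('a \<Rightarrow> complex) \<Rightarrow> 'a \<Rightarrow> complex" where
  "centered_hole f = center (hole f)"

abbreviation h :: real where "h \<equiv> measure M H"

lemma norm_cut_le: "norm (cut f x) \<le> norm (f x)"
  by (simp add: cut_def indicator_def)

lemma cut_Lp:
  assumes "f \<in> Lp p M" "p > 0"
  shows "cut f \<in> Lp p M" "Lp_norm p M (cut f) \<le> Lp_norm p M f"
proof -
  have "cut f \<in> borel_measurable M" unfolding cut_def using assms(1) by measurable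
  then show "cut f \<in> Lp p M" "Lp_norm p M (cut f) \<le> Lp_norm p M f"
    by (rule Lp_dominated[OF assms(1) _ _ assms(2)]; simp add: norm_cut_le)+
qed

lemma cut_integrable: "integrable M f \<Longrightarrow> integrable M (cut f)"
  using cut_Lp(1)[of f 1] by (simp add: Lp_1_iff)

lemma hole_Lp:
  assumes "f \<in> Lp p M" "p \<ge> 1"
  shows "hole f \<in> Lp p M" "Lp_norm p M (hole f) \<le> Lp_norm p M f"
proof -
  have p: "p > 0" using assms(2) by simp
  note c = cut_Lp[OF assms(1) p]
  show "hole f \<in> Lp p M" "Lp_norm p M (hole f) \<le> Lp_norm p M f"
    using T_Lp[OF c(1) assms(2)] c(2) by (simp_all add: hole_def)
qed

lemma hole_integrable: "integrable M f \<Longrightarrow> integrable M (hole f)"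
  by (simp add: hole_def cut_integrable T_integrable)

lemma Lp_bounded_linear_hole:
  assumes p: "p \<ge> 1"
  shows "Lp_bounded_linear p M hole"
proof -
  have "Lp_bounded_linear p M cut"
    unfolding Lp_bounded_linear_def
  proof (intro conjI ballI allI exI[of _ 1] AE_I2)
    fix f assume f: "f \<in> Lp p M"
    show "cut f \<in> Lp p M" "Lp_norm p M (cut f) \<le> 1 * Lp_norm p M f" using cut_Lp[OF f] p by auto
  qed (simp_all add: cut_def algebra_simps)
  from Lp_bounded_linear_compose[OF Lp_bounded_linear_T[OF p] this p]
  show ?thesis by (simp add: hole_def[abs_def])
qed

lemma Lp_bounded_linear_centered_hole: "p \<ge> 1 \<Longrightarrow> Lp_bounded_linear p M centered_hole"
  unfolding centered_hole_def[abs_def]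
  by (rule Lp_bounded_linear_compose[OF Lp_bounded_linear_center Lp_bounded_linear_hole])

lemma centered_hole_norm_le:
  assumes "f \<in> Lp p M" "p \<ge> 1"
  shows "Lp_norm p M (centered_hole f) \<le> 2 * Lp_norm p M f"
  using center_norm_le[OF hole_Lp(1)[OF assms] assms(2)] hole_Lp(2)[OF assms] by (simp add: centered_hole_def)

lemma hole_funpow_Lp:
  assumes "f \<in> Lp p M" "p \<ge> 1"
  shows "(hole ^^ n) f \<in> Lp p M \<and> Lp_norm p M ((hole ^^ n) f) \<le> Lp_norm p M f"
proof (induction n)
  case (Suc n)
  with hole_Lp[of "(hole ^^ n) f" p] assms(2) show ?case by simp
qed (use assms in simp)

lemma hole_funpow_integrable: "integrable M f \<Longrightarrow> integrable M ((hole ^^ n) f)"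
  by (induction n) (auto intro: hole_integrable)

lemma hole_norm_le:
  assumes f: "integrable M f"
  shows "AE x in M. norm (hole f x) \<le> Tr (\<lambda>x. norm (f x)) x"
proof -
  have "AE x in M. Tr (\<lambda>x. norm (cut f x)) x \<le> Tr (\<lambda>x. norm (f x)) x"
    using f cut_integrable[OF f] by (intro Tr_mono) (simp_all add: norm_cut_le)
  with T_norm_le[OF cut_integrable[OF f]] show ?thesis
    unfolding hole_def by eventually_elim simp
qed

text \<open>Cutting only lowers absolute values, so positivity transfers the truncation estimates
  for the free chain to the chain with the hole.\<close>

lemma hole_funpow_norm_le:
  assumes f: "integrable M f"
  shows "AE x in M. norm ((hole ^^ n) f x) \<le> markov_op.Tr (T ^^ n) (\<lambda>x. norm (f x)) x"
proof (induction n)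
  case 0
  show ?case unfolding markov_op.Tr_def[OF markov_op_funpow] by simp
next
  case (Suc n)
  interpret P: markov_op M "T ^^ n" by (rule markov_op_funpow)
  let ?u = "\<lambda>x. norm (f x)"
  have u: "integrable M ?u" "integrable M (\<lambda>x. complex_of_real (?u x))" using f by auto
  have Pu: "integrable M (\<lambda>x. complex_of_real (P.Tr ?u x))" using P.Tr_integrable[OF u(1)] by simp
  have "AE x in M. Tr (\<lambda>x. norm ((hole ^^ n) f x)) x \<le> Tr (P.Tr ?u) x"
    by (intro Tr_mono Suc P.Tr_integrable u(1) integrable_norm hole_funpow_integrable f)
  with hole_norm_le[OF hole_funpow_integrable[OF f, of n]]
    T_cong_AE[OF P.T_integrable[OF u(2)] Pu P.T_of_real[OF u(1)]]
  show ?case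
    unfolding markov_op.Tr_def[OF markov_op_funpow[of "Suc n"]] by eventually_elim (simp add: Tr_def)
qed

lemma hole_funpow_bounded:
  assumes f: "integrable M f" and le: "AE x in M. norm (f x) \<le> c"
  shows "AE x in M. norm ((hole ^^ n) f x) \<le> c"
proof (induction n)
  case (Suc n)
  have "AE x in M. norm (cut ((hole ^^ n) f) x) \<le> c"
    using Suc by eventually_elim (meson norm_cut_le order_trans)
  then show ?case
    using T_bounded[OF cut_integrable[OF hole_funpow_integrable[OF f]]] by (simp add: hole_def[of "(hole ^^ n) f"])
qed (use le in simp)

text \<open>The iterates keep the bound c, so each cut removes at most c on \<open>H\<close>; T
  contracts L^1, so the losses merely add up.\<close>

lemma hole_funpow_L1_diff:
  assumes f: "integrable M f" and le: "AE x in M. norm (f x) \<le> c" and c: "c \<ge> 0"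
  shows "(\<integral>x. norm ((hole ^^ n) f x - (T ^^ n) f x) \<partial>M) \<le> n * c * h"
proof (induction n)
  case (Suc n)
  interpret P: markov_op M "T ^^ n" by (rule markov_op_funpow)
  let ?a = "(hole ^^ n) f" and ?t = "(T ^^ n) f"
  have a: "integrable M ?a" and t: "integrable M ?t" by (rule hole_funpow_integrable[OF f] P.T_integrable[OF f])+
  have ca: "integrable M (cut ?a)" by (rule cut_integrable[OF a])
  have d: "integrable M (\<lambda>x. cut ?a x - ?t x)" using ca t by simp
  have iH: "integrable M (\<lambda>x. c * indicator H x :: real)"
    by (intro integrable_mult_right integrable_const_bound[where B=1]) auto
  have "AE x in M. norm ((hole ^^ Suc n) f x - (T ^^ Suc n) f x) = norm (T (\<lambda>x. cut ?a x - ?t x) x)"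
    using T_diff[OF ca t] by eventually_elim (simp add: hole_def)
  then have "(\<integral>x. norm ((hole ^^ Suc n) f x - (T ^^ Suc n) f x) \<partial>M) = Lp_norm 1 M (T (\<lambda>x. cut ?a x - ?t x))"
    unfolding Lp_norm_1 using T_integrable[OF d] hole_funpow_integrable[OF f, of "Suc n"] T_integrable[OF t]
    by (intro integral_cong_AE) auto
  also have "\<dots> \<le> Lp_norm 1 M (\<lambda>x. cut ?a x - ?t x)" using d by (intro T_Lp) (simp_all add: Lp_1_iff)
  also have "\<dots> = (\<integral>x. norm (cut ?a x - ?t x) \<partial>M)" by (rule Lp_norm_1)
  also have "\<dots> \<le> (\<integral>x. norm (?a x - ?t x) + c * indicator H x \<partial>M)"
  proof (rule integral_mono_AE)
    show "AE x in M. norm (cut ?a x - ?t x) \<le> norm (?a x - ?t x) + c * indicator H x"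
      using hole_funpow_bounded[OF f le, of n] AE_space
    proof eventually_elim
      case (elim x)
      have "norm (cut ?a x - ?t x) \<le> norm (?a x - ?t x) + norm (cut ?a x - ?a x)"
        using norm_triangle_ineq[of "?a x - ?t x" "cut ?a x - ?a x"] by simp
      also have "norm (cut ?a x - ?a x) \<le> c * indicator H x"
        using elim by (auto simp: cut_def indicator_def)
      finally show ?case by simp
    qed
  qed (intro integrable_norm d Bochner_Integration.integrable_add Bochner_Integration.integrable_diff a t iH)+
  also have "\<dots> = (\<integral>x. norm (?a x - ?t x) \<partial>M) + c * h" using a t iH by simp
  also have "\<dots> \<le> Suc n * c * h" using Suc by (simp add: algebra_simps)
  finally show ?case by simp
qed simp

text \<open>The factor 2 comes from the real and imaginary parts, since the gap is stated for real
  functions.\<close>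

lemma gap_L1:
  assumes gap: "L2_gap M (T ^^ n) \<kappa>" and \<kappa>: "\<kappa> \<ge> 0" and g: "integrable M g" "AE x in M. norm (g x) \<le> c"
  shows "(\<integral>x. norm ((T ^^ n) g x - (\<integral>y. g y \<partial>M)) \<partial>M) \<le> 2 * \<kappa> * c"
proof -
  interpret P: markov_op M "T ^^ n" by (rule markov_op_funpow)
  have real: "integrable M (\<lambda>x. norm (complex_of_real (P.Tr u x - (\<integral>y. u y \<partial>M)))) \<and> (\<integral>x. norm (complex_of_real (P.Tr u x - (\<integral>y. u y \<partial>M))) \<partial>M) \<le> \<kappa> * c"
    if u: "integrable M u" "AE x in M. \<bar>u x\<bar> \<le> c" for u :: "'a \<Rightarrow> real"
  proof -
    have uL: "(\<lambda>x. complex_of_real (u x)) \<in> Lp 2 M" "Lp_norm 2 M (\<lambda>x. complex_of_real (u x)) \<le> c"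
      using u by (auto intro!: Lp_bounded)
    let ?w = "\<lambda>x. (T ^^ n) (\<lambda>x. complex_of_real (u x)) x - complex_of_real (\<integral>y. u y \<partial>M)"
    have w: "?w \<in> Lp 2 M" "Lp_norm 2 M ?w \<le> \<kappa> * Lp_norm 2 M (\<lambda>x. complex_of_real (u x))"
      using gap uL(1) by (simp_all add: L2_gap_def)
    have "AE x in M. norm (complex_of_real (P.Tr u x - (\<integral>y. u y \<partial>M))) = norm (?w x)"
      using P.T_of_real[OF u(1)] by eventually_elim simp
    then have "(\<integral>x. norm (complex_of_real (P.Tr u x - (\<integral>y. u y \<partial>M))) \<partial>M) = (\<integral>x. norm (?w x) \<partial>M)"
      using P.Tr_integrable[OF u(1)] w(1) by (intro integral_cong_AE) (auto dest: Lp_measurable)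
    also have "\<dots> \<le> Lp_norm 2 M ?w" by (rule integral_norm_le_Lp_norm[OF w(1)]) simp
    also have "\<dots> \<le> \<kappa> * c" using w(2) mult_left_mono[OF uL(2) \<kappa>] by simp
    finally show ?thesis using P.Tr_integrable[OF u(1)] by auto
  qed
  have R: "AE x in M. \<bar>Re (g x)\<bar> \<le> c" "AE x in M. \<bar>Im (g x)\<bar> \<le> c"
    using g(2) by (auto elim!: eventually_mono intro: order_trans[OF abs_Re_le_cmod] order_trans[OF abs_Im_le_cmod])
  let ?r = "\<lambda>x. P.Tr (\<lambda>x. Re (g x)) x - (\<integral>y. Re (g y) \<partial>M)" and ?i = "\<lambda>x. P.Tr (\<lambda>x. Im (g x)) x - (\<integral>y. Im (g y) \<partial>M)"
  have "(\<integral>x. norm ((T ^^ n) g x - (\<integral>y. g y \<partial>M)) \<partial>M) \<le> (\<integral>x. norm (complex_of_real (?r x)) + norm (complex_of_real (?i x)) \<partial>M)"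
  proof (rule integral_mono_AE)
    show "AE x in M. norm ((T ^^ n) g x - (\<integral>y. g y \<partial>M)) \<le> norm (complex_of_real (?r x)) + norm (complex_of_real (?i x))"
      using P.T_Complex[OF g(1)]
    proof eventually_elim
      case (elim x)
      have e: "(T ^^ n) g x - (\<integral>y. g y \<partial>M) = complex_of_real (?r x) + \<i> * complex_of_real (?i x)"
        using elim g(1) by (simp add: complex_eq_iff)
      show ?case
        unfolding e using norm_triangle_ineq[of "complex_of_real (?r x)" "\<i> * complex_of_real (?i x)"]
        by (simp only: norm_mult norm_ii mult_1)
    qed
  qed (intro integrable_norm Bochner_Integration.integrable_diff P.T_integrable g(1) integrable_const
      Bochner_Integration.integrable_add conjunct1[OF real[OF integrable_Re[OF g(1)] R(1)]] conjunct1[OF real[OF integrable_Im[OF g(1)] R(2)]])+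
  also have "\<dots> = (\<integral>x. norm (complex_of_real (?r x)) \<partial>M) + (\<integral>x. norm (complex_of_real (?i x)) \<partial>M)"
    using real[OF integrable_Re[OF g(1)] R(1)] real[OF integrable_Im[OF g(1)] R(2)]
    by (intro Bochner_Integration.integral_add) (rule conjunct1, assumption)+
  also have "\<dots> \<le> \<kappa> * c + \<kappa> * c"
    by (intro add_mono conjunct2[OF real[OF integrable_Re[OF g(1)] R(1)]] conjunct2[OF real[OF integrable_Im[OF g(1)] R(2)]])
  finally show ?thesis by simp
qed

text \<open>Interpolation between L^1 and a sup bound: a function bounded by 2 c has |.|^p <= (2
  c)^(p-1) |.|. In L^1 the cost of the hole is paid twice, once for the iterate and once for its
  mean, and the gap contributes the remaining term.\<close>

lemma center_hole_funpow_bounded: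
  assumes gap: "L2_gap M (T ^^ n) \<kappa>" and \<kappa>: "\<kappa> \<ge> 0" and g: "g \<in> borel_measurable M" "AE x in M. norm (g x) \<le> c"
    and c: "c \<ge> 0" and p: "p \<ge> 1"
  shows "Lp_norm p M (center ((hole ^^ n) g)) powr p \<le> (2 * c) powr (p - 1) * (2 * real n * c * h + 2 * \<kappa> * c)"
proof -
  interpret P: markov_op M "T ^^ n" by (rule markov_op_funpow)
  have gi: "integrable M g" using Lp_bounded(1)[OF g, of 1] by (simp add: Lp_1_iff)
  let ?a = "(hole ^^ n) g" and ?t = "(T ^^ n) g"
  have a: "integrable M ?a" and t: "integrable M ?t" by (rule hole_funpow_integrable[OF gi] P.T_integrable[OF gi])+
  have ale: "AE x in M. norm (?a x) \<le> c" by (rule hole_funpow_bounded[OF gi g(2)])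
  have "norm (\<integral>x. ?a x \<partial>M) \<le> Lp_norm 1 M ?a" using a by (intro norm_integral_le_Lp_norm) (auto simp: Lp_1_iff)
  also have "\<dots> \<le> c" using a ale by (intro Lp_bounded) auto
  finally have ia: "norm (\<integral>x. ?a x \<partial>M) \<le> c" .
  have cle: "AE x in M. norm (center ?a x) \<le> 2 * c"
    using ale
  proof eventually_elim
    case (elim x)
    then show ?case
      using norm_triangle_ineq4[of "?a x" "\<integral>y. ?a y \<partial>M"] ia unfolding center_def by linarith
  qed
  have ci: "integrable M (center ?a)" using a by (simp add: center_def)
  have cL: "center ?a \<in> Lp p M" using ci cle p by (intro Lp_bounded(1)) auto
  have "norm ((\<integral>y. g y \<partial>M) - (\<integral>y. ?a y \<partial>M)) \<le> n * c * h"
  proof -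
    have e: "(\<integral>y. g y \<partial>M) - (\<integral>y. ?a y \<partial>M) = - (\<integral>y. ?a y - ?t y \<partial>M)"
      using P.T_integral[OF gi] a t by simp
    have "norm (\<integral>y. ?a y - ?t y \<partial>M) \<le> (\<integral>y. norm (?a y - ?t y) \<partial>M)" by (rule integral_norm_bound)
    also have "\<dots> \<le> n * c * h" by (rule hole_funpow_L1_diff[OF gi g(2) c])
    finally show ?thesis unfolding e norm_minus_cancel .
  qed
  note m = this
  have "(\<integral>x. norm (center ?a x) \<partial>M) \<le> (\<integral>x. norm (?a x - ?t x) + norm (?t x - (\<integral>y. g y \<partial>M)) + n * c * h \<partial>M)"
  proof (rule integral_mono)
    fix x
    have e: "center ?a x = (?a x - ?t x) + (?t x - (\<integral>y. g y \<partial>M)) + ((\<integral>y. g y \<partial>M) - (\<integral>y. ?a y \<partial>M))"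
      by (simp add: center_def)
    show "norm (center ?a x) \<le> norm (?a x - ?t x) + norm (?t x - (\<integral>y. g y \<partial>M)) + n * c * h"
      unfolding e using m norm_triangle_ineq[of "?a x - ?t x" "?t x - (\<integral>y. g y \<partial>M)"]
        norm_triangle_ineq[of "(?a x - ?t x) + (?t x - (\<integral>y. g y \<partial>M))" "(\<integral>y. g y \<partial>M) - (\<integral>y. ?a y \<partial>M)"] by linarith
  qed (intro integrable_norm ci Bochner_Integration.integrable_add Bochner_Integration.integrable_diff a t integrable_const)+
  also have "\<dots> = (\<integral>x. norm (?a x - ?t x) \<partial>M) + (\<integral>x. norm (?t x - (\<integral>y. g y \<partial>M)) \<partial>M) + n * c * h"
    using a t by (simp add: prob_space)
  also have "\<dots> \<le> n * c * h + 2 * \<kappa> * c + n * c * h"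
    by (intro add_mono order_refl hole_funpow_L1_diff[OF gi g(2) c] gap_L1[OF gap \<kappa> gi g(2)])
  finally have L1: "(\<integral>x. norm (center ?a x) \<partial>M) \<le> 2 * real n * c * h + 2 * \<kappa> * c" by (simp add: ac_simps)
  have "Lp_norm p M (center ?a) powr p = (\<integral>x. norm (center ?a x) powr p \<partial>M)" using p by (intro Lp_norm_powr) simp
  also have "\<dots> \<le> (\<integral>x. (2 * c) powr (p - 1) * norm (center ?a x) \<partial>M)"
  proof (rule integral_mono_AE)
    show "AE x in M. norm (center ?a x) powr p \<le> (2 * c) powr (p - 1) * norm (center ?a x)"
      using cle
    proof eventually_elim
      case (elim x)
      have "norm (center ?a x) powr p = norm (center ?a x) powr ((p - 1) + 1)" by simp
      also have "\<dots> = norm (center ?a x) powr (p - 1) * norm (center ?a x)"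
        by (simp only: powr_add powr_one norm_ge_zero)
      also have "\<dots> \<le> (2 * c) powr (p - 1) * norm (center ?a x)"
        using elim p by (intro mult_right_mono powr_mono2) auto
      finally show ?case .
    qed
  qed (intro Lp_integrable_powr cL integrable_mult_right integrable_norm ci)+
  also have "\<dots> = (2 * c) powr (p - 1) * (\<integral>x. norm (center ?a x) \<partial>M)" by simp
  also have "\<dots> \<le> (2 * c) powr (p - 1) * (2 * real n * c * h + 2 * \<kappa> * c)" using L1 by (intro mult_left_mono) auto
  finally show ?thesis .
qed

text \<open>The image of 1 is 1 - T (indicator H), and centering removes the constant.\<close>

lemma centered_hole_one:
  assumes p: "p \<ge> 1"
  shows "Lp_norm p M (centered_hole (\<lambda>_. 1)) \<le> 2 * h powr (1 / p)"
proof -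
  have one: "integrable M (\<lambda>_. 1 :: complex)" and indH: "integrable M (indicator H :: _ \<Rightarrow> complex)"
    by (auto intro: integrable_indicator_complex)
  have iH: "indicator H \<in> Lp p M" by (rule Lp_bounded(1)[where c=1]) (use p in \<open>auto simp: indicator_def\<close>)
  have THi: "integrable M (T (indicator H))" by (rule T_integrable[OF indH])
  have oi: "integrable M (hole (\<lambda>_. 1))" by (rule hole_integrable[OF one])
  have d: "integrable M (\<lambda>x. 1 - indicator H x :: complex)" using indH by simp
  have "AE x in M. cut (\<lambda>_. 1) x = 1 - indicator H x"
    using sets.sets_into_space[OF H] by (intro AE_I2) (auto simp: cut_def indicator_def)
  from T_cong_AE[OF cut_integrable[OF one] d this] T_diff[OF one indH] T_one
  have eq: "AE x in M. hole (\<lambda>_. 1) x = 1 - T (indicator H) x"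
    unfolding hole_def by eventually_elim (simp only:)
  then have int: "(\<integral>x. hole (\<lambda>_. 1) x \<partial>M) = 1 - (\<integral>x. T (indicator H) x \<partial>M)"
    using oi THi by (subst integral_cong_AE[OF _ _ eq]) (auto simp: prob_space)
  have "Lp_norm p M (centered_hole (\<lambda>_. 1)) = Lp_norm p M (\<lambda>x. - 1 * center (T (indicator H)) x)"
    using eq oi THi by (intro Lp_norm_cong_AE) (auto simp: centered_hole_def center_def int elim!: eventually_mono)
  also have "\<dots> = Lp_norm p M (center (T (indicator H)))" using p Lp_norm_scale[of p M "-1"] by simp
  also have "\<dots> \<le> 2 * Lp_norm p M (T (indicator H))" by (intro center_norm_le T_Lp iH p)
  also have "\<dots> \<le> 2 * Lp_norm p M (indicator H)" using T_Lp(2)[OF iH p] by simp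
  also have "\<dots> = 2 * h powr (1 / p)" using p by (simp add: Lp_norm_indicator)
  finally show ?thesis .
qed

text \<open>
  Centering after every step differs from centering once at the end by terms that contain
  \<^term>\<open>centered_hole (\<lambda>_. 1)\<close>, which is small.
\<close>

lemma centered_hole_funpow_diff:
  assumes f: "f \<in> Lp p M" and p: "p \<ge> 1"
  shows "Lp_norm p M (\<lambda>x. (centered_hole ^^ Suc n) f x - center ((hole ^^ Suc n) f) x)
     \<le> (2 ^ Suc n - 1) * (2 * h powr (1 / p)) * Lp_norm p M f"
proof (induction n)
  case 0
  show ?case by (simp add: centered_hole_def)
next
  case (Suc n)
  note B = Lp_bounded_linear_centered_hole[OF p] and BL = Lp_bounded_linear_Lp[OF Lp_bounded_linear_centered_hole[OF p]]
  let ?b = "(centered_hole ^^ Suc n) f" and ?a = "(hole ^^ Suc n) f"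
  have b: "?b \<in> Lp p M" by (rule Lp_bounded_linear_Lp[OF Lp_bounded_linear_funpow[OF B p] f])
  have a: "?a \<in> Lp p M" "Lp_norm p M ?a \<le> Lp_norm p M f" using hole_funpow_Lp[OF f p, of "Suc n"] by auto
  have ca: "center ?a \<in> Lp p M" by (rule center_Lp[OF a(1) p])
  have d: "(\<lambda>x. ?b x - center ?a x) \<in> Lp p M" by (rule Lp_diff[OF b ca p])
  define c where "c = (\<integral>y. ?a y \<partial>M)"
  have c: "norm c \<le> Lp_norm p M f" unfolding c_def using norm_integral_le_Lp_norm[OF a(1) p] a(2) by simp
  have cen: "center ?a = (\<lambda>x. ?a x - c * 1)" by (simp add: center_def c_def)
  have c1: "(\<lambda>x. c * 1) \<in> Lp p M" by simp
  have e: "center ((hole ^^ Suc (Suc n)) f) = centered_hole ?a" by (simp add: centered_hole_def)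
  have "AE x in M. centered_hole ?b x - center ((hole ^^ Suc (Suc n)) f) x
      = centered_hole (\<lambda>x. ?b x - center ?a x) x - c * centered_hole (\<lambda>_. 1) x"
    using Lp_bounded_linear_diff[OF B b ca] Lp_bounded_linear_diff[OF B a(1) c1]
      Lp_bounded_linear_scale[OF B Lp_const[of 1], of c]
    unfolding e cen
  proof eventually_elim
    case (elim x)
    have alg: "X - Y = X - (Y - Z) - Z" for X Y Z :: complex by simp
    show ?case unfolding elim(1) elim(2) elim(3) by (rule alg)
  qed
  then have "Lp_norm p M (\<lambda>x. centered_hole ?b x - center ((hole ^^ Suc (Suc n)) f) x)
     = Lp_norm p M (\<lambda>x. centered_hole (\<lambda>x. ?b x - center ?a x) x - c * centered_hole (\<lambda>_. 1) x)"
    by (intro Lp_norm_cong_AE Lp_measurable[OF Lp_diff[OF BL[OF b] center_Lp[OF conjunct1[OF hole_funpow_Lp[OF f p]] p] p]]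
        Lp_measurable[OF Lp_diff[OF BL[OF d] Lp_scale[OF BL[OF Lp_const]] p]])
  also have "\<dots> \<le> Lp_norm p M (centered_hole (\<lambda>x. ?b x - center ?a x)) + Lp_norm p M (\<lambda>x. c * centered_hole (\<lambda>_. 1) x)"
    by (rule Lp_norm_triangle_diff[OF BL[OF d] Lp_scale[OF BL[OF Lp_const]] p])
  \<comment> \<open>One more step doubles the error and adds one new term, hence the factor 2^n -
    1.\<close>
  also have "\<dots> \<le> 2 * Lp_norm p M (\<lambda>x. ?b x - center ?a x) + Lp_norm p M f * (2 * h powr (1 / p))"
  proof (intro add_mono centered_hole_norm_le[OF d p])
    have "Lp_norm p M (\<lambda>x. c * centered_hole (\<lambda>_. 1) x) = norm c * Lp_norm p M (centered_hole (\<lambda>_. 1))"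
      using p by (intro Lp_norm_scale) simp
    also have "\<dots> \<le> Lp_norm p M f * (2 * h powr (1 / p))"
      by (intro mult_mono c centered_hole_one p) simp_all
    finally show "Lp_norm p M (\<lambda>x. c * centered_hole (\<lambda>_. 1) x) \<le> Lp_norm p M f * (2 * h powr (1 / p))" .
  qed
  also have "\<dots> \<le> 2 * ((2 ^ Suc n - 1) * (2 * h powr (1 / p)) * Lp_norm p M f) + Lp_norm p M f * (2 * h powr (1 / p))"
    by (intro add_mono mult_left_mono Suc order_refl) simp
  also have "\<dots> = (2 ^ Suc (Suc n) - 1) * (2 * h powr (1 / p)) * Lp_norm p M f" by (simp add: algebra_simps)
  finally show ?case by simp
qed

end

lemma powr_le_imp_le_nonneg:
  fixes a b p :: real
  assumes "a \<ge> 0" "b \<ge> 0" "p > 0" "a powr p \<le> b powr p"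
  shows "a \<le> b"
  using assms powr_less_mono2[of p b a] by (meson not_le)

text \<open>\<open>n0\<close> steps produce a part bounded by t and a remainder of norm at most 1 /
  32; \<open>m\<close> further steps shrink the bounded part to 1 / 8 and, with centering, at most
  double the remainder. The total is at most 3 / 16.\<close>

lemma uniform_center_contraction:
  assumes \<kappa>: "\<kappa> \<longlonglongrightarrow> 0" "\<And>n. \<kappa> n \<ge> 0" and p: "p > 1"
  obtains n \<delta> where "n > 0" "\<delta> > 0"
    "\<And>(M :: 'a measure) T H f. gap_markov \<kappa> M T \<Longrightarrow> H \<in> sets M \<Longrightarrow> measure M H \<le> \<delta> \<Longrightarrow>
       f \<in> Lp p M \<Longrightarrow> Lp_norm p M f \<le> 1 \<Longrightarrow>
       Lp_norm p M (prob_space.center M ((hole_markov.hole M T H ^^ n) f)) \<le> 1 / 4"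
proof -
  obtain n0 t where t: "t > 0" and tr: 
    "\<And>(M :: 'a measure) T (f :: 'a \<Rightarrow> complex) (F :: 'a \<Rightarrow> complex). gap_markov \<kappa> M T \<Longrightarrow> f \<in> Lp p M \<Longrightarrow> Lp_norm p M f \<le> 1 \<Longrightarrow>
        F \<in> borel_measurable M \<Longrightarrow>
        AE x in M. norm (F x) \<le> markov_op.Tr (T ^^ n0) (\<lambda>x. norm (f x)) x \<Longrightarrow>
        (\<lambda>x. if norm (F x) \<le> t then 0 else F x) \<in> Lp p M \<and>
        Lp_norm p M (\<lambda>x. if norm (F x) \<le> t then 0 else F x) \<le> 1 / 32"
    by (rule uniform_truncation[OF \<kappa> p, of "1 / 32"]) auto
  \<comment> \<open>Half of (1 / 8)^p goes to the gap term, which fixes m, and half to the hole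
    term, which fixes how small the hole must be.\<close>
  define c where "c = (1 / 8) powr p / 2"
  have c: "c > 0" by (simp add: c_def)
  have "(\<lambda>m. (2 * t) powr (p - 1) * (2 * \<kappa> m * t)) \<longlonglongrightarrow> (2 * t) powr (p - 1) * (2 * 0 * t)"
    by (intro tendsto_intros \<kappa>)
  then have "eventually (\<lambda>m. (2 * t) powr (p - 1) * (2 * \<kappa> m * t) < c) sequentially"
    using c by (intro order_tendstoD) auto
  moreover have "eventually (\<lambda>m. \<kappa> m < 1) sequentially" using \<kappa>(1) by (intro order_tendstoD) auto
  ultimately have "eventually (\<lambda>m. (2 * t) powr (p - 1) * (2 * \<kappa> m * t) < c \<and> \<kappa> m < 1 \<and> m > 0) sequentially"
    using eventually_gt_at_top[of 0] by eventually_elim auto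
  then obtain m where m: "(2 * t) powr (p - 1) * (2 * \<kappa> m * t) < c" "\<kappa> m < 1" "m > 0"
    by (auto simp: eventually_sequentially)
  \<comment> \<open>The coefficient of the measure of the hole in the bound for the bounded part;
    measure at most c / k makes that term at most c.\<close>
  define k where "k = (2 * t) powr (p - 1) * (2 * real m * t)"
  have k: "k > 0" using t m by (simp add: k_def)
  show ?thesis
  proof (rule that[of "m + n0" "c / k"])
    show "m + n0 > 0" "c / k > 0" using m k c by auto
    fix M :: "'a measure" and T H f
    assume *: "gap_markov \<kappa> M T" "H \<in> sets M" "measure M H \<le> c / k" "f \<in> Lp p M" "Lp_norm p M f \<le> 1"
    interpret markov_op M T using *(1) by (simp add: gap_markov_def)
    interpret hole_markov M T H by unfold_locales fact
    have p1: "p \<ge> 1" using p by simp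
    let ?F = "(hole ^^ n0) f"
    have F: "?F \<in> Lp p M" using hole_funpow_Lp[OF *(4) p1] by simp
    note [measurable] = F
    let ?F1 = "\<lambda>x. if norm (?F x) \<le> t then ?F x else 0" and ?F2 = "\<lambda>x. if norm (?F x) \<le> t then 0 else ?F x"
    have F2: "?F2 \<in> Lp p M" "Lp_norm p M ?F2 \<le> 1 / 32"
      using tr[OF *(1,4,5) Lp_measurable[OF F] hole_funpow_norm_le[OF Lp_integrable[OF *(4) p1]]] by auto
    have F1m: "?F1 \<in> borel_measurable M" by measurable
    have F1: "?F1 \<in> Lp p M" by (rule Lp_bounded(1)[OF F1m, of t]) (use t p in auto)
    have split: "?F = (\<lambda>x. ?F1 x + ?F2 x)" by auto
    define S where "S = (\<lambda>f. center ((hole ^^ m) f))"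
    have S: "Lp_bounded_linear p M S"
      unfolding S_def by (rule Lp_bounded_linear_compose[OF Lp_bounded_linear_center[OF p1] Lp_bounded_linear_funpow[OF Lp_bounded_linear_hole[OF p1] p1] p1])
    have "L2_gap M (T ^^ m) (\<kappa> m)" using *(1) m(2) by (simp add: gap_markov_def)
    from center_hole_funpow_bounded[OF this \<kappa>(2) F1m _ _ p1, of t]
    have "Lp_norm p M (S ?F1) powr p \<le> (2 * t) powr (p - 1) * (2 * real m * t * h + 2 * \<kappa> m * t)"
      using t unfolding S_def by auto
    also have "\<dots> = k * h + (2 * t) powr (p - 1) * (2 * \<kappa> m * t)" by (simp add: k_def algebra_simps)
    also have "\<dots> \<le> c + c"
      using *(3) k m(1) by (intro add_mono) (auto simp: field_simps)
    also have "\<dots> = (1 / 8) powr p" by (simp add: c_def)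
    finally have S1p: "Lp_norm p M (S ?F1) powr p \<le> (1 / 8) powr p" .
    have S1: "Lp_norm p M (S ?F1) \<le> 1 / 8"
      by (rule powr_le_imp_le_nonneg[OF _ _ _ S1p]) (use p in auto)
    have hF2: "(hole ^^ m) ?F2 \<in> Lp p M" "Lp_norm p M ((hole ^^ m) ?F2) \<le> Lp_norm p M ?F2"
      using hole_funpow_Lp[OF F2(1) p1, of m] by auto
    have S2: "Lp_norm p M (S ?F2) \<le> 1 / 16"
      using center_norm_le[OF hF2(1) p1] hF2(2) F2(2) by (simp add: S_def)
    note SL = Lp_bounded_linear_Lp[OF S]
    have "Lp_norm p M (S ?F) = Lp_norm p M (\<lambda>x. S ?F1 x + S ?F2 x)"
    proof (rule Lp_norm_cong_AE)
      show "AE x in M. S ?F x = S ?F1 x + S ?F2 x"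
        using Lp_bounded_linear_add[OF S F1 F2(1)] unfolding split[symmetric] .
    qed (use SL[OF F] SL[OF F1] SL[OF F2(1)] in \<open>auto dest!: Lp_measurable\<close>)
    also have "\<dots> \<le> Lp_norm p M (S ?F1) + Lp_norm p M (S ?F2)"
      by (rule Lp_norm_triangle[OF SL[OF F1] SL[OF F2(1)] p1])
    also have "\<dots> \<le> 1 / 4" using S1 S2 by simp
    finally show "Lp_norm p M (center ((hole ^^ (m + n0)) f)) \<le> 1 / 4"
      by (simp add: S_def funpow_add)
  qed
qed

text \<open>Centering in every step instead of once at the end costs a further 1 / 4, so the n-th
  power has norm at most 1 / 2. Division of j by n turns this into a geometric rate.\<close>

lemma uniform_contraction:
  assumes \<kappa>: "\<kappa> \<longlonglongrightarrow> 0" "\<And>n. \<kappa> n \<ge> 0" and p: "p > 1"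
  obtains K \<theta> \<delta> where "K > 0" "0 < \<theta>" "\<theta> < 1" "\<delta> > 0"
    "\<And>(M :: 'a measure) T H f j. gap_markov \<kappa> M T \<Longrightarrow> H \<in> sets M \<Longrightarrow> measure M H \<le> \<delta> \<Longrightarrow>
       f \<in> Lp p M \<Longrightarrow>
       Lp_norm p M ((hole_markov.centered_hole M T H ^^ j) f) \<le> K * \<theta> ^ j * Lp_norm p M f"
proof -
  obtain n \<delta>0 where n: "n > 0" and \<delta>0: "\<delta>0 > 0" and con:
    "\<And>(M :: 'a measure) T H f. gap_markov \<kappa> M T \<Longrightarrow> H \<in> sets M \<Longrightarrow> measure M H \<le> \<delta>0 \<Longrightarrow>
       f \<in> Lp p M \<Longrightarrow> Lp_norm p M f \<le> 1 \<Longrightarrow>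
       Lp_norm p M (prob_space.center M ((hole_markov.hole M T H ^^ n) f)) \<le> 1 / 4"
    by (rule uniform_center_contraction[OF \<kappa> p]) (rule that; assumption)
  \<comment> \<open>The second bound makes the price of repeated centering, 2^n times 2 h^(1/p), at
    most 1 / 4.\<close>
  define \<delta> where "\<delta> = min \<delta>0 ((1 / 2 ^ (n + 3)) powr p)"
  define \<theta> where "\<theta> = (1 / 2 :: real) powr (1 / n)"
  have \<theta>: "0 < \<theta>" "\<theta> < 1"
    using n powr_less_mono'[of "1/2" 0 "1 / n"] by (auto simp: \<theta>_def)
  show ?thesis
  proof (rule that[of "2 ^ (n + 1)" \<theta> \<delta>])
    show "\<delta> > 0" using \<delta>0 by (simp add: \<delta>_def)
    fix M :: "'a measure" and T H f and j :: nat
    assume *: "gap_markov \<kappa> M T" "H \<in> sets M" "measure M H \<le> \<delta>" "f \<in> Lp p M"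
    interpret markov_op M T using *(1) by (simp add: gap_markov_def)
    interpret hole_markov M T H by unfold_locales fact
    have p1: "p \<ge> 1" using p by simp
    note B = Lp_bounded_linear_centered_hole[OF p1]
    note Bn = Lp_bounded_linear_funpow[OF B p1]
    have hp: "h powr (1 / p) \<le> 1 / 2 ^ (n + 3)"
    proof -
      have "h powr (1 / p) \<le> ((1 / 2 ^ (n + 3)) powr p) powr (1 / p)"
        using *(3) p by (intro powr_mono2) (auto simp: \<delta>_def)
      also have "\<dots> = (1 / 2 ^ (n + 3)) powr 1" using p by (simp only: powr_powr) simp
      finally show ?thesis by simp
    qed
    have unit: "Lp_norm p M ((centered_hole ^^ n) g) \<le> 1 / 2" if g: "g \<in> Lp p M" "Lp_norm p M g \<le> 1" for g
    proof -
      obtain n' where n': "n = Suc n'" using n by (cases n) auto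
      let ?a = "(centered_hole ^^ n) g" and ?b = "center ((hole ^^ n) g)"
      have b: "?b \<in> Lp p M" using hole_funpow_Lp[OF g(1) p1, of n] by (intro center_Lp p1) simp
      have a: "?a \<in> Lp p M" by (rule Lp_bounded_linear_Lp[OF Bn g(1)])
      have b4: "Lp_norm p M ?b \<le> 1 / 4"
        using *(3) by (intro con[OF *(1,2) _ g]) (simp add: \<delta>_def)
      have "Lp_norm p M (\<lambda>x. ?a x - ?b x) \<le> (2 ^ n - 1) * (2 * h powr (1 / p)) * Lp_norm p M g"
        using centered_hole_funpow_diff[OF g(1) p1, of n'] by (simp only: n')
      also have "\<dots> \<le> 2 ^ n * (2 * (1 / 2 ^ (n + 3))) * 1"
        using hp g(2) by (intro mult_mono) auto
      also have "\<dots> = 1 / 4" by (simp add: power_add)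
      finally have d: "Lp_norm p M (\<lambda>x. ?a x - ?b x) \<le> 1 / 4" .
      have "Lp_norm p M ?a = Lp_norm p M (\<lambda>x. (?a x - ?b x) + ?b x)" by simp
      also have "\<dots> \<le> Lp_norm p M (\<lambda>x. ?a x - ?b x) + Lp_norm p M ?b"
        by (rule Lp_norm_triangle[OF Lp_diff[OF a b p1] b p1])
      finally show ?thesis using d b4 by simp
    qed
    have half: "Lp_norm p M ((centered_hole ^^ n) g) \<le> 1 / 2 * Lp_norm p M g" if "g \<in> Lp p M" for g
      by (rule Lp_bounded_linear_unit_bound[OF Bn p1 that unit])
    have q: "Lp_norm p M (((centered_hole ^^ n) ^^ q) g) \<le> (1 / 2) ^ q * Lp_norm p M g" if g: "g \<in> Lp p M" for q g
    proof (induction q)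
      case (Suc q)
      have "((centered_hole ^^ n) ^^ q) g \<in> Lp p M"
        by (rule Lp_bounded_linear_Lp[OF Lp_bounded_linear_funpow[OF Bn p1] g])
      from half[OF this] Suc show ?case by simp
    qed simp
    have r: "Lp_norm p M ((centered_hole ^^ r) g) \<le> 2 ^ r * Lp_norm p M g" if g: "g \<in> Lp p M" for r g
    proof (induction r)
      case (Suc r)
      from centered_hole_norm_le[OF Lp_bounded_linear_Lp[OF Bn g, of r] p1] Suc show ?case by simp
    qed simp
    define q where "q = j div n"
    define r where "r = j mod n"
    have j: "j = n * q + r" "r < n" using n by (auto simp: q_def r_def)
    have rL: "(centered_hole ^^ r) f \<in> Lp p M" by (rule Lp_bounded_linear_Lp[OF Bn *(4)])
    have "(centered_hole ^^ j) f = ((centered_hole ^^ n) ^^ q) ((centered_hole ^^ r) f)"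
      by (simp add: j(1) funpow_add funpow_mult mult.commute)
    then have "Lp_norm p M ((centered_hole ^^ j) f) \<le> (1 / 2) ^ q * Lp_norm p M ((centered_hole ^^ r) f)"
      using q[OF rL] by simp
    also have "\<dots> \<le> (1 / 2) ^ q * (2 ^ r * Lp_norm p M f)" using r[OF *(4)] by (intro mult_left_mono) auto
    \<comment> \<open>As j / n <= q + 1, rounding down costs a factor 2; the r < n leftover steps
      cost at most 2^n, each step having norm at most 2.\<close>
    also have "\<dots> \<le> (2 * \<theta> ^ j) * (2 ^ n * Lp_norm p M f)"
    proof (intro mult_mono)
      have "real j / n \<le> q + 1"
      proof -
        have "real j \<le> real n * (q + 1)" using j by (simp add: algebra_simps)
        then show ?thesis using n by (simp add: field_simps)
      qed
      then have "(1 / 2 :: real) powr (q + 1) \<le> (1 / 2) powr (real j / n)" by (intro powr_mono') auto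
      also have "\<dots> = \<theta> ^ j" using \<theta> by (simp add: \<theta>_def powr_powr flip: powr_realpow)
      also have "(1 / 2 :: real) powr (q + 1) = (1 / 2) ^ (q + 1)"
        by (subst powr_realpow[symmetric]) (auto simp: add.commute)
      finally show "(1 / 2) ^ q \<le> 2 * \<theta> ^ j" by simp
      show "(2::real) ^ r \<le> 2 ^ n" using j(2) by (intro power_increasing) auto
    qed (use \<theta> in auto)
    finally show "Lp_norm p M ((centered_hole ^^ j) f) \<le> 2 ^ (n + 1) * \<theta> ^ j * Lp_norm p M f" by (simp add: ac_simps)
  qed (use \<theta> in auto)
qed

section \<open>Neumann series\<close>

text \<open>Kept apart from the hole so that the same operator can be viewed on L^p and on L^q with
  different constants.\<close>

locale Lp_contraction = prob_space M for M :: "'a measure" +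
  fixes p :: real and B :: "('a \<Rightarrow> complex) \<Rightarrow> 'a \<Rightarrow> complex" and K \<theta> :: real
  assumes p: "p \<ge> 1" and B: "Lp_bounded_linear p M B"
    and K: "K > 0" and \<theta>: "\<theta> > 0"
    and decay: "\<And>j f. f \<in> Lp p M \<Longrightarrow> Lp_norm p M ((B ^^ j) f) \<le> K * \<theta> ^ j * Lp_norm p M f"
begin

lemma B_funpow: "Lp_bounded_linear p M (B ^^ j)"
  by (rule Lp_bounded_linear_funpow[OF B p])

text \<open>Substituting e = (B e + w) / z into itself n times gives the partial Neumann sum plus a
  remainder B^n e / z^n, which the decay sends to 0. Uniqueness follows, and the bound applies to
  any solution, however it was obtained.\<close>

lemma solution_norm_le:
  assumes z: "norm z > \<theta>" and e: "e \<in> Lp p M" and w: "w \<in> Lp p M"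
    and eq: "AE x in M. z * e x - B e x = w x"
  shows "Lp_norm p M e \<le> K / (norm z - \<theta>) * Lp_norm p M w"
proof -
  define W where "W = Lp_norm p M w"
  define x where "x = \<theta> / norm z"
  have z0: "norm z > 0" using z \<theta> by linarith
  have x: "0 \<le> x" "x < 1" using z \<theta> by (auto simp: x_def divide_simps)
  note BL = Lp_bounded_linear_Lp[OF B_funpow]
  have step: "norm z * Lp_norm p M ((B ^^ j) e) \<le> Lp_norm p M ((B ^^ Suc j) e) + K * \<theta> ^ j * W" for j
  proof -
    have ze: "(\<lambda>x. z * e x) \<in> Lp p M" and Be: "B e \<in> Lp p M" and d: "(\<lambda>x. z * e x - B e x) \<in> Lp p M"
      using Lp_scale[OF e] BL[OF e, of 1] by (auto intro: Lp_diff p)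
    have "AE x in M. (B ^^ j) w x = (B ^^ j) (\<lambda>x. z * e x - B e x) x"
      using Lp_bounded_linear_cong_AE[OF B_funpow d w p eq, of j] by eventually_elim (rule sym)
    with Lp_bounded_linear_diff[OF B_funpow ze Be, of j] Lp_bounded_linear_scale[OF B_funpow e, of j z]
    have "AE x in M. z * (B ^^ j) e x = (B ^^ Suc j) e x + (B ^^ j) w x"
      by eventually_elim (simp add: funpow_swap1)
    then have "Lp_norm p M (\<lambda>x. z * (B ^^ j) e x) = Lp_norm p M (\<lambda>x. (B ^^ Suc j) e x + (B ^^ j) w x)"
      by (intro Lp_norm_cong_AE Lp_measurable[OF Lp_scale[OF BL[OF e]]] Lp_measurable[OF Lp_add[OF BL[OF e] BL[OF w] p]])
    also have "\<dots> \<le> Lp_norm p M ((B ^^ Suc j) e) + Lp_norm p M ((B ^^ j) w)"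
      by (rule Lp_norm_triangle[OF BL[OF e] BL[OF w] p])
    also have "\<dots> \<le> Lp_norm p M ((B ^^ Suc j) e) + K * \<theta> ^ j * W"
      using decay[OF w, of j] by (simp add: W_def)
    finally show ?thesis using p by (simp add: Lp_norm_scale)
  qed
  have iter: "Lp_norm p M e \<le> Lp_norm p M ((B ^^ n) e) / norm z ^ n + K * W / norm z * (\<Sum>j<n. x ^ j)" for n
  proof (induction n)
    case (Suc n)
    have "Lp_norm p M ((B ^^ n) e) / norm z ^ n \<le> (Lp_norm p M ((B ^^ Suc n) e) + K * \<theta> ^ n * W) / norm z ^ Suc n"
      using step[of n] z0 by (simp add: field_simps del: funpow.simps)
    also have "\<dots> = Lp_norm p M ((B ^^ Suc n) e) / norm z ^ Suc n + K * W / norm z * x ^ n"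
      using z0 by (simp add: x_def power_divide field_simps del: funpow.simps)
    finally show ?case using Suc by (simp add: algebra_simps del: funpow.simps power_Suc)
  qed simp
  have bd: "Lp_norm p M e \<le> K * Lp_norm p M e * x ^ n + K / (norm z - \<theta>) * W" for n
  proof -
    have "Lp_norm p M ((B ^^ n) e) / norm z ^ n \<le> (K * \<theta> ^ n * Lp_norm p M e) / norm z ^ n"
      using decay[OF e, of n] by (intro divide_right_mono) auto
    also have "\<dots> = K * Lp_norm p M e * x ^ n" by (simp add: x_def power_divide)
    finally have 1: "Lp_norm p M ((B ^^ n) e) / norm z ^ n \<le> K * Lp_norm p M e * x ^ n" .
    have "(\<Sum>j<n. x ^ j) \<le> 1 / (1 - x)"
      using sum_le_suminf[OF summable_geometric, of x "{..<n}"] x suminf_geometric[of x] by simp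
    then have "K * W / norm z * (\<Sum>j<n. x ^ j) \<le> K * W / norm z * (1 / (1 - x))"
      using K by (intro mult_left_mono) (auto simp: W_def)
    also have "\<dots> = K / (norm z - \<theta>) * W" using z0 z by (simp add: x_def field_simps)
    finally show ?thesis using 1 iter[of n] by linarith
  qed
  have "(\<lambda>n. K * Lp_norm p M e * x ^ n + K / (norm z - \<theta>) * W) \<longlonglongrightarrow> K * Lp_norm p M e * 0 + K / (norm z - \<theta>) * W"
    using x by (intro tendsto_intros LIMSEQ_power_zero) auto
  then have "Lp_norm p M e \<le> K * Lp_norm p M e * 0 + K / (norm z - \<theta>) * W"
    by (rule LIMSEQ_le_const) (use bd in blast)
  then show ?thesis by (simp add: W_def)
qed

lemma solution_unique:
  assumes z: "norm z > \<theta>" and e: "e \<in> Lp p M" "e' \<in> Lp p M"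
    and eq: "AE x in M. z * e x - B e x = z * e' x - B e' x"
  shows "AE x in M. e x = e' x"
proof -
  have d: "(\<lambda>x. e x - e' x) \<in> Lp p M" by (rule Lp_diff[OF e p])
  have "AE x in M. z * (e x - e' x) - B (\<lambda>x. e x - e' x) x = 0"
    using eq Lp_bounded_linear_diff[OF B e]
  proof eventually_elim
    case (elim x)
    show ?case unfolding elim(2) using elim(1) by (simp add: algebra_simps)
  qed
  from solution_norm_le[OF z d Lp_zero this] have "Lp_norm p M (\<lambda>x. e x - e' x) = 0"
    by (intro antisym) auto
  then show ?thesis using Lp_AE_eq_iff[OF e p] by simp
qed

text \<open>The Neumann series is summed pointwise: the L^p bounds dominate the L^1 norms of the
  terms, so their absolute values have an integrable sum and the series converges almost everywhere.
  Fatou then supplies the rate in L^p, and the residual of the partial sums tends to 0.\<close>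

lemma solution_exists:
  assumes z: "norm z > \<theta>" and w: "w \<in> Lp p M"
  obtains e where "e \<in> Lp p M" "AE x in M. z * e x - B e x = w x"
proof -
  define W where "W = Lp_norm p M w"
  define x where "x = \<theta> / norm z"
  have z0: "norm z > 0" using z \<theta> by linarith
  have x: "0 \<le> x" "x < 1" using z \<theta> by (auto simp: x_def divide_simps)
  note BL = Lp_bounded_linear_Lp[OF B_funpow]
  define u where "u = (\<lambda>j y. (1 / z) ^ Suc j * (B ^^ j) w y)"
  define c where "c = K * W / norm z"
  have c: "c \<ge> 0" using K by (simp add: c_def W_def)
  have u: "u j \<in> Lp p M" for j unfolding u_def by (rule Lp_scale[OF BL[OF w]])
  note [measurable] = u
  have un: "Lp_norm p M (u j) \<le> c * x ^ j" for j
  proof -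
    have "Lp_norm p M (u j) = (1 / norm z) ^ Suc j * Lp_norm p M ((B ^^ j) w)"
      using p unfolding u_def by (simp only: Lp_norm_scale norm_power norm_divide norm_one)
    also have "\<dots> \<le> (1 / norm z) ^ Suc j * (K * \<theta> ^ j * W)"
      using decay[OF w, of j] by (intro mult_left_mono) (auto simp: W_def)
    also have "\<dots> = c * x ^ j" by (simp add: c_def x_def power_divide field_simps)
    finally show ?thesis .
  qed
  define s where "s = (\<lambda>n y. \<Sum>j<n. u j y)"
  have s: "s n \<in> Lp p M" for n unfolding s_def by (intro Lp_sum u p) auto
  note [measurable] = s
  have "AE y in M. summable (\<lambda>j. norm (u j y))"
  proof -
    have "(\<integral>\<^sup>+y. (\<Sum>j. ennreal (norm (u j y))) \<partial>M) = (\<Sum>j. \<integral>\<^sup>+y. ennreal (norm (u j y)) \<partial>M)"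
      by (intro nn_integral_suminf) measurable
    also have "\<dots> \<le> (\<Sum>j. ennreal (c * x ^ j))"
    proof (intro suminf_le allI summableI)
      fix j
      have "(\<integral>\<^sup>+y. ennreal (norm (u j y)) \<partial>M) = ennreal (\<integral>y. norm (u j y) \<partial>M)"
        using Lp_integrable[OF u p] by (intro nn_integral_eq_integral) auto
      also have "\<dots> \<le> ennreal (c * x ^ j)"
        using integral_norm_le_Lp_norm[OF u p] un[of j] by (intro ennreal_leI) (rule order_trans)
      finally show "(\<integral>\<^sup>+y. ennreal (norm (u j y)) \<partial>M) \<le> ennreal (c * x ^ j)" .
    qed
    also have "\<dots> = ennreal (\<Sum>j. c * x ^ j)"
      using c x by (intro suminf_ennreal2) (auto intro!: summable_mult summable_geometric)
    finally have "(\<integral>\<^sup>+y. (\<Sum>j. ennreal (norm (u j y))) \<partial>M) \<noteq> \<infinity>" by (auto simp: top_unique)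
    then have "AE y in M. (\<Sum>j. ennreal (norm (u j y))) \<noteq> \<infinity>"
      by (intro nn_integral_PInf_AE) measurable
    then show ?thesis by eventually_elim (auto intro: summable_suminf_not_top)
  qed
  then have conv: "AE y in M. convergent (\<lambda>n. s n y)"
    by eventually_elim (auto simp: s_def summable_iff_convergent[symmetric] intro: summable_norm_cancel)
  define e where "e = (\<lambda>y. lim (\<lambda>n. s n y))"
  have em: "e \<in> borel_measurable M" unfolding e_def by (intro borel_measurable_lim_metric) measurable
  have tail: "Lp_norm p M (\<lambda>y. s m y - s n y) \<le> c / (1 - x) * x ^ n" if "n \<le> m" for m n
  proof -
    have "(\<lambda>y. s m y - s n y) = (\<lambda>y. \<Sum>j\<in>{n..<m}. u j y)"
      unfolding s_def lessThan_atLeast0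
    proof
      fix y show "(\<Sum>j=0..<m. u j y) - (\<Sum>j=0..<n. u j y) = (\<Sum>j=n..<m. u j y)"
        using sum.atLeastLessThan_concat[of 0 n m "\<lambda>j. u j y"] that by (simp add: algebra_simps)
    qed
    then have "Lp_norm p M (\<lambda>y. s m y - s n y) \<le> (\<Sum>j\<in>{n..<m}. Lp_norm p M (u j))"
      using Lp_norm_sum[of "{n..<m}" u p M] u p by simp
    also have "\<dots> \<le> (\<Sum>j\<in>{n..<m}. c * x ^ j)" by (intro sum_mono un)
    also have "\<dots> \<le> c / (1 - x) * x ^ n"
    proof -
      have "(1 - x) * (\<Sum>j\<in>{n..<m}. x ^ j) = x ^ n - x ^ m"
        using that
      proof (induction m rule: dec_induct)
        case (step k)
        then have "(1 - x) * (\<Sum>j\<in>{n..<Suc k}. x ^ j) = (x ^ n - x ^ k) + (1 - x) * x ^ k"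
          by (simp add: distrib_left)
        then show ?case by (simp add: algebra_simps)
      qed simp
      then have "(1 - x) * (\<Sum>j\<in>{n..<m}. x ^ j) \<le> x ^ n" using x by simp
      then have "(\<Sum>j\<in>{n..<m}. x ^ j) \<le> x ^ n / (1 - x)" using x by (simp add: pos_le_divide_eq mult.commute)
      then have "c * (\<Sum>j\<in>{n..<m}. x ^ j) \<le> c * (x ^ n / (1 - x))" using c by (rule mult_left_mono)
      then show ?thesis by (simp add: sum_distrib_left)
    qed
    finally show ?thesis .
  qed
  \<comment> \<open>The tail bound does not depend on m, so letting m tend to infinity with n fixed
    preserves it.\<close>
  have es: "(\<lambda>y. e y - s n y) \<in> Lp p M \<and> Lp_norm p M (\<lambda>y. e y - s n y) \<le> c / (1 - x) * x ^ n" for n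
  proof (rule conjI)
    have lim: "AE y in M. (\<lambda>m. s m y - s n y) \<longlonglongrightarrow> e y - s n y"
      using conv by eventually_elim (auto simp: e_def convergent_LIMSEQ_iff intro!: tendsto_intros)
    have c': "c / (1 - x) * x ^ n \<ge> 0" using c x by simp
    have ev: "\<forall>\<^sub>F m in sequentially. Lp_norm p M (\<lambda>y. s m y - s n y) \<le> c / (1 - x) * x ^ n"
      using eventually_ge_at_top[of n] by eventually_elim (rule tail)
    have m: "(\<lambda>y. e y - s n y) \<in> borel_measurable M" using em by measurable
    have p0: "p > 0" using p by simp
    show "(\<lambda>y. e y - s n y) \<in> Lp p M" by (rule Lp_Fatou(1)[OF Lp_diff[OF s s p] m p0 lim ev c'])
    show "Lp_norm p M (\<lambda>y. e y - s n y) \<le> c / (1 - x) * x ^ n" by (rule Lp_Fatou(2)[OF Lp_diff[OF s s p] m p0 lim ev c'])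
  qed
  have e: "e \<in> Lp p M" using conjunct1[OF es[of 0]] by (simp add: s_def)
  \<comment> \<open>The sum telescopes, leaving only the term of order n as residual.\<close>
  have tele: "AE y in M. z * s n y - B (s n) y = w y - (1 / z) ^ n * (B ^^ n) w y" for n
  proof (induction n)
    case 0
    have "AE y in M. B (\<lambda>y. 0 * w y) y = 0 * B w y" by (rule Lp_bounded_linear_scale[OF B w])
    then show ?case by (auto simp: s_def)
  next
    case (Suc n)
    have "AE y in M. B (s (Suc n)) y = B (s n) y + B (u n) y"
      using Lp_bounded_linear_add[OF B s[of n] u[of n]] by (simp add: s_def)
    moreover have "AE y in M. B (u n) y = (1 / z) ^ Suc n * (B ^^ Suc n) w y"
      using Lp_bounded_linear_scale[OF B BL[OF w, of n], of "(1 / z) ^ Suc n"] unfolding u_def by simp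
    ultimately show ?case using Suc
    proof eventually_elim
      case (elim y)
      have "z * u n y = (1 / z) ^ n * (B ^^ n) w y" using z0 by (auto simp: u_def)
      then show ?case unfolding elim(1) elim(2) using elim(3)
        by (simp add: s_def distrib_left algebra_simps del: funpow.simps power_Suc)
    qed
  qed
  obtain b where b: "b \<ge> 0" "\<And>f. f \<in> Lp p M \<Longrightarrow> Lp_norm p M (B f) \<le> b * Lp_norm p M f"
    using Lp_bounded_linear_bound[OF B] by blast
  have Be: "B e \<in> Lp p M" by (rule Lp_bounded_linear_Lp[OF B e])
  have ze: "(\<lambda>y. z * e y - B e y) \<in> Lp p M" by (rule Lp_diff[OF Lp_scale[OF e] Be p])
  let ?N = "Lp_norm p M (\<lambda>y. (z * e y - B e y) - w y)"
  have "?N \<le> (norm z + b) * (c / (1 - x) * x ^ n) + K * W * x ^ n" for n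
  proof -
    let ?d = "\<lambda>y. e y - s n y"
    have d: "?d \<in> Lp p M" "Lp_norm p M ?d \<le> c / (1 - x) * x ^ n" using es[of n] by auto
    have Bd: "B ?d \<in> Lp p M" by (rule Lp_bounded_linear_Lp[OF B d(1)])
    have t: "(\<lambda>y. (1 / z) ^ n * (B ^^ n) w y) \<in> Lp p M" by (rule Lp_scale[OF BL[OF w]])
    have zd: "(\<lambda>y. z * ?d y - B ?d y) \<in> Lp p M" by (rule Lp_diff[OF Lp_scale[OF d(1)] Bd p])
    have "AE y in M. (z * e y - B e y) - w y = (z * ?d y - B ?d y) - (1 / z) ^ n * (B ^^ n) w y"
      using Lp_bounded_linear_diff[OF B e s[of n]] tele[of n]
    proof eventually_elim
      case (elim y)
      then show ?case unfolding elim(1) by (simp add: algebra_simps)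
    qed
    then have "?N = Lp_norm p M (\<lambda>y. (z * ?d y - B ?d y) - (1 / z) ^ n * (B ^^ n) w y)"
      by (intro Lp_norm_cong_AE Lp_measurable[OF Lp_diff[OF ze w p]] Lp_measurable[OF Lp_diff[OF zd t p]])
    also have "\<dots> \<le> Lp_norm p M (\<lambda>y. z * ?d y - B ?d y) + Lp_norm p M (\<lambda>y. (1 / z) ^ n * (B ^^ n) w y)"
      by (rule Lp_norm_triangle_diff[OF zd t p])
    also have "Lp_norm p M (\<lambda>y. z * ?d y - B ?d y) \<le> norm z * Lp_norm p M ?d + b * Lp_norm p M ?d"
      using Lp_norm_triangle_diff[OF Lp_scale[OF d(1), of z] Bd p] b(2)[OF d(1)] p
      by (simp add: Lp_norm_scale)
    also have "\<dots> \<le> (norm z + b) * (c / (1 - x) * x ^ n)"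
      unfolding distrib_right[symmetric] using b(1) by (intro mult_left_mono d(2)) simp
    also have "Lp_norm p M (\<lambda>y. (1 / z) ^ n * (B ^^ n) w y) \<le> K * W * x ^ n"
    proof -
      have "Lp_norm p M (\<lambda>y. (1 / z) ^ n * (B ^^ n) w y) = (1 / norm z) ^ n * Lp_norm p M ((B ^^ n) w)"
        using p by (simp only: Lp_norm_scale norm_power norm_divide norm_one)
      also have "\<dots> \<le> (1 / norm z) ^ n * (K * \<theta> ^ n * W)"
        using decay[OF w, of n] by (intro mult_left_mono) (auto simp: W_def)
      also have "\<dots> = K * W * x ^ n" by (simp add: x_def power_divide field_simps)
      finally show ?thesis .
    qed
    finally show ?thesis by simp
  qed
  moreover have "(\<lambda>n. (norm z + b) * (c / (1 - x) * x ^ n) + K * W * x ^ n) \<longlonglongrightarrow> (norm z + b) * (c / (1 - x) * 0) + K * W * 0"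
    using x by (intro tendsto_intros LIMSEQ_power_zero) auto
  ultimately have "?N \<le> (norm z + b) * (c / (1 - x) * 0) + K * W * 0"
    by (intro LIMSEQ_le_const) auto
  then have "?N = 0" by (intro antisym) auto
  then have "AE y in M. z * e y - B e y = w y" using Lp_AE_eq_iff[OF ze w p] by simp
  with e show ?thesis by (rule that)
qed

end

section \<open>Spectrum of the operator with a hole\<close>

text \<open>The lower bound gives injectivity and the norm of the inverse. The inverse is a choice
  of preimages, and it is linear because preimages are unique almost everywhere.\<close>

lemma Lp_resolvent_setI:
  assumes p: "p \<ge> 1" and Z: "Lp_bounded_linear p M (shifted z A)"
    and surj: "\<And>w. w \<in> Lp p M \<Longrightarrow> \<exists>f\<in>Lp p M. AE x in M. shifted z A f x = w x"
    and bd: "\<And>f. f \<in> Lp p M \<Longrightarrow> Lp_norm p M f \<le> C * Lp_norm p M (shifted z A f)"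
  shows "z \<in> Lp_resolvent_set p M A"
proof -
  let ?Z = "shifted z A"
  note ZL = Lp_bounded_linear_Lp[OF Z]
  have inj: "AE x in M. f x = g x" if f: "f \<in> Lp p M" "g \<in> Lp p M" and eq: "AE x in M. ?Z f x = ?Z g x" for f g
  proof -
    have d: "(\<lambda>x. f x - g x) \<in> Lp p M" by (rule Lp_diff[OF f p])
    have "AE x in M. ?Z (\<lambda>x. f x - g x) x = 0"
      using Lp_bounded_linear_diff[OF Z f] eq by eventually_elim simp
    then have "Lp_norm p M (?Z (\<lambda>x. f x - g x)) = 0"
      using Lp_norm_eq_0_iff[OF ZL[OF d]] p by simp
    then have "Lp_norm p M (\<lambda>x. f x - g x) = 0" using bd[OF d] by (intro antisym) auto
    then show ?thesis using Lp_AE_eq_iff[OF f p] by simp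
  qed
  define R where "R = (\<lambda>w. SOME f. f \<in> Lp p M \<and> (AE x in M. ?Z f x = w x))"
  have R: "R w \<in> Lp p M" "AE x in M. ?Z (R w) x = w x" if "w \<in> Lp p M" for w
  proof -
    have "\<exists>f. f \<in> Lp p M \<and> (AE x in M. ?Z f x = w x)" using surj[OF that] by blast
    from someI_ex[OF this] show "R w \<in> Lp p M" "AE x in M. ?Z (R w) x = w x" by (auto simp: R_def)
  qed
  have "Lp_bounded_linear p M R"
    unfolding Lp_bounded_linear_def
  proof (intro conjI ballI allI exI[of _ C])
    fix f g assume f: "f \<in> Lp p M" and g: "g \<in> Lp p M"
    show "AE x in M. R (\<lambda>y. f y + g y) x = R f x + R g x"
    proof (rule inj[OF R(1) Lp_add[OF R(1) R(1) p]])
      show "AE x in M. ?Z (R (\<lambda>y. f y + g y)) x = ?Z (\<lambda>x. R f x + R g x) x"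
        using R(2)[OF Lp_add[OF f g p]] R(2)[OF f] R(2)[OF g] Lp_bounded_linear_add[OF Z R(1)[OF f] R(1)[OF g]]
        by eventually_elim simp
    qed (use f g Lp_add p in auto)
  next
    fix c f assume f: "f \<in> Lp p M"
    show "AE x in M. R (\<lambda>y. c * f y) x = c * R f x"
    proof (rule inj[OF R(1) Lp_scale[OF R(1)]])
      show "AE x in M. ?Z (R (\<lambda>y. c * f y)) x = ?Z (\<lambda>x. c * R f x) x"
        using R(2)[OF Lp_scale[OF f, of c]] R(2)[OF f] Lp_bounded_linear_scale[OF Z R(1)[OF f], of c]
        by eventually_elim simp
    qed (use f Lp_scale in auto)
  next
    fix f assume f: "f \<in> Lp p M"
    show "R f \<in> Lp p M" by (rule R(1)[OF f])
    have "Lp_norm p M (?Z (R f)) = Lp_norm p M f"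
      by (intro Lp_norm_cong_AE R(2) f Lp_measurable[OF ZL[OF R(1)[OF f]]] Lp_measurable[OF f])
    then show "Lp_norm p M (R f) \<le> C * Lp_norm p M f" using bd[OF R(1)[OF f]] by simp
  qed
  moreover have "AE x in M. R (?Z f) x = f x" if f: "f \<in> Lp p M" for f
    by (rule inj[OF R(1)[OF ZL[OF f]] f R(2)[OF ZL[OF f]]])
  ultimately show ?thesis
    using Z R(2) unfolding Lp_resolvent_set_def by blast
qed

lemma Lp_eigenvalue_in_spectrum:
  assumes p: "p \<ge> 1" and ev: "Lp_eigenvalue p M A z"
  shows "z \<in> Lp_spectrum p M A"
proof (rule ccontr)
  assume "z \<notin> Lp_spectrum p M A"
  then obtain R where R: "Lp_bounded_linear p M R" and Z: "Lp_bounded_linear p M (shifted z A)"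
    and inv: "\<And>f. f \<in> Lp p M \<Longrightarrow> AE x in M. R (shifted z A f) x = f x"
    by (auto simp: Lp_spectrum_def Lp_resolvent_set_def)
  obtain f where f: "f \<in> Lp p M" "\<not> (AE x in M. f x = 0)" "AE x in M. A f x = z * f x"
    using ev by (auto simp: Lp_eigenvalue_def Lp_eigenvector_def)
  have "AE x in M. shifted z A f x = 0" using f(3) by eventually_elim (simp add: shifted_def)
  from Lp_bounded_linear_cong_AE[OF R Lp_bounded_linear_Lp[OF Z f(1)] Lp_zero p this]
    Lp_bounded_linear_scale[OF R Lp_zero, of 0] inv[OF f(1)]
  have "AE x in M. f x = 0" by eventually_elim simp
  with f(2) show False by contradiction
qed

lemma Lp_bounded_linear_shifted:
  assumes A: "Lp_bounded_linear p M A" and p: "p \<ge> 1"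
  shows "Lp_bounded_linear p M (shifted z A)"
  unfolding Lp_bounded_linear_def
proof -
  obtain a where a: "a \<ge> 0" "\<And>f. f \<in> Lp p M \<Longrightarrow> Lp_norm p M (A f) \<le> a * Lp_norm p M f"
    using Lp_bounded_linear_bound[OF A] by blast
  note AL = Lp_bounded_linear_Lp[OF A]
  show "(\<forall>f\<in>Lp p M. shifted z A f \<in> Lp p M) \<and>
    (\<forall>f\<in>Lp p M. \<forall>g\<in>Lp p M. AE x in M. shifted z A (\<lambda>y. f y + g y) x = shifted z A f x + shifted z A g x) \<and>
    (\<forall>c. \<forall>f\<in>Lp p M. AE x in M. shifted z A (\<lambda>y. c * f y) x = c * shifted z A f x) \<and>
    (\<exists>B. \<forall>f\<in>Lp p M. Lp_norm p M (shifted z A f) \<le> B * Lp_norm p M f)"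
  proof (intro conjI ballI allI exI[of _ "norm z + a"])
    fix f assume f: "f \<in> Lp p M"
    show "shifted z A f \<in> Lp p M" unfolding shifted_def by (rule Lp_diff[OF Lp_scale[OF f] AL[OF f] p])
    have "Lp_norm p M (shifted z A f) \<le> Lp_norm p M (\<lambda>x. z * f x) + Lp_norm p M (A f)"
      unfolding shifted_def by (rule Lp_norm_triangle_diff[OF Lp_scale[OF f] AL[OF f] p])
    also have "\<dots> \<le> (norm z + a) * Lp_norm p M f" using a(2)[OF f] p by (simp add: Lp_norm_scale distrib_right)
    finally show "Lp_norm p M (shifted z A f) \<le> (norm z + a) * Lp_norm p M f" .
    show "AE x in M. shifted z A (\<lambda>y. c * f y) x = c * shifted z A f x" for c
      using Lp_bounded_linear_scale[OF A f, of c] by eventually_elim (simp add: shifted_def right_diff_distrib)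
    show "AE x in M. shifted z A (\<lambda>y. f y + g y) x = shifted z A f x + shifted z A g x" if "g \<in> Lp p M" for g
      using Lp_bounded_linear_add[OF A f that] by eventually_elim (simp add: shifted_def distrib_left)
  qed
qed

text \<open>\<open>\<rho>\<close> is half the distance from \<theta> to 1: for |z| >= 1 - \<rho> the
  resolvent bound is K / \<rho>, and the disk of radius \<rho> about 1 lies in that region.
  \<open>c\<close> is K / \<rho> times the factor 2 in the bound for the image of 1.
  \<open>small1\<close> makes the scalar map preserve the disk, and \<open>small2\<close> makes it
  contract by 1 / 2.\<close>

locale hole_contraction = hole_markov M T H + Lp_contraction M p "hole_markov.centered_hole M T H" K \<theta>
  for M :: "'a measure" and T H p K \<theta> +
  fixes \<rho> c :: real
  assumes \<theta>_less_1: "\<theta> < 1"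
  defines "\<rho> \<equiv> (1 - \<theta>) / 2" and "c \<equiv> 2 * K / \<rho>"
  assumes small1: "measure M H + c * measure M H powr (1 / p) \<le> \<rho>"
    and small2: "K / \<rho> * (c * measure M H powr (1 / p)) \<le> 1 / 2"
begin

lemma \<rho>: "\<rho> > 0" "\<rho> < 1" and c: "c > 0"
  using \<theta>_less_1 \<theta> K by (auto simp: \<rho>_def c_def)

text \<open>The functional of the rank-one part: \<open>hole\<close> is \<open>centered_hole\<close>
  plus \<nu> times the constant function 1.\<close>

definition \<nu> :: "('a \<Rightarrow> complex) \<Rightarrow> complex" where
  "\<nu> f = (\<integral>x. hole f x \<partial>M)"

lemma hole_eq: "hole f x = centered_hole f x + \<nu> f"
  by (simp add: centered_hole_def center_def \<nu>_def)

lemma Lp_bounded_linear_hole_p: "Lp_bounded_linear p M hole" by (rule Lp_bounded_linear_hole[OF p])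

lemma norm_\<nu>_le: "f \<in> Lp q M \<Longrightarrow> q \<ge> 1 \<Longrightarrow> norm (\<nu> f) \<le> Lp_norm q M f"
  unfolding \<nu>_def using norm_integral_le_Lp_norm[OF hole_Lp(1)] hole_Lp(2) by (meson order_trans)

lemma \<nu>_cong:
  assumes "f \<in> Lp p M" "g \<in> Lp p M" "AE x in M. f x = g x"
  shows "\<nu> f = \<nu> g"
  unfolding \<nu>_def using Lp_bounded_linear_cong_AE[OF Lp_bounded_linear_hole_p assms(1,2) p assms(3)] assms
  by (intro integral_cong_AE Lp_measurable[OF Lp_bounded_linear_Lp[OF Lp_bounded_linear_hole_p]]) auto

lemma \<nu>_add:
  assumes "f \<in> Lp p M" "g \<in> Lp p M"
  shows "\<nu> (\<lambda>x. f x + g x) = \<nu> f + \<nu> g"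
proof -
  note AL = Lp_bounded_linear_Lp[OF Lp_bounded_linear_hole_p]
  note i = Lp_integrable[OF AL[OF assms(1)] p] Lp_integrable[OF AL[OF assms(2)] p]
  have "\<nu> (\<lambda>x. f x + g x) = (\<integral>x. hole f x + hole g x \<partial>M)"
    unfolding \<nu>_def
    by (intro integral_cong_AE Lp_bounded_linear_add[OF Lp_bounded_linear_hole_p assms] Lp_measurable[OF AL[OF Lp_add[OF assms p]]]
        Lp_measurable[OF Lp_add[OF AL[OF assms(1)] AL[OF assms(2)] p]])
  then show ?thesis using i by (simp add: \<nu>_def)
qed

lemma \<nu>_scale:
  assumes "f \<in> Lp p M"
  shows "\<nu> (\<lambda>x. a * f x) = a * \<nu> f"
proof -
  note AL = Lp_bounded_linear_Lp[OF Lp_bounded_linear_hole_p]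
  have "\<nu> (\<lambda>x. a * f x) = (\<integral>x. a * hole f x \<partial>M)"
    unfolding \<nu>_def
    by (intro integral_cong_AE Lp_bounded_linear_scale[OF Lp_bounded_linear_hole_p assms] Lp_measurable[OF AL[OF Lp_scale[OF assms]]]
        Lp_measurable[OF Lp_scale[OF AL[OF assms]]])
  then show ?thesis by (simp add: \<nu>_def)
qed

lemma \<nu>_diff:
  assumes "f \<in> Lp p M" "g \<in> Lp p M"
  shows "\<nu> (\<lambda>x. f x - g x) = \<nu> f - \<nu> g"
  using \<nu>_add[OF assms(1) Lp_scale[OF assms(2), of "-1"]] \<nu>_scale[OF assms(2), of "-1"] by simp

lemma \<nu>_one: "\<nu> (\<lambda>_. 1) = 1 - complex_of_real h"
proof -
  have "\<nu> (\<lambda>_. 1) = (\<integral>x. cut (\<lambda>_. 1) x \<partial>M)"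
    unfolding \<nu>_def hole_def by (intro T_integral cut_integrable) simp
  also have "\<dots> = (\<integral>x. indicator (space M - H) x \<partial>M)" by (simp add: cut_def)
  also have "\<dots> = (\<integral>x. complex_of_real (indicator (space M - H) x) \<partial>M)" by (simp add: of_real_indicator)
  also have "\<dots> = complex_of_real (prob (space M - H))" by (simp only: integral_complex_of_real) simp
  also have "prob (space M - H) = 1 - h" by (rule prob_compl[OF H])
  finally show ?thesis by simp
qed

lemma integral_centered_hole: "f \<in> Lp p M \<Longrightarrow> (\<integral>x. centered_hole f x \<partial>M) = 0"
  using Lp_integrable[OF hole_Lp(1)[OF _ p] p] by (simp add: centered_hole_def center_def prob_space)

abbreviation B1 where "B1 \<equiv> centered_hole (\<lambda>_. 1)"

lemma B1_Lp: "B1 \<in> Lp q M" if "q \<ge> 1" for q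
  by (rule Lp_bounded_linear_Lp[OF Lp_bounded_linear_centered_hole[OF that] Lp_const])

text \<open>Chosen so that (z - centered_hole) (1 + err z) = z. Written as a correction to 1 it has
  a small right-hand side, the centered image of 1, and is therefore small itself.\<close>

definition err :: "complex \<Rightarrow> 'a \<Rightarrow> complex" where
  "err z = (SOME e. e \<in> Lp p M \<and> (AE x in M. z * e x - centered_hole e x = B1 x))"

lemma err:
  assumes "norm z > \<theta>"
  shows "err z \<in> Lp p M" "AE x in M. z * err z x - centered_hole (err z) x = B1 x"
proof -
  have "\<exists>e. e \<in> Lp p M \<and> (AE x in M. z * e x - centered_hole e x = B1 x)"
    using solution_exists[OF assms B1_Lp[OF p]] by metis
  from someI_ex[OF this] show "err z \<in> Lp p M" "AE x in M. z * err z x - centered_hole (err z) x = B1 x"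
    by (auto simp: err_def)
qed

lemma solution_norm_le':
  assumes z: "norm z \<ge> 1 - \<rho>" and e: "e \<in> Lp p M" "w \<in> Lp p M" "AE x in M. z * e x - centered_hole e x = w x"
  shows "Lp_norm p M e \<le> K / \<rho> * Lp_norm p M w"
proof -
  have z': "norm z - \<theta> \<ge> \<rho>" using z by (simp add: \<rho>_def field_simps)
  then have "norm z > \<theta>" using \<rho> by simp
  from solution_norm_le[OF this e] have "Lp_norm p M e \<le> K / (norm z - \<theta>) * Lp_norm p M w" .
  also have "\<dots> \<le> K / \<rho> * Lp_norm p M w"
    using z' \<rho> K by (intro mult_right_mono divide_left_mono) auto
  finally show ?thesis .
qed

lemma norm_gt: "norm z \<ge> 1 - \<rho> \<Longrightarrow> norm z > \<theta>"
  using \<rho> by (simp add: \<rho>_def field_simps)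

lemma err_norm_le:
  assumes z: "norm z \<ge> 1 - \<rho>"
  shows "Lp_norm p M (err z) \<le> c * h powr (1 / p)"
proof -
  have "Lp_norm p M (err z) \<le> K / \<rho> * Lp_norm p M B1"
    by (rule solution_norm_le'[OF z err(1)[OF norm_gt[OF z]] B1_Lp[OF p] err(2)[OF norm_gt[OF z]]])
  also have "\<dots> \<le> K / \<rho> * (2 * h powr (1 / p))"
    using K \<rho> by (intro mult_left_mono centered_hole_one p) auto
  finally show ?thesis by (simp add: c_def ac_simps)
qed

text \<open>Resolvent identity: err z - err z' solves the equation at z with right-hand side (z' -
  z) err z', which already carries the small factor.\<close>

lemma err_lipschitz:
  assumes z: "norm z \<ge> 1 - \<rho>" "norm z' \<ge> 1 - \<rho>"
  shows "norm (\<nu> (err z) - \<nu> (err z')) \<le> 1 / 2 * norm (z - z')"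
proof -
  note e = err[OF norm_gt[OF z(1)]] and e' = err[OF norm_gt[OF z(2)]]
  have d: "(\<lambda>x. err z x - err z' x) \<in> Lp p M" by (rule Lp_diff[OF e(1) e'(1) p])
  have w: "(\<lambda>x. (z' - z) * err z' x) \<in> Lp p M" by (rule Lp_scale[OF e'(1)])
  have "AE x in M. z * (err z x - err z' x) - centered_hole (\<lambda>x. err z x - err z' x) x = (z' - z) * err z' x"
    using e(2) e'(2) Lp_bounded_linear_diff[OF B e(1) e'(1)]
  proof eventually_elim
    case (elim x)
    have "centered_hole (err z) x = z * err z x - B1 x" by (simp add: elim(1)[symmetric])
    moreover have "centered_hole (err z') x = z' * err z' x - B1 x" by (simp add: elim(2)[symmetric])
    ultimately show ?case unfolding elim(3) by (simp only:) (simp add: algebra_simps)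
  qed
  from solution_norm_le'[OF z(1) d w this]
  have "Lp_norm p M (\<lambda>x. err z x - err z' x) \<le> K / \<rho> * (norm (z' - z) * Lp_norm p M (err z'))"
    using p by (simp add: Lp_norm_scale)
  also have "\<dots> \<le> K / \<rho> * (norm (z' - z) * (c * h powr (1 / p)))"
    using K \<rho> by (intro mult_left_mono err_norm_le z) auto
  also have "\<dots> = (K / \<rho> * (c * h powr (1 / p))) * norm (z - z')" by (simp add: norm_minus_commute)
  also have "\<dots> \<le> 1 / 2 * norm (z - z')" by (intro mult_right_mono small2) auto
  finally have "Lp_norm p M (\<lambda>x. err z x - err z' x) \<le> 1 / 2 * norm (z - z')" .
  moreover have "\<nu> (err z) - \<nu> (err z') = \<nu> (\<lambda>x. err z x - err z' x)"
    by (rule \<nu>_diff[OF e(1) e'(1), symmetric])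
  ultimately show ?thesis using norm_\<nu>_le[OF d p] by simp
qed

text \<open>
  For \<open>norm z > \<theta>\<close> the operator \<open>z - hole\<close> is a rank-one perturbation of the invertible
  \<open>z - centered_hole\<close>; it is singular exactly at the fixed points of \<open>\<Phi>\<close>.
\<close>

definition \<Phi> :: "complex \<Rightarrow> complex" where
  "\<Phi> z = 1 - complex_of_real h + \<nu> (err z)"

lemma \<Phi>_close:
  assumes "norm z \<ge> 1 - \<rho>"
  shows "norm (\<Phi> z - 1) \<le> h + c * h powr (1 / p)"
proof -
  have "norm (\<Phi> z - 1) = norm (\<nu> (err z) - complex_of_real h)" by (simp add: \<Phi>_def algebra_simps)
  also have "\<dots> \<le> norm (\<nu> (err z)) + h" using norm_triangle_ineq4[of "\<nu> (err z)" "complex_of_real h"] by simp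
  also have "norm (\<nu> (err z)) \<le> c * h powr (1 / p)"
    using norm_\<nu>_le[OF err(1)[OF norm_gt[OF assms]] p] err_norm_le[OF assms] by simp
  finally show ?thesis by simp
qed

lemma norm_ge_of_near_1: "norm (z - 1) \<le> \<rho> \<Longrightarrow> norm z \<ge> 1 - \<rho>" for z :: complex
  using norm_triangle_ineq2[of 1 z] by (simp add: norm_minus_commute)

lemma \<Phi>_fixpoint_ex: "\<exists>!z. z \<in> cball 1 \<rho> \<and> \<Phi> z = z"
proof -
  have near: "norm z \<ge> 1 - \<rho>" if "z \<in> cball 1 \<rho>" for z :: complex
    using that by (intro norm_ge_of_near_1) (simp add: dist_norm norm_minus_commute)
  have "\<exists>!z\<in>cball 1 \<rho>. \<Phi> z = z"
  proof (rule Banach_fix[OF iffD2[OF complete_eq_closed closed_cball]])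
    show "cball (1::complex) \<rho> \<noteq> {}" using \<rho> by simp
    show "\<Phi> ` cball 1 \<rho> \<subseteq> cball 1 \<rho>"
      using \<Phi>_close[OF near] small1 by (force simp: dist_norm norm_minus_commute)
    show "dist (\<Phi> x) (\<Phi> y) \<le> 1 / 2 * dist x y" if "x \<in> cball 1 \<rho>" "y \<in> cball 1 \<rho>" for x y
      using err_lipschitz[of x y] near that by (simp add: \<Phi>_def dist_norm)
  qed auto
  then show ?thesis by blast
qed

definition z0 :: complex where "z0 = (THE z. z \<in> cball 1 \<rho> \<and> \<Phi> z = z)"

lemma z0: "norm (z0 - 1) \<le> \<rho>" "\<Phi> z0 = z0"
  using theI'[OF \<Phi>_fixpoint_ex] by (auto simp: z0_def dist_norm norm_minus_commute)

text \<open>Values of \<Phi> on |z| >= 1 - \<rho> are within \<rho> of 1, so a fixed point there is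
  automatically in the disk of the contraction argument.\<close>

lemma \<Phi>_fixpoint_unique:
  assumes "norm z \<ge> 1 - \<rho>" "\<Phi> z = z"
  shows "z = z0"
proof -
  have "norm (z - 1) \<le> \<rho>" using \<Phi>_close[OF assms(1)] small1 assms(2) by simp
  then show ?thesis
    using \<Phi>_fixpoint_ex z0 assms(2) by (metis dist_commute dist_norm mem_cball)
qed

lemma z0_norm: "norm z0 \<ge> 1 - \<rho>" "norm z0 > \<theta>" "z0 \<noteq> 0"
  using norm_ge_of_near_1[OF z0(1)] norm_gt[of z0] \<rho> by auto

lemma z0_close: "norm (z0 - 1) \<le> h + c * h powr (1 / p)"
  using \<Phi>_close[OF z0_norm(1)] z0(2) by simp

text \<open>Inversion of a rank-one perturbation: with u the solution for the constant 1, every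
  solution for w has the form g + a u, and consistency a = \<nu> (g + a u) is solvable because 1 -
  \<nu> u = 1 - \<Phi> z / z is nonzero.\<close>

lemma hole_resolvent:
  assumes z: "norm z \<ge> 1 - \<rho>" "\<Phi> z \<noteq> z"
  shows "z \<in> Lp_resolvent_set p M hole"
proof -
  note zt = norm_gt[OF z(1)]
  note e = err[OF zt]
  have z0: "z \<noteq> 0" using zt \<theta> by auto
  \<comment> \<open>By the choice of \<open>err\<close> this solves (z - centered_hole) u =
    1.\<close>
  define u where "u = (\<lambda>x. (1 / z) * (1 + err z x))"
  have u: "u \<in> Lp p M" unfolding u_def by (intro Lp_scale Lp_add Lp_const e(1) p)
  have ue: "AE x in M. z * u x - centered_hole u x = 1"
    using e(2) Lp_bounded_linear_scale[OF B Lp_add[OF Lp_const[of 1] e(1) p], of "1 / z"] Lp_bounded_linear_add[OF B Lp_const[of 1] e(1)]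
  proof eventually_elim
    case (elim x)
    have "centered_hole u x = (1 / z) * (B1 x + centered_hole (err z) x)" unfolding u_def elim(2) elim(3) by simp
    also have "\<dots> = err z x" using elim(1) z0 by (simp add: field_simps)
    finally show ?case using z0 by (simp add: u_def)
  qed
  have lu: "\<nu> u = \<Phi> z / z"
    unfolding u_def using \<nu>_scale[OF Lp_add[OF Lp_const[of 1] e(1) p], of "1 / z"] \<nu>_add[OF Lp_const[of 1] e(1)]
    by (simp add: \<nu>_one \<Phi>_def)
  have F: "1 - \<nu> u \<noteq> 0" using z(2) z0 by (simp add: lu field_simps)
  let ?N = "Lp_norm p M"
  show ?thesis
  proof (rule Lp_resolvent_setI[OF p Lp_bounded_linear_shifted[OF Lp_bounded_linear_hole_p p]])
    fix w assume w: "w \<in> Lp p M"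
    obtain g where g: "g \<in> Lp p M" "AE x in M. z * g x - centered_hole g x = w x" by (rule solution_exists[OF zt w])
    define a where "a = \<nu> g / (1 - \<nu> u)"
    have au: "(\<lambda>x. a * u x) \<in> Lp p M" by (rule Lp_scale[OF u])
    let ?f = "\<lambda>x. g x + a * u x"
    have f: "?f \<in> Lp p M" by (rule Lp_add[OF g(1) au p])
    have lf: "\<nu> ?f = \<nu> g + a * \<nu> u" using \<nu>_add[OF g(1) au] \<nu>_scale[OF u] by simp
    have al: "a - (\<nu> g + a * \<nu> u) = 0" using F by (simp add: a_def field_simps)
    have "AE x in M. shifted z hole ?f x = w x"
      using g(2) ue Lp_bounded_linear_add[OF B g(1) au] Lp_bounded_linear_scale[OF B u, of a]
    proof eventually_elim
      case (elim x)
      have "shifted z hole ?f x = (z * g x - centered_hole g x) + a * (z * u x - centered_hole u x) - (\<nu> g + a * \<nu> u)"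
        unfolding shifted_def hole_eq lf elim(3) elim(4) by (simp add: algebra_simps)
      also have "\<dots> = w x + (a - (\<nu> g + a * \<nu> u))" unfolding elim(1) elim(2) by simp
      finally show ?case using al by simp
    qed
    with f show "\<exists>f\<in>Lp p M. AE x in M. shifted z hole f x = w x" by blast
  next
    fix f assume f: "f \<in> Lp p M"
    let ?w = "shifted z hole f"
    have w: "?w \<in> Lp p M" by (rule Lp_bounded_linear_Lp[OF Lp_bounded_linear_shifted[OF Lp_bounded_linear_hole_p p] f])
    obtain g where g: "g \<in> Lp p M" "AE x in M. z * g x - centered_hole g x = ?w x" by (rule solution_exists[OF zt w])
    have lu': "(\<lambda>x. \<nu> f * u x) \<in> Lp p M" by (rule Lp_scale[OF u])
    have gu: "(\<lambda>x. g x + \<nu> f * u x) \<in> Lp p M" by (rule Lp_add[OF g(1) lu' p])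
    \<comment> \<open>The given f solves the same equation as g + (\<nu> f) u, hence coincides with
      it; applying \<nu> determines \<nu> f from g.\<close>
    have "AE x in M. z * f x - centered_hole f x = z * (g x + \<nu> f * u x) - centered_hole (\<lambda>x. g x + \<nu> f * u x) x"
      using g(2) ue Lp_bounded_linear_add[OF B g(1) lu'] Lp_bounded_linear_scale[OF B u, of "\<nu> f"]
    proof eventually_elim
      case (elim x)
      have "z * (g x + \<nu> f * u x) - centered_hole (\<lambda>x. g x + \<nu> f * u x) x
         = (z * g x - centered_hole g x) + \<nu> f * (z * u x - centered_hole u x)"
        unfolding elim(3) elim(4) by (simp add: algebra_simps)
      also have "\<dots> = ?w x + \<nu> f" unfolding elim(1) elim(2) by simp
      finally show ?case by (simp add: shifted_def hole_eq)
    qed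
    from solution_unique[OF zt f gu this] have fg: "AE x in M. f x = g x + \<nu> f * u x" .
    have "\<nu> f = \<nu> (\<lambda>x. g x + \<nu> f * u x)" by (rule \<nu>_cong[OF f gu fg])
    also have "\<dots> = \<nu> g + \<nu> f * \<nu> u" unfolding \<nu>_add[OF g(1) lu'] \<nu>_scale[OF u] ..
    finally have lf: "\<nu> f = \<nu> g / (1 - \<nu> u)" using F by (simp add: field_simps)
    have ng: "?N g \<le> K / \<rho> * ?N ?w" by (rule solution_norm_le'[OF z(1) g(1) w g(2)])
    have "?N f = ?N (\<lambda>x. g x + \<nu> f * u x)"
      by (rule Lp_norm_cong_AE[OF Lp_measurable[OF f] Lp_measurable[OF gu] fg])
    also have "\<dots> \<le> ?N g + ?N (\<lambda>x. \<nu> f * u x)" by (rule Lp_norm_triangle[OF g(1) lu' p])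
    also have "?N (\<lambda>x. \<nu> f * u x) = norm (\<nu> g) / norm (1 - \<nu> u) * ?N u"
      by (subst Lp_norm_scale) (use p in \<open>simp_all add: lf norm_divide\<close>)
    also have "\<dots> \<le> ?N g / norm (1 - \<nu> u) * ?N u"
      by (intro mult_right_mono divide_right_mono norm_\<nu>_le[OF g(1) p]) auto
    also have "?N g + ?N g / norm (1 - \<nu> u) * ?N u = ?N g * (1 + ?N u / norm (1 - \<nu> u))" by (simp add: algebra_simps)
    also have "\<dots> \<le> (K / \<rho> * ?N ?w) * (1 + ?N u / norm (1 - \<nu> u))"
      by (intro mult_right_mono ng) auto
    finally show "?N f \<le> (K / \<rho> * (1 + ?N u / norm (1 - \<nu> u))) * ?N ?w" by (simp add: ac_simps)
  qed
qed

lemma hole_spectrum: "Lp_spectrum p M hole \<subseteq> cball 0 (1 - \<rho>) \<union> {z0}"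
proof
  fix z assume z: "z \<in> Lp_spectrum p M hole"
  show "z \<in> cball 0 (1 - \<rho>) \<union> {z0}"
  proof (rule ccontr)
    assume *: "z \<notin> cball 0 (1 - \<rho>) \<union> {z0}"
    then have n: "norm z \<ge> 1 - \<rho>" by simp
    then have "\<Phi> z \<noteq> z" using \<Phi>_fixpoint_unique * by blast
    from hole_resolvent[OF n this] z show False by (simp add: Lp_spectrum_def)
  qed
qed

lemma eigenvalue_unique:
  assumes "Lp_eigenvalue p M hole z" "norm z \<ge> 1 - \<rho>"
  shows "z = z0"
  using Lp_eigenvalue_in_spectrum[OF p assms(1)] hole_resolvent[OF assms(2)] \<Phi>_fixpoint_unique[OF assms(2)]
  by (auto simp: Lp_spectrum_def)

text \<open>At the fixed point \<nu> of this function is z0, which is the condition for the rank-one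
  part to turn the centered equation into an eigenvalue equation.\<close>

definition \<psi> :: "'a \<Rightarrow> complex" where "\<psi> = (\<lambda>x. 1 + err z0 x)"

lemma \<psi>_Lp: "\<psi> \<in> Lp p M"
  unfolding \<psi>_def by (rule Lp_add[OF Lp_const err(1)[OF z0_norm(2)] p])

lemma centered_hole_\<psi>: "AE x in M. z0 * \<psi> x - centered_hole \<psi> x = z0"
  using err(2)[OF z0_norm(2)] Lp_bounded_linear_add[OF B Lp_const[of 1] err(1)[OF z0_norm(2)]]
proof eventually_elim
  case (elim x)
  have "centered_hole \<psi> x = B1 x + centered_hole (err z0) x" unfolding \<psi>_def elim(2) ..
  then show ?case using elim(1) by (simp add: \<psi>_def algebra_simps)
qed

lemma \<nu>_\<psi>: "\<nu> \<psi> = z0"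
  unfolding \<psi>_def using \<nu>_add[OF Lp_const[of 1] err(1)[OF z0_norm(2)]] z0(2) by (simp add: \<nu>_one \<Phi>_def)

lemma hole_\<psi>: "AE x in M. hole \<psi> x = z0 * \<psi> x"
  using centered_hole_\<psi> by eventually_elim (simp add: hole_eq \<nu>_\<psi> algebra_simps)

text \<open>The range of \<open>centered_hole\<close> has mean 0, so z0 times the mean of
  \<open>err z0\<close> vanishes, and z0 is nonzero.\<close>

lemma integral_\<psi>: "(\<integral>x. \<psi> x \<partial>M) = 1"
proof -
  let ?e = "err z0"
  note e = err[OF z0_norm(2)]
  have Be: "centered_hole ?e \<in> Lp p M" by (rule Lp_bounded_linear_Lp[OF B e(1)])
  note i = Lp_integrable[OF e(1) p] Lp_integrable[OF Be p] Lp_integrable[OF B1_Lp[OF p] p]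
  have "(\<integral>x. z0 * ?e x \<partial>M) = (\<integral>x. B1 x + centered_hole ?e x \<partial>M)"
  proof (rule integral_cong_AE)
    show "AE x in M. z0 * ?e x = B1 x + centered_hole ?e x"
      using e(2) by eventually_elim (simp add: algebra_simps)
  qed (use i in auto)
  also have "\<dots> = 0" using i integral_centered_hole[OF e(1)] integral_centered_hole[OF Lp_const] by simp
  finally have "(\<integral>x. ?e x \<partial>M) = 0" using z0_norm(3) by simp
  then show ?thesis using i(1) by (simp add: \<psi>_def prob_space)
qed

lemma \<psi>_eigenvector: "Lp_eigenvector p M hole z0 \<psi>"
  unfolding Lp_eigenvector_def
proof (intro conjI \<psi>_Lp hole_\<psi> notI)
  assume "AE x in M. \<psi> x = 0"
  then have "(\<integral>x. \<psi> x \<partial>M) = (\<integral>x. 0 \<partial>M)"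
    by (intro integral_cong_AE Lp_measurable[OF \<psi>_Lp]) auto
  then show False using integral_\<psi> by simp
qed

lemma \<psi>_close: "Lp_norm p M (\<lambda>x. \<psi> x - 1) \<le> c * h powr (1 / p)"
  using err_norm_le[OF z0_norm(1)] by (simp add: \<psi>_def)

text \<open>The heart of algebraic simplicity: no Jordan chain sits above \<psi>. Solving the
  centered equation gives f = b \<psi> + a d, and applying \<nu> leaves a (1 + \<nu> d) = 0. With a
  = 0 it also identifies the eigenspace.\<close>

lemma hole_preimage_\<psi>:
  assumes f: "f \<in> Lp p M" and eq: "AE x in M. z0 * f x - hole f x = a * \<psi> x"
  shows "a = 0" "AE x in M. f x = \<nu> f / z0 * \<psi> x"
proof -
  obtain d where d: "d \<in> Lp p M" "AE x in M. z0 * d x - centered_hole d x = err z0 x"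
    by (rule solution_exists[OF z0_norm(2) err(1)[OF z0_norm(2)]])
  define b where "b = (a + \<nu> f) / z0"
  have ad: "(\<lambda>x. a * d x) \<in> Lp p M" and b\<psi>: "(\<lambda>x. b * \<psi> x) \<in> Lp p M" by (rule Lp_scale[OF d(1)] Lp_scale[OF \<psi>_Lp])+
  have s: "(\<lambda>x. b * \<psi> x + a * d x) \<in> Lp p M" by (rule Lp_add[OF b\<psi> ad p])
  have "AE x in M. z0 * f x - centered_hole f x = z0 * (b * \<psi> x + a * d x) - centered_hole (\<lambda>x. b * \<psi> x + a * d x) x"
    using eq d(2) centered_hole_\<psi> Lp_bounded_linear_add[OF B b\<psi> ad] Lp_bounded_linear_scale[OF B \<psi>_Lp, of b]
      Lp_bounded_linear_scale[OF B d(1), of a]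
  proof eventually_elim
    case (elim x)
    have "z0 * (b * \<psi> x + a * d x) - centered_hole (\<lambda>x. b * \<psi> x + a * d x) x
        = b * (z0 * \<psi> x - centered_hole \<psi> x) + a * (z0 * d x - centered_hole d x)"
      unfolding elim(4) elim(5) elim(6) by (simp add: algebra_simps)
    also have "\<dots> = (a + \<nu> f) + a * err z0 x"
      unfolding elim(2) elim(3) using z0_norm(3) by (simp add: b_def)
    also have "\<dots> = a * \<psi> x + \<nu> f" by (simp add: \<psi>_def algebra_simps)
    also have "\<dots> = z0 * f x - centered_hole f x" unfolding elim(1)[symmetric] by (simp add: hole_eq)
    finally show ?case ..
  qed
  from solution_unique[OF z0_norm(2) f s this] have fs: "AE x in M. f x = b * \<psi> x + a * d x" .
  have "\<nu> f = \<nu> (\<lambda>x. b * \<psi> x + a * d x)" by (rule \<nu>_cong[OF f s fs])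
  also have "\<dots> = b * z0 + a * \<nu> d" unfolding \<nu>_add[OF b\<psi> ad] \<nu>_scale[OF \<psi>_Lp] \<nu>_scale[OF d(1)] \<nu>_\<psi> ..
  also have "\<dots> = a + \<nu> f + a * \<nu> d" using z0_norm(3) by (simp add: b_def)
  finally have "a * (1 + \<nu> d) = 0" by (simp add: distrib_left)
  \<comment> \<open>Formally this is 1 minus the derivative of \<Phi> at z0, so it is the
    contraction property again that excludes 0.\<close>
  moreover have "1 + \<nu> d \<noteq> 0"
  proof -
    have "norm (\<nu> d) \<le> Lp_norm p M d" by (rule norm_\<nu>_le[OF d(1) p])
    also have "\<dots> \<le> K / \<rho> * Lp_norm p M (err z0)"
      by (rule solution_norm_le'[OF z0_norm(1) d(1) err(1)[OF z0_norm(2)] d(2)])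
    also have "\<dots> \<le> K / \<rho> * (c * h powr (1 / p))"
      using K \<rho> by (intro mult_left_mono err_norm_le z0_norm) auto
    also have "\<dots> \<le> 1 / 2" by (rule small2)
    finally have "norm (\<nu> d) < 1" by simp
    then show ?thesis by (metis add_eq_0_iff norm_minus_cancel norm_one order_less_irrefl)
  qed
  ultimately show a: "a = 0" by simp
  show "AE x in M. f x = \<nu> f / z0 * \<psi> x" using fs by eventually_elim (simp add: a b_def)
qed

lemma generalized_eigenvector:
  assumes "f \<in> Lp p M" "AE x in M. (shifted z0 hole ^^ k) f x = 0"
  shows "\<exists>a. AE x in M. f x = a * \<psi> x"
  using assms
proof (induction k arbitrary: f)
  case 0
  then show ?case by (auto intro: exI[of _ 0])
next
  case (Suc k)
  have Z: "shifted z0 hole f \<in> Lp p M"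
    by (rule Lp_bounded_linear_Lp[OF Lp_bounded_linear_shifted[OF Lp_bounded_linear_hole_p p] Suc.prems(1)])
  obtain a where "AE x in M. shifted z0 hole f x = a * \<psi> x"
    using Suc.IH[OF Z] Suc.prems(2) by (auto simp: funpow_swap1)
  then have "AE x in M. z0 * f x - hole f x = a * \<psi> x" by (simp add: shifted_def)
  from hole_preimage_\<psi>(2)[OF Suc.prems(1) this] show ?case by blast
qed

lemma simple_eigenvalue: "Lp_simple_eigenvalue p M hole z0"
  unfolding Lp_simple_eigenvalue_def
proof (intro conjI bexI[of _ \<psi>] ballI)
  show "Lp_eigenvalue p M hole z0" using \<psi>_eigenvector by (auto simp: Lp_eigenvalue_def)
  show "\<not> (AE x in M. \<psi> x = 0)" using \<psi>_eigenvector by (simp add: Lp_eigenvector_def)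
  show "\<exists>a. AE x in M. g x = a * \<psi> x" if "g \<in> Lp_generalized_eigenspace p M hole z0" for g
    using that generalized_eigenvector by (auto simp: Lp_generalized_eigenspace_def)
  show "\<psi> \<in> Lp_generalized_eigenspace p M hole z0"
    unfolding Lp_generalized_eigenspace_def using \<psi>_Lp hole_\<psi>
    by (auto simp: shifted_def intro!: exI[of _ 1])
qed

end

section \<open>Positivity of the eigenfunction\<close>

lemma (in markov_op) T_cnj:
  assumes f: "integrable M f"
  shows "AE x in M. T (\<lambda>x. cnj (f x)) x = cnj (T f x)"
proof -
  have i: "integrable M (\<lambda>x. cnj (f x))" using f by simp
  from T_Complex[OF i] T_Complex[OF f] Tr_scale[OF integrable_Im[OF f], of "-1"]
  show ?thesis by eventually_elim (simp add: complex_eq_iff)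
qed

context hole_contraction begin

lemma hole_cnj:
  assumes f: "f \<in> Lp p M"
  shows "AE x in M. hole (\<lambda>x. cnj (f x)) x = cnj (hole f x)"
proof -
  have "cut (\<lambda>x. cnj (f x)) = (\<lambda>x. cnj (cut f x))" by (auto simp: cut_def indicator_def)
  then show ?thesis
    using T_cnj[OF cut_integrable[OF Lp_integrable[OF f p]]] by (simp add: hole_def)
qed

lemma cnj_Lp: "f \<in> Lp q M \<Longrightarrow> (\<lambda>x. cnj (f x)) \<in> Lp q M"
proof -
  have "cnj \<in> borel_measurable borel" by (intro borel_measurable_continuous_onI continuous_intros)
  then show "f \<in> Lp q M \<Longrightarrow> (\<lambda>x. cnj (f x)) \<in> Lp q M" by (auto simp: Lp_def)
qed

lemma cnj_\<psi>_eigenvector: "Lp_eigenvector p M hole (cnj z0) (\<lambda>x. cnj (\<psi> x))"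
  unfolding Lp_eigenvector_def
proof (intro conjI cnj_Lp \<psi>_Lp)
  show "\<not> (AE x in M. cnj (\<psi> x) = 0)" using \<psi>_eigenvector by (simp add: Lp_eigenvector_def)
  show "AE x in M. hole (\<lambda>x. cnj (\<psi> x)) x = cnj z0 * cnj (\<psi> x)"
    using hole_cnj[OF \<psi>_Lp] hole_\<psi> by eventually_elim simp
qed

text \<open>The conjugate is an eigenvalue of equal modulus, and there is only one eigenvalue in
  that region.\<close>

lemma z0_real: "cnj z0 = z0"
  using cnj_\<psi>_eigenvector z0_norm by (intro eigenvalue_unique) (auto simp: Lp_eigenvalue_def)

lemma z0_Re: "z0 = complex_of_real (Re z0)" "Re z0 \<ge> 1 - (h + c * h powr (1 / p))"
proof -
  show "z0 = complex_of_real (Re z0)" using arg_cong[OF z0_real, of Im] by (simp add: complex_eq_iff)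
  have "\<bar>Re (z0 - 1)\<bar> \<le> h + c * h powr (1 / p)" using z0_close abs_Re_le_cmod order_trans by blast
  then show "Re z0 \<ge> 1 - (h + c * h powr (1 / p))" by simp
qed

text \<open>The conjugate of \<psi> lies in the same one-dimensional eigenspace, and both have
  integral 1.\<close>

lemma \<psi>_real: "AE x in M. Im (\<psi> x) = 0"
proof -
  have L: "(\<lambda>x. cnj (\<psi> x)) \<in> Lp p M" by (rule cnj_Lp[OF \<psi>_Lp])
  have "AE x in M. z0 * cnj (\<psi> x) - hole (\<lambda>x. cnj (\<psi> x)) x = 0 * \<psi> x"
    using cnj_\<psi>_eigenvector by (auto simp: Lp_eigenvector_def z0_real)
  from hole_preimage_\<psi>(2)[OF L this]
  obtain a where a: "AE x in M. cnj (\<psi> x) = a * \<psi> x" by blast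
  have "(\<integral>x. cnj (\<psi> x) \<partial>M) = (\<integral>x. a * \<psi> x \<partial>M)"
    by (intro integral_cong_AE a Lp_measurable[OF L] Lp_measurable[OF Lp_scale[OF \<psi>_Lp]])
  then have "a = 1" using integral_\<psi> by simp
  with a show ?thesis by (auto elim!: eventually_mono simp: complex_eq_iff)
qed

lemma hole_mono:
  assumes f: "f \<in> Lp p M" and g: "g \<in> Lp p M" and le: "AE x in M. g x - f x \<in> \<real>\<^sub>\<ge>\<^sub>0"
  shows "AE x in M. hole g x - hole f x \<in> \<real>\<^sub>\<ge>\<^sub>0"
proof -
  have i: "integrable M (\<lambda>x. g x - f x)" using Lp_integrable[OF f p] Lp_integrable[OF g p] by simp
  have "AE x in M. cut (\<lambda>x. g x - f x) x \<in> \<real>\<^sub>\<ge>\<^sub>0"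
    using le by eventually_elim (auto simp: cut_def indicator_def)
  from T_nonneg[OF cut_integrable[OF i] this] Lp_bounded_linear_diff[OF Lp_bounded_linear_hole_p g f]
  show ?thesis by eventually_elim (simp add: hole_def)
qed

text \<open>
  The negative part \<open>v\<close> of \<open>\<psi>\<close> satisfies \<open>z0 v \<le> hole v\<close> and lives on a set of small measure;
  truncation of \<open>hole\<^sup>n v\<close> shows that this is only possible for \<open>v = 0\<close>.
\<close>

lemma \<psi>_nonneg:
  assumes t: "t > 0"
    and trunc: "\<And>f F :: 'a \<Rightarrow> complex. f \<in> Lp p M \<Longrightarrow> Lp_norm p M f \<le> 1 \<Longrightarrow> F \<in> borel_measurable M \<Longrightarrow>
      AE x in M. norm (F x) \<le> markov_op.Tr (T ^^ n) (\<lambda>x. norm (f x)) x \<Longrightarrow>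
      (\<lambda>x. if norm (F x) \<le> t then 0 else F x) \<in> Lp p M \<and>
      Lp_norm p M (\<lambda>x. if norm (F x) \<le> t then 0 else F x) \<le> 1 / 4"
    and small3: "t * (c * h powr (1 / p)) \<le> 1 / 8"
    and small4: "real n * (h + c * h powr (1 / p)) \<le> 1 / 4"
  shows "AE x in M. \<psi> x \<in> \<real>\<^sub>\<ge>\<^sub>0"
proof -
  note [measurable] = \<psi>_Lp
  define s where "s = Re z0"
  have z0s: "z0 = complex_of_real s" using z0_Re(1) by (simp add: s_def)
  have s0: "s > 0"
  proof -
    have "s \<ge> 1 - \<rho>" using z0_Re(2) small1 by (simp add: s_def)
    then show ?thesis using \<rho> by simp
  qed
  define v where "v = (\<lambda>x. complex_of_real (max 0 (- Re (\<psi> x))))"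
  have vm: "v \<in> borel_measurable M" unfolding v_def by measurable
  have vL: "v \<in> Lp p M"
    by (rule Lp_dominated(1)[OF \<psi>_Lp vm])
       (use p abs_Re_le_cmod in \<open>auto simp: v_def max_def intro: order_trans[OF abs_ge_minus_self]\<close>)
  have vpos: "v x \<in> \<real>\<^sub>\<ge>\<^sub>0" for x by (simp add: v_def complex_nonneg_Reals_iff)
  have v\<psi>: "(\<lambda>x. v x + \<psi> x) \<in> Lp p M" by (rule Lp_add[OF vL \<psi>_Lp p])
  \<comment> \<open>Where \<psi> < 0 one has v = - \<psi>, and positivity applied to v + \<psi>, the
    positive part, gives hole v >= - z0 \<psi>. Elsewhere v = 0.\<close>
  have step: "AE x in M. hole v x - z0 * v x \<in> \<real>\<^sub>\<ge>\<^sub>0"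
  proof -
    have "AE x in M. v x - 0 \<in> \<real>\<^sub>\<ge>\<^sub>0" using vpos by simp
    from hole_mono[OF Lp_zero vL this] Lp_bounded_linear_scale[OF Lp_bounded_linear_hole_p Lp_zero, of 0]
    have 1: "AE x in M. hole v x \<in> \<real>\<^sub>\<ge>\<^sub>0" by eventually_elim simp
    have "AE x in M. (v x + \<psi> x) - 0 \<in> \<real>\<^sub>\<ge>\<^sub>0"
      using \<psi>_real by eventually_elim (auto simp: v_def complex_nonneg_Reals_iff max_def)
    from hole_mono[OF Lp_zero v\<psi> this] Lp_bounded_linear_scale[OF Lp_bounded_linear_hole_p Lp_zero, of 0] Lp_bounded_linear_add[OF Lp_bounded_linear_hole_p vL \<psi>_Lp] hole_\<psi>
    have 2: "AE x in M. hole v x + z0 * \<psi> x \<in> \<real>\<^sub>\<ge>\<^sub>0" by eventually_elim simp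
    from 1 2 show ?thesis
    proof eventually_elim
      case (elim x)
      show ?case
      proof (cases "Re (\<psi> x) \<ge> 0")
        case True
        then show ?thesis using elim(1) by (simp add: v_def)
      next
        case False
        then show ?thesis using elim by (simp add: v_def complex_nonneg_Reals_iff z0s)
      qed
    qed
  qed
  have iter: "AE x in M. (hole ^^ k) v x - z0 ^ k * v x \<in> \<real>\<^sub>\<ge>\<^sub>0" for k
  proof (induction k)
    case (Suc k)
    have hk: "(hole ^^ k) v \<in> Lp p M" using hole_funpow_Lp[OF vL p] by simp
    from hole_mono[OF Lp_scale[OF vL] hk Suc] Lp_bounded_linear_scale[OF Lp_bounded_linear_hole_p vL, of "z0 ^ k"] step
    show ?case
    proof eventually_elim
      case (elim x)
      have "z0 ^ k * (hole v x - z0 * v x) \<in> \<real>\<^sub>\<ge>\<^sub>0"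
        using elim(3) s0 by (auto simp: z0s complex_nonneg_Reals_iff simp flip: of_real_power)
      with elim(1,2) show ?case
        by (auto simp: complex_nonneg_Reals_iff algebra_simps)
    qed
  qed simp
  define E where "E = {x \<in> space M. Re (\<psi> x) < 0}"
  have E[measurable]: "E \<in> sets M" unfolding E_def by measurable
  have iE: "(indicator E :: 'a \<Rightarrow> complex) \<in> Lp p M" by (rule Lp_bounded(1)[where c=1]) (use p in \<open>auto simp: indicator_def\<close>)
  \<comment> \<open>|\<psi> - 1| exceeds 1 where \<psi> is negative, so closeness to 1 makes this
    set small.\<close>
  have NE: "Lp_norm p M (indicator E) \<le> c * h powr (1 / p)"
  proof -
    have "norm (indicator E x :: complex) \<le> norm (\<psi> x - 1)" for x
      using abs_Re_le_cmod[of "\<psi> x - 1"] by (auto simp: indicator_def E_def)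
    then have "Lp_norm p M (indicator E) \<le> Lp_norm p M (\<lambda>x. \<psi> x - 1)"
      using p by (intro Lp_dominated(2)[OF Lp_diff[OF \<psi>_Lp Lp_const p]]) auto
    with \<psi>_close show ?thesis by simp
  qed
  let ?F = "(hole ^^ n) v"
  have "Lp_norm p M v = 0"
  proof (rule ccontr)
    assume "Lp_norm p M v \<noteq> 0"
    define r where "r = Lp_norm p M v"
    have r: "r > 0" using \<open>Lp_norm p M v \<noteq> 0\<close> by (simp add: r_def order_less_le)
    let ?a = "complex_of_real (1 / r)"
    define f where "f = (\<lambda>x. ?a * v x)"
    have fL: "f \<in> Lp p M" unfolding f_def by (rule Lp_scale[OF vL])
    have f1: "Lp_norm p M f = 1"
      unfolding f_def using p r by (subst Lp_norm_scale) (auto simp: r_def norm_divide)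
    let ?G = "(hole ^^ n) f"
    have GL: "?G \<in> Lp p M" using hole_funpow_Lp[OF fL p] by simp
    have Gv: "AE x in M. ?G x = ?a * ?F x"
      unfolding f_def by (rule Lp_bounded_linear_scale[OF Lp_bounded_linear_funpow[OF Lp_bounded_linear_hole_p p] vL])
    let ?G1 = "\<lambda>x. complex_of_real t * indicator E x" and ?G2 = "\<lambda>x. if norm (?G x) \<le> t then 0 else ?G x"
    have G2: "?G2 \<in> Lp p M" "Lp_norm p M ?G2 \<le> 1 / 4"
      using trunc[OF fL _ Lp_measurable[OF GL] hole_funpow_norm_le[OF Lp_integrable[OF fL p]]] f1 by auto
    have G2n: "(\<lambda>x. complex_of_real (norm (?G2 x))) \<in> Lp p M" using G2(1) by (auto simp: Lp_def)
    have G1: "?G1 \<in> Lp p M" by (rule Lp_scale[OF iE])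
    \<comment> \<open>f lives on \<open>E\<close>, and its n-th image is at least z0^n f in modulus;
      on \<open>E\<close> that image is at most t plus its large part.\<close>
    have fE: "AE x in M. norm (z0 ^ n * f x) \<le> norm (?G1 x + complex_of_real (norm (?G2 x)))"
      using iter[of n] Gv AE_space
    proof eventually_elim
      case (elim x)
      have le: "norm (z0 ^ n * f x) \<le> norm (?G x)"
      proof -
        have "s ^ n * Re (v x) \<le> Re (?F x)"
          using elim(1) by (simp add: z0s complex_nonneg_Reals_iff flip: of_real_power)
        then have "s ^ n * Re (v x) \<le> norm (?F x)" using complex_Re_le_cmod order_trans by blast
        moreover have "norm (z0 ^ n * v x) = s ^ n * Re (v x)"
          using s0 by (simp add: z0s norm_mult norm_power v_def)
        ultimately have "norm (z0 ^ n * v x) \<le> norm (?F x)" by simp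
        then have "norm ?a * norm (z0 ^ n * v x) \<le> norm ?a * norm (?F x)" by (intro mult_left_mono) auto
        moreover have "norm (?G x) = norm ?a * norm (?F x)" by (simp only: elim(2) norm_mult)
        moreover have "norm (z0 ^ n * f x) = norm ?a * norm (z0 ^ n * v x)"
          by (simp only: f_def norm_mult mult.left_commute)
        ultimately show ?thesis by (simp only:)
      qed
      show ?case
      proof (cases "x \<in> E")
        case True
        have "norm (?G x) \<le> t + norm (?G2 x)" using t by auto
        also have "\<dots> = norm (?G1 x + complex_of_real (norm (?G2 x)))"
        proof -
          have "?G1 x + complex_of_real (norm (?G2 x)) = complex_of_real (t + norm (?G2 x))" using True by simp
          then show ?thesis using t by (simp only: norm_of_real) auto
        qed
        finally show ?thesis using le by simp
      next
        case False
        then have "f x = 0" using elim(3) by (auto simp: f_def v_def E_def)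
        then show ?thesis by simp
      qed
    qed
    have "s ^ n = Lp_norm p M (\<lambda>x. z0 ^ n * f x)"
      using p s0 f1 by (subst Lp_norm_scale) (auto simp: z0s norm_power)
    also have "\<dots> \<le> Lp_norm p M (\<lambda>x. ?G1 x + complex_of_real (norm (?G2 x)))"
      using p by (intro Lp_dominated(2)[OF Lp_add[OF G1 G2n p] Lp_measurable[OF Lp_scale[OF fL]] fE]) simp
    also have "\<dots> \<le> Lp_norm p M ?G1 + Lp_norm p M (\<lambda>x. complex_of_real (norm (?G2 x)))"
      by (rule Lp_norm_triangle[OF G1 G2n p])
    also have "Lp_norm p M (\<lambda>x. complex_of_real (norm (?G2 x))) = Lp_norm p M ?G2" by (rule Lp_norm_cong) simp
    also have "Lp_norm p M ?G1 \<le> 1 / 8"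
    proof -
      have "Lp_norm p M ?G1 = t * Lp_norm p M (indicator E)" using p t by (subst Lp_norm_scale) auto
      also have "\<dots> \<le> t * (c * h powr (1 / p))" using NE t by (intro mult_left_mono) auto
      finally show ?thesis using small3 by simp
    qed
    also have "1 / 8 + Lp_norm p M ?G2 < 3 / 4" using G2(2) by simp
    \<comment> \<open>Bernoulli keeps s^n at 3 / 4 or more, against at most 1 / 8 + 1 / 4 on the
      other side.\<close>
    also have "3 / 4 \<le> s ^ n"
    proof -
      have "3 / 4 \<le> 1 + real n * (s - 1)"
      proof -
        have "real n * (1 - s) \<le> real n * (h + c * h powr (1 / p))"
          using z0_Re(2) by (intro mult_left_mono) (auto simp: s_def)
        then show ?thesis using small4 by (simp add: algebra_simps)
      qed
      also have "\<dots> \<le> (1 + (s - 1)) ^ n" using s0 by (intro Bernoulli_inequality) simp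
      finally show ?thesis by simp
    qed
    finally show False by simp
  qed
  then have "AE x in M. v x = 0" using Lp_norm_eq_0_iff[OF vL] p by simp
  with \<psi>_real show ?thesis
    by eventually_elim (auto simp: v_def complex_nonneg_Reals_iff max_def split: if_splits)
qed

text \<open>No second fixed point is needed: \<open>err z0\<close> lies in L^q and solves the same
  equation there, so the L^q estimate applies to it. The gain is that the right-hand side has L^q
  norm of order h^(1/q), better than h^(1/p).\<close>

lemma z0_close_exponent:
  assumes q: "1 \<le> q" "q \<le> p" and con: "Lp_contraction M q centered_hole Kq \<theta>q" and \<theta>q: "\<theta>q < 1"
    and small: "h + c * h powr (1 / p) \<le> (1 - \<theta>q) / 2"
  shows "norm (z0 - 1) \<le> h + 2 * Kq / ((1 - \<theta>q) / 2) * h powr (1 / q)"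
proof -
  interpret q: Lp_contraction M q centered_hole Kq \<theta>q by fact
  have "norm (z0 - 1) \<le> (1 - \<theta>q) / 2" using z0_close small by simp
  moreover have "1 - norm (z0 - 1) \<le> norm z0"
    using norm_triangle_ineq2[of 1 z0] by (simp add: norm_minus_commute)
  ultimately have z: "norm z0 - \<theta>q \<ge> (1 - \<theta>q) / 2" by (simp add: field_simps)
  then have z': "norm z0 > \<theta>q" using \<theta>q by simp
  note e = err[OF z0_norm(2)]
  have eq: "err z0 \<in> Lp q M" using Lp_mono(1)[OF e(1)] q by simp
  have "norm (\<nu> (err z0)) \<le> Lp_norm q M (err z0)" by (rule norm_\<nu>_le[OF eq q(1)])
  also have "\<dots> \<le> Kq / (norm z0 - \<theta>q) * Lp_norm q M B1"
    by (rule q.solution_norm_le[OF z' eq B1_Lp[OF q(1)] e(2)])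
  also have "\<dots> \<le> Kq / ((1 - \<theta>q) / 2) * (2 * h powr (1 / q))"
    using z z' \<theta>q q.K centered_hole_one[OF q(1)] by (intro mult_mono divide_left_mono) auto
  finally have l: "norm (\<nu> (err z0)) \<le> 2 * Kq / ((1 - \<theta>q) / 2) * h powr (1 / q)" by (simp add: ac_simps)
  have "1 - complex_of_real h + \<nu> (err z0) = z0" using z0(2) by (simp add: \<Phi>_def)
  then have "z0 - 1 = (1 - complex_of_real h + \<nu> (err z0)) - 1" by (simp only:)
  then have "norm (z0 - 1) = norm (\<nu> (err z0) - complex_of_real h)" by simp
  also have "\<dots> \<le> norm (\<nu> (err z0)) + h" using norm_triangle_ineq4[of "\<nu> (err z0)" "complex_of_real h"] by simp
  finally show ?thesis using l by simp
qed

end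

section \<open>Choice of the constants\<close>

lemma tendsto_powr_at_right_0:
  fixes a c :: real
  assumes "a > 0"
  shows "((\<lambda>x. c * x powr a) \<longlongrightarrow> 0) (at_right 0)"
proof -
  have "((\<lambda>x::real. x powr a) \<longlongrightarrow> 0 powr a) (at_right 0)"
    using assms by (intro tendsto_powr' tendsto_const tendsto_ident_at)
      (auto intro!: eventually_mono[OF eventually_at_right_less])
  then have "((\<lambda>x::real. c * x powr a) \<longlongrightarrow> c * 0 powr a) (at_right 0)" by (rule tendsto_mult_left)
  then show ?thesis by simp
qed

text \<open>The order of quantifiers carries the content: \<theta> depends on p only, \<delta> and
  the two constants may depend on \<epsilon>, and all precede the space and the hole.\<close>

lemma uniform_hole_spectrum:
  assumes \<kappa>: "\<kappa> \<longlonglongrightarrow> 0" "\<And>n. \<kappa> n \<ge> 0" and p: "p > 1"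
  shows "\<exists>\<theta>::real. 0 < \<theta> \<and> \<theta> < 1 \<and>
    (\<forall>\<epsilon>::real. 0 < \<epsilon> \<and> \<epsilon> < 1 / p \<longrightarrow>
      (\<exists>\<delta>>0. \<exists>C' Cbar::real. C' > 0 \<and> Cbar > 0 \<and>
        (\<forall>(M :: 'a measure) T H. gap_markov \<kappa> M T \<and> H \<in> sets M \<and> measure M H \<le> \<delta> \<longrightarrow>
          (let A = hole_markov.hole M T H; h = measure M H; D = cball 1 (Cbar * h powr (1 - \<epsilon>))
           in Lp_spectrum p M A \<subseteq> cball 0 \<theta> \<union> D \<and>
               (\<exists>z0\<in>D. Lp_simple_eigenvalue p M A z0 \<and>
                  (\<forall>z\<in>D. Lp_eigenvalue p M A z \<longrightarrow> z = z0) \<and>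
                  (\<exists>\<psi>. Lp_eigenvector p M A z0 \<psi> \<and>
                     (AE x in M. \<psi> x \<in> \<real>\<^sub>\<ge>\<^sub>0) \<and>
                     (\<integral>x. \<psi> x \<partial>M) = 1 \<and>
                     Lp_norm p M (\<lambda>x. \<psi> x - 1) \<le> C' * h powr (1 / p - \<epsilon>)))))))"
proof -
  obtain K \<theta> \<delta>1 where K: "K > 0" and \<theta>: "0 < \<theta>" "\<theta> < 1" and \<delta>1: "\<delta>1 > 0" and decay:
    "\<And>(M :: 'a measure) T H f j. gap_markov \<kappa> M T \<Longrightarrow> H \<in> sets M \<Longrightarrow> measure M H \<le> \<delta>1 \<Longrightarrow>
       f \<in> Lp p M \<Longrightarrow>
       Lp_norm p M ((hole_markov.centered_hole M T H ^^ j) f) \<le> K * \<theta> ^ j * Lp_norm p M f"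
    by (rule uniform_contraction[OF \<kappa> p]) (rule that; assumption)
  obtain n t where t: "t > 0" and trunc: 
    "\<And>(M :: 'a measure) T (f :: 'a \<Rightarrow> complex) (F :: 'a \<Rightarrow> complex). gap_markov \<kappa> M T \<Longrightarrow> f \<in> Lp p M \<Longrightarrow> Lp_norm p M f \<le> 1 \<Longrightarrow>
        F \<in> borel_measurable M \<Longrightarrow>
        AE x in M. norm (F x) \<le> markov_op.Tr (T ^^ n) (\<lambda>x. norm (f x)) x \<Longrightarrow>
        (\<lambda>x. if norm (F x) \<le> t then 0 else F x) \<in> Lp p M \<and>
        Lp_norm p M (\<lambda>x. if norm (F x) \<le> t then 0 else F x) \<le> 1 / 4"
    by (rule uniform_truncation[OF \<kappa> p, of "1 / 4"]) auto
  define \<rho> where "\<rho> = (1 - \<theta>) / 2"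
  define c where "c = 2 * K / \<rho>"
  have \<rho>: "\<rho> > 0" "\<rho> < 1" using \<theta> by (auto simp: \<rho>_def)
  have c: "c > 0" using K \<rho> by (simp add: c_def)
  show ?thesis
  \<comment> \<open>The radius lies halfway between the decay rate and 1, so that the resolvent
    bounds outside it are uniform.\<close>
  proof (rule exI[of _ "1 - \<rho>"], intro conjI allI impI)
    show "0 < 1 - \<rho>" "1 - \<rho> < 1" using \<rho> by auto
    fix \<epsilon> :: real assume \<epsilon>: "0 < \<epsilon> \<and> \<epsilon> < 1 / p"
    have \<epsilon>1: "\<epsilon> < 1" using \<epsilon> p by (smt (verit) divide_less_eq_1)
    \<comment> \<open>q > 1 is needed for the contraction, q <= p for the inclusion of L^p in L^q,
      and 1 / q >= 1 - \<epsilon> for the exponent. The minimum matters when p < 2.\<close>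
    define q where "q = min p (1 / (1 - \<epsilon>))"
    have q: "1 < q" "q \<le> p" "1 - \<epsilon> \<le> 1 / q"
      using \<epsilon> \<epsilon>1 p by (auto simp: q_def min_def field_simps)
    obtain Kq \<theta>q \<delta>2 where Kq: "Kq > 0" and \<theta>q: "0 < \<theta>q" "\<theta>q < 1" and \<delta>2: "\<delta>2 > 0" and decayq:
      "\<And>(M :: 'a measure) T H f j. gap_markov \<kappa> M T \<Longrightarrow> H \<in> sets M \<Longrightarrow> measure M H \<le> \<delta>2 \<Longrightarrow>
         f \<in> Lp q M \<Longrightarrow>
         Lp_norm q M ((hole_markov.centered_hole M T H ^^ j) f) \<le> Kq * \<theta>q ^ j * Lp_norm q M f"
      by (rule uniform_contraction[OF \<kappa> q(1)]) (rule that; assumption)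
    define \<rho>q where "\<rho>q = (1 - \<theta>q) / 2"
    have \<rho>q: "\<rho>q > 0" using \<theta>q by (simp add: \<rho>q_def)
    \<comment> \<open>The summand 1 absorbs the term h itself, which is at most h^(1 - \<epsilon>);
      the other is the constant of the L^q estimate.\<close>
    define Cbar where "Cbar = 1 + 2 * Kq / \<rho>q"
    have Cbar: "Cbar > 0" using Kq \<rho>q by (simp add: Cbar_def add_pos_pos)
    define S where "S = (\<lambda>x::real. x + c * x powr (1 / p))"
    have S: "(S \<longlongrightarrow> 0) (at_right 0)"
      unfolding S_def using tendsto_add[OF tendsto_ident_at tendsto_powr_at_right_0[of "1 / p" c]] p by simp
    note P = tendsto_powr_at_right_0[of "1 / p"]
    have nS: "((\<lambda>x. real n * S x) \<longlongrightarrow> 0) (at_right 0)" using tendsto_mult_left[OF S, of "real n"] by simp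
    \<comment> \<open>All smallness conditions hold near 0 from the right, so one positive \<delta>
      serves them together. Each is monotone in the measure of the hole, which extends it to smaller
      holes, null holes included.\<close>
    have "\<forall>\<^sub>F x in at_right 0. x < \<delta>1 \<and> x < \<delta>2 \<and> S x < \<rho> \<and> S x < \<rho>q \<and> (K / \<rho> * c) * x powr (1 / p) < 1 / 2 \<and>
       (t * c) * x powr (1 / p) < 1 / 8 \<and> real n * S x < 1 / 4 \<and> Cbar * x powr (1 - \<epsilon>) < \<rho> \<and> x < 1 \<and> 0 < x"
      using order_tendstoD(2)[OF tendsto_ident_at, of 0 \<delta>1 "{0<..}"] order_tendstoD(2)[OF tendsto_ident_at, of 0 \<delta>2 "{0<..}"]
        order_tendstoD(2)[OF S, of \<rho>] order_tendstoD(2)[OF S, of \<rho>q] order_tendstoD(2)[OF P, of "1/2" "K / \<rho> * c"]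
        order_tendstoD(2)[OF P, of "1/8" "t * c"] order_tendstoD(2)[OF nS, of "1/4"]
        order_tendstoD(2)[OF tendsto_powr_at_right_0[of "1 - \<epsilon>" Cbar], of \<rho>]
        order_tendstoD(2)[OF tendsto_ident_at, of "0::real" 1 "{0<..}"] eventually_at_right_less[of "0::real"]
        \<delta>1 \<delta>2 \<rho> \<rho>q \<epsilon>1 p
      by (intro eventually_conj) auto
    then obtain \<delta> :: real where \<delta>: "\<delta> < \<delta>1" "\<delta> < \<delta>2" "S \<delta> < \<rho>" "S \<delta> < \<rho>q" "(K / \<rho> * c) * \<delta> powr (1 / p) < 1 / 2"
       "(t * c) * \<delta> powr (1 / p) < 1 / 8" "real n * S \<delta> < 1 / 4" "Cbar * \<delta> powr (1 - \<epsilon>) < \<rho>" "\<delta> < 1" "0 < \<delta>"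
      using eventually_happens'[OF trivial_limit_at_right_real] by (metis (mono_tags, lifting))
    show "\<exists>\<delta>>0. \<exists>C' Cbar::real. C' > 0 \<and> Cbar > 0 \<and>
        (\<forall>(M :: 'a measure) T H. gap_markov \<kappa> M T \<and> H \<in> sets M \<and> measure M H \<le> \<delta> \<longrightarrow>
          (let A = hole_markov.hole M T H; h = measure M H; D = cball 1 (Cbar * h powr (1 - \<epsilon>))
           in Lp_spectrum p M A \<subseteq> cball 0 (1 - \<rho>) \<union> D \<and>
               (\<exists>z0\<in>D. Lp_simple_eigenvalue p M A z0 \<and>
                  (\<forall>z\<in>D. Lp_eigenvalue p M A z \<longrightarrow> z = z0) \<and>
                  (\<exists>\<psi>. Lp_eigenvector p M A z0 \<psi> \<and>
                     (AE x in M. \<psi> x \<in> \<real>\<^sub>\<ge>\<^sub>0) \<and>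
                     (\<integral>x. \<psi> x \<partial>M) = 1 \<and>
                     Lp_norm p M (\<lambda>x. \<psi> x - 1) \<le> C' * h powr (1 / p - \<epsilon>)))))"
    proof (rule exI[of _ \<delta>], rule conjI[OF \<delta>(10)], rule exI[of _ c], rule exI[of _ Cbar],
        intro conjI allI impI c Cbar)
      fix M :: "'a measure" and T H
      assume *: "gap_markov \<kappa> M T \<and> H \<in> sets M \<and> measure M H \<le> \<delta>"
      interpret markov_op M T using * by (simp add: gap_markov_def)
      interpret hole_markov M T H by unfold_locales (use * in simp)
      have h: "0 \<le> h" "h \<le> \<delta>" "h \<le> 1" using * by auto
      have hp: "h powr a \<le> \<delta> powr a" if "a \<ge> 0" for a using h that by (intro powr_mono2) auto
      have Sh: "h + c * h powr (1 / p) \<le> S \<delta>"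
        unfolding S_def using h hp[of "1 / p"] p c by (intro add_mono mult_left_mono) auto
      have Ph: "a * h powr (1 / p) \<le> a * \<delta> powr (1 / p)" if "a \<ge> 0" for a
        using hp[of "1 / p"] p that by (intro mult_left_mono) auto
      have p1: "p \<ge> 1" using p by simp
      have con: "Lp_contraction M p centered_hole K \<theta>"
        using * \<delta>(1) K \<theta> p1 Lp_bounded_linear_centered_hole[OF p1] decay[of M T H]
        by unfold_locales auto
      interpret hole_contraction M T H p K \<theta> \<rho> c
      proof (intro hole_contraction.intro hole_contraction_axioms.intro hole_markov_axioms con \<theta>(2))
        show "h + 2 * K / ((1 - \<theta>) / 2) * h powr (1 / p) \<le> (1 - \<theta>) / 2"
          using Sh \<delta>(3) by (simp add: c_def \<rho>_def)
        show "K / ((1 - \<theta>) / 2) * (2 * K / ((1 - \<theta>) / 2) * h powr (1 / p)) \<le> 1 / 2"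
        proof -
          have "K / \<rho> * c * h powr (1 / p) \<le> 1 / 2" using order_trans[OF Ph less_imp_le[OF \<delta>(5)]] K \<rho> c by simp
          then show ?thesis unfolding c_def \<rho>_def mult.assoc .
        qed
      qed (simp_all add: c_def \<rho>_def)
      have conq: "Lp_contraction M q centered_hole Kq \<theta>q"
        using * \<delta>(2) Kq \<theta>q q Lp_bounded_linear_centered_hole[of q] decayq[of M T H]
        by unfold_locales auto
      let ?D = "cball 1 (Cbar * h powr (1 - \<epsilon>))"
      have "norm (z0 - 1) \<le> h + 2 * Kq / \<rho>q * h powr (1 / q)"
        unfolding \<rho>q_def using Sh \<delta>(4) q by (intro z0_close_exponent conq \<theta>q) (auto simp: \<rho>q_def)
      also have "\<dots> \<le> h powr (1 - \<epsilon>) + 2 * Kq / \<rho>q * h powr (1 - \<epsilon>)"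
        using h q \<epsilon> \<epsilon>1 Kq \<rho>q powr_mono'[of "1 - \<epsilon>" 1 h] powr_mono'[of "1 - \<epsilon>" "1 / q" h]
        by (intro add_mono mult_left_mono) auto
      also have "\<dots> = Cbar * h powr (1 - \<epsilon>)" by (simp add: Cbar_def distrib_right)
      finally have z0D: "z0 \<in> ?D" by (simp add: dist_norm norm_minus_commute)
      \<comment> \<open>The disk of the statement lies in the region where the eigenvalue is
        unique.\<close>
      have D\<rho>: "norm z \<ge> 1 - \<rho>" if "z \<in> ?D" for z :: complex
      proof (rule norm_ge_of_near_1)
        have "norm (z - 1) \<le> Cbar * h powr (1 - \<epsilon>)" using that by (simp add: dist_norm norm_minus_commute)
        also have "\<dots> \<le> Cbar * \<delta> powr (1 - \<epsilon>)" using hp[of "1 - \<epsilon>"] \<epsilon>1 Cbar by (intro mult_left_mono) auto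
        finally show "norm (z - 1) \<le> \<rho>" using \<delta>(8) by simp
      qed
      have pos: "AE x in M. \<psi> x \<in> \<real>\<^sub>\<ge>\<^sub>0"
      proof (rule \<psi>_nonneg[OF t])
        show "t * (c * h powr (1 / p)) \<le> 1 / 8" 
          using order_trans[OF Ph less_imp_le[OF \<delta>(6)]] t c unfolding mult.assoc by simp
        have "real n * (h + c * h powr (1 / p)) \<le> real n * S \<delta>" using Sh by (intro mult_left_mono) auto
        then show "real n * (h + c * h powr (1 / p)) \<le> 1 / 4" using \<delta>(7) by simp
      qed (use trunc * in blast)
      \<comment> \<open>The estimate holds with exponent 1 / p already; h <= 1 allows the weaker
        exponent.\<close>
      have close: "Lp_norm p M (\<lambda>x. \<psi> x - 1) \<le> c * h powr (1 / p - \<epsilon>)"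
      proof -
        have "h powr (1 / p) \<le> h powr (1 / p - \<epsilon>)" using h \<epsilon> by (intro powr_mono') auto
        then have "c * h powr (1 / p) \<le> c * h powr (1 / p - \<epsilon>)" using c by (intro mult_left_mono) auto
        then show ?thesis using \<psi>_close by simp
      qed
      show "let A = hole; h = h; D = cball 1 (Cbar * h powr (1 - \<epsilon>))
           in Lp_spectrum p M A \<subseteq> cball 0 (1 - \<rho>) \<union> D \<and>
               (\<exists>z0\<in>D. Lp_simple_eigenvalue p M A z0 \<and>
                  (\<forall>z\<in>D. Lp_eigenvalue p M A z \<longrightarrow> z = z0) \<and>
                  (\<exists>\<psi>. Lp_eigenvector p M A z0 \<psi> \<and>
                     (AE x in M. \<psi> x \<in> \<real>\<^sub>\<ge>\<^sub>0) \<and>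
                     (\<integral>x. \<psi> x \<partial>M) = 1 \<and>
                     Lp_norm p M (\<lambda>x. \<psi> x - 1) \<le> c * h powr (1 / p - \<epsilon>)))"
        unfolding Let_def
      proof (intro conjI bexI[OF _ z0D] ballI impI exI[of _ \<psi>])
        show "Lp_spectrum p M hole \<subseteq> cball 0 (1 - \<rho>) \<union> ?D" using hole_spectrum z0D by blast
      qed (use simple_eigenvalue eigenvalue_unique D\<rho> \<psi>_eigenvector pos integral_\<psi> close in auto)
    qed
  qed
qed

section \<open>Transfer to the tensor power\<close>

text \<open>The tensor power is a choice that agrees with a transfer operator only up to null sets,
  so the Markov property has to be carried across almost-everywhere equality.\<close>

lemma markov_op_cong_AE:
  assumes T: "markov_op M T" and eq: "\<And>f. integrable M f \<Longrightarrow> AE x in M. Q f x = T f x"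
    and int: "\<And>f. integrable M f \<Longrightarrow> integrable M (Q f)"
  shows "markov_op M Q"
proof -
  interpret T: markov_op M T by fact
  show ?thesis
  proof
    fix f g :: "'a \<Rightarrow> complex" and c assume f: "integrable M f"
    show "integrable M (Q f)" by (rule int[OF f])
    show "AE x in M. Q (\<lambda>x. f x + g x) x = Q f x + Q g x" if g: "integrable M g"
      using eq[OF Bochner_Integration.integrable_add[OF f g]] eq[OF f] eq[OF g] T.T_add[OF f g] by eventually_elim simp
    show "AE x in M. Q (\<lambda>x. c * f x) x = c * Q f x"
      using eq[OF integrable_mult_right[of c, OF f]] eq[OF f] T.T_scale[OF f, of c] by eventually_elim simp
    show "(\<integral>x. Q f x \<partial>M) = (\<integral>x. f x \<partial>M)"
      using T.T_integral[OF f] T.T_integrable[OF f] int[OF f] eq[OF f] by (subst integral_cong_AE[OF _ _ eq[OF f]]) auto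
    show "AE x in M. Q f x \<in> \<real>\<^sub>\<ge>\<^sub>0" if "AE x in M. f x \<in> \<real>\<^sub>\<ge>\<^sub>0"
      using T.T_nonneg[OF f that] eq[OF f] by eventually_elim simp
  next
    have "integrable M (\<lambda>_. 1 :: complex)" by simp
    from eq[OF this] T.T_one show "AE x in M. Q (\<lambda>_. 1) x = 1" by eventually_elim simp
  qed
qed

lemma markov_op_funpow_cong_AE:
  assumes T: "markov_op M T" and Q: "markov_op M Q" and eq: "\<And>f. integrable M f \<Longrightarrow> AE x in M. Q f x = T f x"
    and f: "integrable M f"
  shows "AE x in M. (Q ^^ n) f x = (T ^^ n) f x"
proof (induction n)
  case (Suc n)
  interpret T: markov_op M T by fact
  interpret Q: markov_op M Q by fact
  have i: "integrable M ((Q ^^ n) f)" "integrable M ((T ^^ n) f)"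
    using markov_op.T_integrable[OF Q.markov_op_funpow f] markov_op.T_integrable[OF T.markov_op_funpow f] by auto
  from eq[OF i(1)] T.T_cong_AE[OF i Suc] show ?case by eventually_elim simp
qed simp

text \<open>The round trip: the gap on one factor passes to the Koopman side, is tensorized there,
  and returns to L^2 of the product.\<close>

lemma (in stationary_kernel) gap_markov_tensor_power_op:
  assumes \<kappa>: "\<And>n. \<kappa> n \<ge> 0"
    and gap: "\<And>n \<phi>. \<phi> \<in> Lp 2 M \<Longrightarrow> (\<integral>x. \<phi> x \<partial>M) = 0 \<Longrightarrow>
       Lp_norm 2 M ((transfer_op K M ^^ n) \<phi>) \<le> \<kappa> n * Lp_norm 2 M \<phi>"
  shows "gap_markov \<kappa> (power_measure M N) (tensor_power_op M N (transfer_op K M))"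
proof -
  define P where "P = power_measure M N"
  have Pdef: "P = PiM {..<N} (\<lambda>_. M)" by (simp add: P_def power_measure_def)
  interpret P: stationary_kernel P "product_kernel {..<N} K"
    unfolding Pdef by (rule product_stationary) simp
  let ?T = "transfer_op (product_kernel {..<N} K) P" and ?Q = "tensor_power_op M N (transfer_op K M)"
  have T: "markov_op P ?T" by (rule P.transfer.markov_op_axioms)
  have eq: "AE x in P. ?Q f x = ?T f x" if "integrable P f" for f by (rule tensor_power_op_eq[OF P_def that])
  have Q: "markov_op P ?Q"
    using tensor_power_op_bounded_linear[OF P_def] P.Lp_1_iff
    by (intro markov_op_cong_AE[OF T eq]) (auto dest: Lp_bounded_linear_Lp)
  have "L2_gap P (?Q ^^ n) (\<kappa> n)" if "\<kappa> n \<le> 1" for n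
    unfolding L2_gap_def
  proof (intro allI impI)
    fix g assume g: "(\<lambda>x. complex_of_real (g x)) \<in> Lp 2 P"
    have "koopman_contracts M (kernel_power M K n) (\<kappa> n)" by (rule koopman_contracts_of_gap[OF \<kappa> gap])
    then have kc: "koopman_contracts P (kernel_power P (product_kernel {..<N} K) n) (\<kappa> n)"
      unfolding Pdef using \<kappa> that by (intro koopman_contracts_kernel_power_product) auto
    let ?w = "\<lambda>S x. S (\<lambda>x. complex_of_real (g x)) x - complex_of_real (\<integral>x. g x \<partial>P)"
    have gi: "integrable P (\<lambda>x. complex_of_real (g x))" using P.Lp_integrable[OF g] by simp
    have ae: "AE x in P. ?w (?Q ^^ n) x = ?w (?T ^^ n) x"
    proof -
      have "AE x in P. (?Q ^^ n) (\<lambda>x. complex_of_real (g x)) x = (?T ^^ n) (\<lambda>x. complex_of_real (g x)) x"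
        by (rule markov_op_funpow_cong_AE[OF T Q _ gi]) (rule eq)
      then show ?thesis by eventually_elim simp
    qed
    have m: "?w (?Q ^^ n) \<in> borel_measurable P"
      using markov_op.T_integrable[OF markov_op.markov_op_funpow[OF Q] gi] by auto
    note TL = P.Lp_2_transfer_gap[OF kc \<kappa> g]
    show "?w (?Q ^^ n) \<in> Lp 2 P \<and> Lp_norm 2 P (?w (?Q ^^ n)) \<le> \<kappa> n * Lp_norm 2 P (\<lambda>x. complex_of_real (g x))"
      using Lp_cong_AE[OF TL(1) m ae] Lp_norm_cong_AE[OF m Lp_measurable[OF TL(1)] ae, of 2] TL(2) by simp
  qed
  with Q show ?thesis by (simp add: gap_markov_def P_def)
qed

theorem theorem2p1:
  fixes K :: "complex \<Rightarrow> complex measure" and \<mu> :: "complex measure"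
    and C \<gamma> :: real and H :: "nat \<Rightarrow> (nat \<Rightarrow> complex) set"
  assumes kernel: "markov_kernel circle K"
    and stationary: "stationary_measure circle K \<mu>"
    and C: "C > 0" and \<gamma>: "0 < \<gamma>" "\<gamma> < 1"
    and gap: "\<And>k \<phi>. \<phi> \<in> Lp 2 \<mu> \<Longrightarrow> (\<integral>x. \<phi> x \<partial>\<mu>) = 0 \<Longrightarrow>
               Lp_norm 2 \<mu> ((transfer_op K \<mu> ^^ k) \<phi>) \<le> C * \<gamma> ^ k * Lp_norm 2 \<mu> \<phi>"
    and H_sets: "\<And>N. N \<ge> 1 \<Longrightarrow> H N \<in> sets (power_measure circle N)"
    and H_lim: "(\<lambda>N. measure (power_measure \<mu> N) (H N)) \<longlonglongrightarrow> 0"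
  shows "\<forall>p::real. p > 1 \<longrightarrow>
    (\<exists>\<theta>::real. 0 < \<theta> \<and> \<theta> < 1 \<and>
      (\<forall>\<epsilon>::real. 0 < \<epsilon> \<and> \<epsilon> < 1 / p \<longrightarrow>
        (\<exists>N0::nat. \<exists>C' Cbar::real. N0 \<ge> 1 \<and> C' > 0 \<and> Cbar > 0 \<and>
          (\<forall>N\<ge>N0.
            let \<mu>N = power_measure \<mu> N;
                A = hole_op K \<mu> N (H N);
                h = measure \<mu>N (H N);
                D = cball 1 (Cbar * h powr (1 - \<epsilon>))
            in Lp_spectrum p \<mu>N A \<subseteq> cball 0 \<theta> \<union> D \<and>
               (\<exists>z0\<in>D. Lp_simple_eigenvalue p \<mu>N A z0 \<and>
                  (\<forall>z\<in>D. Lp_eigenvalue p \<mu>N A z \<longrightarrow> z = z0) \<and>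
                  (\<exists>\<psi>. Lp_eigenvector p \<mu>N A z0 \<psi> \<and>
                     (AE x in \<mu>N. \<psi> x \<in> \<real>\<^sub>\<ge>\<^sub>0) \<and>
                     (\<integral>x. \<psi> x \<partial>\<mu>N) = 1 \<and>
                     Lp_norm p \<mu>N (\<lambda>x. \<psi> x - 1) \<le> C' * h powr (1 / p - \<epsilon>)))))))"
proof (intro allI impI)
  fix p :: real assume p: "p > 1"
  have sets_\<mu>: "sets \<mu> = sets circle" and prob_\<mu>: "prob_space \<mu>" and bind_\<mu>: "\<mu> \<bind> K = \<mu>"
    using stationary by (auto simp: stationary_measure_def)
  \<comment> \<open>The kernel is given on the circle; \<mu> has the same measurable sets, so it is
    also a kernel over \<mu>.\<close>
  have "K \<in> \<mu> \<rightarrow>\<^sub>M prob_algebra \<mu>"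
    using kernel unfolding markov_kernel_def prob_algebra_def subprob_algebra_cong[OF sets_\<mu>]
    by (simp add: measurable_cong_sets[OF sets_\<mu> refl])
  then interpret stationary_kernel \<mu> K
    using prob_\<mu> bind_\<mu> by (simp add: stationary_kernel_def stationary_kernel_axioms_def)
  let ?\<kappa> = "\<lambda>n. C * \<gamma> ^ n"
  let ?Q = "\<lambda>N. tensor_power_op \<mu> N (transfer_op K \<mu>)"
  have \<kappa>: "?\<kappa> \<longlonglongrightarrow> 0" "?\<kappa> n \<ge> 0" for n
    using C \<gamma> tendsto_mult_left[OF LIMSEQ_power_zero[of \<gamma>], of C] by auto
  have Q: "gap_markov ?\<kappa> (power_measure \<mu> N) (?Q N)" for N
    using \<kappa>(2) gap by (rule gap_markov_tensor_power_op)
  have sets_H: "H N \<in> sets (power_measure \<mu> N)" if "N \<ge> 1" for N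
    using H_sets[OF that] sets_PiM_cong[OF refl sets_\<mu>, of "{..<N}"] by (simp add: power_measure_def)
  have hole: "hole_markov.hole (power_measure \<mu> N) (?Q N) (H N) = hole_op K \<mu> N (H N)" if "N \<ge> 1" for N
  proof -
    have "hole_markov (power_measure \<mu> N) (?Q N) (H N)"
      using Q sets_H[OF that] by (simp add: gap_markov_def hole_markov_def hole_markov_axioms_def)
    then show ?thesis
      by (simp add: fun_eq_iff hole_markov.hole_def hole_markov.cut_def hole_op_def)
  qed
  obtain \<theta> :: real where \<theta>: "0 < \<theta>" "\<theta> < 1" and main: 
    "\<And>\<epsilon>::real. 0 < \<epsilon> \<and> \<epsilon> < 1 / p \<Longrightarrow>
      (\<exists>\<delta>>0. \<exists>C' Cbar::real. C' > 0 \<and> Cbar > 0 \<and>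
        (\<forall>(M :: (nat \<Rightarrow> complex) measure) T H. gap_markov ?\<kappa> M T \<and> H \<in> sets M \<and> measure M H \<le> \<delta> \<longrightarrow>
          (let A = hole_markov.hole M T H; h = measure M H; D = cball 1 (Cbar * h powr (1 - \<epsilon>))
           in Lp_spectrum p M A \<subseteq> cball 0 \<theta> \<union> D \<and>
               (\<exists>z0\<in>D. Lp_simple_eigenvalue p M A z0 \<and>
                  (\<forall>z\<in>D. Lp_eigenvalue p M A z \<longrightarrow> z = z0) \<and>
                  (\<exists>\<psi>. Lp_eigenvector p M A z0 \<psi> \<and>
                     (AE x in M. \<psi> x \<in> \<real>\<^sub>\<ge>\<^sub>0) \<and>
                     (\<integral>x. \<psi> x \<partial>M) = 1 \<and>
                     Lp_norm p M (\<lambda>x. \<psi> x - 1) \<le> C' * h powr (1 / p - \<epsilon>))))))"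
    using uniform_hole_spectrum[OF \<kappa> p, where 'a="nat \<Rightarrow> complex"] by blast
  show "\<exists>\<theta>::real. 0 < \<theta> \<and> \<theta> < 1 \<and>
      (\<forall>\<epsilon>::real. 0 < \<epsilon> \<and> \<epsilon> < 1 / p \<longrightarrow>
        (\<exists>N0::nat. \<exists>C' Cbar::real. N0 \<ge> 1 \<and> C' > 0 \<and> Cbar > 0 \<and>
          (\<forall>N\<ge>N0.
            let \<mu>N = power_measure \<mu> N;
                A = hole_op K \<mu> N (H N);
                h = measure \<mu>N (H N);
                D = cball 1 (Cbar * h powr (1 - \<epsilon>))
            in Lp_spectrum p \<mu>N A \<subseteq> cball 0 \<theta> \<union> D \<and>
               (\<exists>z0\<in>D. Lp_simple_eigenvalue p \<mu>N A z0 \<and>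
                  (\<forall>z\<in>D. Lp_eigenvalue p \<mu>N A z \<longrightarrow> z = z0) \<and>
                  (\<exists>\<psi>. Lp_eigenvector p \<mu>N A z0 \<psi> \<and>
                     (AE x in \<mu>N. \<psi> x \<in> \<real>\<^sub>\<ge>\<^sub>0) \<and>
                     (\<integral>x. \<psi> x \<partial>\<mu>N) = 1 \<and>
                     Lp_norm p \<mu>N (\<lambda>x. \<psi> x - 1) \<le> C' * h powr (1 / p - \<epsilon>))))))"
  proof (rule exI[of _ \<theta>], intro conjI \<theta> allI impI)
    fix \<epsilon> :: real assume "0 < \<epsilon> \<and> \<epsilon> < 1 / p"
    from main[OF this] obtain \<delta> C' Cbar where \<delta>: "\<delta> > 0" and CC: "C' > 0" "Cbar > 0" and main':
      "\<And>(M :: (nat \<Rightarrow> complex) measure) T H. gap_markov ?\<kappa> M T \<and> H \<in> sets M \<and> measure M H \<le> \<delta> \<Longrightarrow>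
          (let A = hole_markov.hole M T H; h = measure M H; D = cball 1 (Cbar * h powr (1 - \<epsilon>))
           in Lp_spectrum p M A \<subseteq> cball 0 \<theta> \<union> D \<and>
               (\<exists>z0\<in>D. Lp_simple_eigenvalue p M A z0 \<and>
                  (\<forall>z\<in>D. Lp_eigenvalue p M A z \<longrightarrow> z = z0) \<and>
                  (\<exists>\<psi>. Lp_eigenvector p M A z0 \<psi> \<and>
                     (AE x in M. \<psi> x \<in> \<real>\<^sub>\<ge>\<^sub>0) \<and>
                     (\<integral>x. \<psi> x \<partial>M) = 1 \<and>
                     Lp_norm p M (\<lambda>x. \<psi> x - 1) \<le> C' * h powr (1 / p - \<epsilon>))))" by blast
    have "\<forall>\<^sub>F N in sequentially. measure (power_measure \<mu> N) (H N) < \<delta>"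
      using H_lim \<delta> by (rule order_tendstoD)
    then obtain N1 where N1: "\<And>N. N \<ge> N1 \<Longrightarrow> measure (power_measure \<mu> N) (H N) < \<delta>"
      by (auto simp: eventually_sequentially)
    \<comment> \<open>N >= 1 is imposed because measurability of \<open>H N\<close> is available
      only from there on.\<close>
    have "gap_markov ?\<kappa> (power_measure \<mu> N) (?Q N) \<and> H N \<in> sets (power_measure \<mu> N) \<and> measure (power_measure \<mu> N) (H N) \<le> \<delta>"
      if "N \<ge> max 1 N1" for N
      using Q sets_H[of N] N1[of N] that by (auto intro: less_imp_le)
    note fin = main'[OF this, unfolded Let_def]
    show "\<exists>N0::nat. \<exists>C' Cbar::real. N0 \<ge> 1 \<and> C' > 0 \<and> Cbar > 0 \<and>
          (\<forall>N\<ge>N0.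
            let \<mu>N = power_measure \<mu> N;
                A = hole_op K \<mu> N (H N);
                h = measure \<mu>N (H N);
                D = cball 1 (Cbar * h powr (1 - \<epsilon>))
            in Lp_spectrum p \<mu>N A \<subseteq> cball 0 \<theta> \<union> D \<and>
               (\<exists>z0\<in>D. Lp_simple_eigenvalue p \<mu>N A z0 \<and>
                  (\<forall>z\<in>D. Lp_eigenvalue p \<mu>N A z \<longrightarrow> z = z0) \<and>
                  (\<exists>\<psi>. Lp_eigenvector p \<mu>N A z0 \<psi> \<and>
                     (AE x in \<mu>N. \<psi> x \<in> \<real>\<^sub>\<ge>\<^sub>0) \<and>
                     (\<integral>x. \<psi> x \<partial>\<mu>N) = 1 \<and>
                     Lp_norm p \<mu>N (\<lambda>x. \<psi> x - 1) \<le> C' * h powr (1 / p - \<epsilon>))))"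
      unfolding Let_def
    proof (rule exI[of _ "max 1 N1"], rule exI[of _ C'], rule exI[of _ Cbar], intro conjI CC allI impI)
      fix N assume N: "N \<ge> max 1 N1"
      then have N': "N \<ge> 1" by simp
      note fin[OF N, unfolded hole[OF N']]
      then show "Lp_spectrum p (power_measure \<mu> N) (hole_op K \<mu> N (H N))
          \<subseteq> cball 0 \<theta> \<union> cball 1 (Cbar * measure (power_measure \<mu> N) (H N) powr (1 - \<epsilon>))"
        and "\<exists>z0\<in>cball 1 (Cbar * measure (power_measure \<mu> N) (H N) powr (1 - \<epsilon>)).
           Lp_simple_eigenvalue p (power_measure \<mu> N) (hole_op K \<mu> N (H N)) z0 \<and>
           (\<forall>z\<in>cball 1 (Cbar * measure (power_measure \<mu> N) (H N) powr (1 - \<epsilon>)).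
             Lp_eigenvalue p (power_measure \<mu> N) (hole_op K \<mu> N (H N)) z \<longrightarrow> z = z0) \<and>
           (\<exists>\<psi>. Lp_eigenvector p (power_measure \<mu> N) (hole_op K \<mu> N (H N)) z0 \<psi> \<and>
              (AE x in power_measure \<mu> N. \<psi> x \<in> \<real>\<^sub>\<ge>\<^sub>0) \<and>
              (\<integral>x. \<psi> x \<partial>power_measure \<mu> N) = 1 \<and>
              Lp_norm p (power_measure \<mu> N) (\<lambda>x. \<psi> x - 1) \<le> C' * measure (power_measure \<mu> N) (H N) powr (1 / p - \<epsilon>))"
        by blast+
    qed simp
  qed
qed

end
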